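(* Let $d\in\mathbb N$ and $p\in[1,\infty]$. Let $u,v>0$ with $\frac1u+\frac1v=1$. Then for any $\varphi,\psi\in L^p(\mathbb R^d,\mu)$, $\Gamma(1/\sqrt u)\varphi\diamond\Gamma(1/\sqrt v)\psi\in L^p(\mathbb R^d,\mu)$ and $$\Big\|\Gamma\big(\tfrac1{\sqrt u}\big)\varphi\diamond\Gamma\big(\tfrac1{\sqrt v}\big)\psi\Big\|_p\le\|\varphi\|_p\,\|\psi\|_p.$$
   Context: $\mu$ is the standard Gaussian probability measure on $\mathbb R^d$ and $\|\cdot\|_p$ is the norm of $L^p(\mathbb R^d,\mu)$. Gaussian chaos setting: $L^2(\mathbb R^d,\mu)=\bigoplus_{n\ge0}G_n$, $G_0=\mathbb C$, $G_n=\overline{F_n}\ominus\overline{F_{n-1}}$ with $F_n$ the polynomials of degree $\le n$ in the coordinates; $P_n$ the orthogonal projection onto $G_n$. Wick product: $\varphi\diamond\psi=P_{m+n}(\varphi\psi)$ for $\varphi\in G_m,\psi\in G_n$, extended bilinearly ($\varphi\diamond\psi=\sum_k\sum_{i+j=k}f_i\diamond g_j$ for $\varphi=\sum f_n$, $\psi=\sum g_n$). Second quantization: $\Gamma(c)\sum f_n=\sum c^nf_n$; for real $|c|\le1$ it extends to a norm-one operator on each $L^p(\mu)$, $1\le p\le\infty$. For $1/u+1/v=1$ the bilinear map $(\varphi,\psi)\mapsto\Gamma(1/\sqrt u)\varphi\diamond\Gamma(1/\sqrt v)\psi$, bounded on $L^2\times L^2\to L^2$, extends uniquely continuously to $L^1\times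 L^1\to L^1$, and this extension is what the expression means for general $L^p$ arguments. *)

theory Defs
  imports "HOL-Probability.Probability"
begin

text \<open>Standard Gaussian measure on R^d; points of R^d are represented as
  (extensional) functions nat => real on the index set {..<d}.\<close>
definition gauss :: "nat \<Rightarrow> (nat \<Rightarrow> real) measure" where
  "gauss d = PiM {..<d} (\<lambda>_. density lborel std_normal_density)"

definition Lp_norm :: "'a measure \<Rightarrow> ennreal \<Rightarrow> ('a \<Rightarrow> complex) \<Rightarrow> ennreal" where
  "Lp_norm M p f =
     (if p = \<top> then esssup M (\<lambda>x. ennreal (norm (f x)))
      else (let I = (\<integral>\<^sup>+ x. ennreal (norm (f x) powr enn2real p) \<partial>M)
            in if I = \<top> then \<top> else ennreal (enn2real I powr (1 / enn2real p))))"

definition Lp_mem :: "'a measure \<Rightarrow> ennreal \<Rightarrow> ('a \<Rightarrow> complex) \<Rightarrow> bool" where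
  "Lp_mem M p f \<longleftrightarrow> f \<in> borel_measurable M \<and> Lp_norm M p f < \<top>"

definition L2_inner :: "'a measure \<Rightarrow> ('a \<Rightarrow> complex) \<Rightarrow> ('a \<Rightarrow> complex) \<Rightarrow> complex" where
  "L2_inner M f g = (\<integral>x. f x * cnj (g x) \<partial>M)"

definition L2_closure :: "'a measure \<Rightarrow> ('a \<Rightarrow> complex) set \<Rightarrow> ('a \<Rightarrow> complex) set" where
  "L2_closure M S = {f. Lp_mem M 2 f \<and>
      (\<forall>e>0. \<exists>g\<in>S. Lp_norm M 2 (\<lambda>x. f x - g x) < ennreal e)}"

definition polys :: "nat \<Rightarrow> nat \<Rightarrow> ((nat \<Rightarrow> real) \<Rightarrow> complex) set" where
  "polys d n = {(\<lambda>x. \<Sum>a\<in>A. c a * (\<Prod>i<d. complex_of_real (x i) ^ a i)) | A c.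
       finite A \<and> (\<forall>a\<in>A. (\<Sum>i<d. a i) \<le> n)}"

definition chaos :: "nat \<Rightarrow> nat \<Rightarrow> ((nat \<Rightarrow> real) \<Rightarrow> complex) set" where
  "chaos d n = {f. f \<in> L2_closure (gauss d) (polys d n) \<and>
      (n > 0 \<longrightarrow> (\<forall>g \<in> L2_closure (gauss d) (polys d (n - 1)). L2_inner (gauss d) f g = 0))}"

text \<open>Orthogonal projection P_n onto G_n (determined up to a.e. equality).\<close>
definition proj :: "nat \<Rightarrow> nat \<Rightarrow> ((nat \<Rightarrow> real) \<Rightarrow> complex) \<Rightarrow> ((nat \<Rightarrow> real) \<Rightarrow> complex)" where
  "proj d n f = (SOME g. g \<in> chaos d n \<and>
      (\<forall>h \<in> chaos d n. L2_inner (gauss d) (\<lambda>x. f x - g x) h = 0))"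

definition L2_lim :: "'a measure \<Rightarrow> (nat \<Rightarrow> 'a \<Rightarrow> complex) \<Rightarrow> ('a \<Rightarrow> complex)" where
  "L2_lim M F = (SOME S. Lp_mem M 2 S \<and>
      (\<lambda>k. Lp_norm M 2 (\<lambda>x. F k x - S x)) \<longlonglongrightarrow> 0)"

definition second_quant :: "nat \<Rightarrow> real \<Rightarrow> ((nat \<Rightarrow> real) \<Rightarrow> complex) \<Rightarrow> ((nat \<Rightarrow> real) \<Rightarrow> complex)" where
  "second_quant d c f = L2_lim (gauss d)
      (\<lambda>N x. \<Sum>n\<le>N. complex_of_real (c ^ n) * proj d n f x)"

definition wick :: "nat \<Rightarrow> ((nat \<Rightarrow> real) \<Rightarrow> complex) \<Rightarrow> ((nat \<Rightarrow> real) \<Rightarrow> complex) \<Rightarrow> ((nat \<Rightarrow> real) \<Rightarrow> complex)" where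
  "wick d f g = L2_lim (gauss d)
      (\<lambda>K x. \<Sum>k\<le>K. \<Sum>i\<le>k. proj d k (\<lambda>y. proj d i f y * proj d (k - i) g y) x)"

definition wick_uv :: "nat \<Rightarrow> real \<Rightarrow> real \<Rightarrow> ((nat \<Rightarrow> real) \<Rightarrow> complex) \<Rightarrow> ((nat \<Rightarrow> real) \<Rightarrow> complex) \<Rightarrow> ((nat \<Rightarrow> real) \<Rightarrow> complex)" where
  "wick_uv d u v f g = wick d (second_quant d (1 / sqrt u) f) (second_quant d (1 / sqrt v) g)"

text \<open>Its continuous extension L^1 x L^1 -> L^1: the L^1-limit of wick_uv along
  any L^2 sequences converging in L^1.\<close>
definition wick_uv_ext :: "nat \<Rightarrow> real \<Rightarrow> real \<Rightarrow> ((nat \<Rightarrow> real) \<Rightarrow> complex) \<Rightarrow> ((nat \<Rightarrow> real) \<Rightarrow> complex) \<Rightarrow> ((nat \<Rightarrow> real) \<Rightarrow> complex)" where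
  "wick_uv_ext d u v f g = (SOME F. Lp_mem (gauss d) 1 F \<and>
     (\<forall>fs gs. (\<forall>k. Lp_mem (gauss d) 2 (fs k) \<and> Lp_mem (gauss d) 2 (gs k)) \<and>
        (\<lambda>k. Lp_norm (gauss d) 1 (\<lambda>x. fs k x - f x)) \<longlonglongrightarrow> 0 \<and>
        (\<lambda>k. Lp_norm (gauss d) 1 (\<lambda>x. gs k x - g x)) \<longlonglongrightarrow> 0 \<longrightarrow>
        (\<lambda>k. Lp_norm (gauss d) 1 (\<lambda>x. wick_uv d u v (fs k) (gs k) x - F x)) \<longlonglongrightarrow> 0))"

end

(* With a = 1/sqrt u, b = 1/sqrt v (so that a^2 + b^2 = 1) the bilinear map has the integral representation
     T(f,g)(x) = INT f(ax + by) g(bx - ay) dmu(y).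
   The map (x,y) |-> (ax + by, bx - ay) is an involution preserving mu x mu, so Jensen's inequality in y and Fubini
   give the bound on L^p at once; the work is to show that T is the Wick expression.
   Moving the rotation to a test polynomial q turns <T(f,g),q> into the double integral of f(s) g(t) q(as + bt),
   conjugated in q; expanding q in monomials in s and t shows that T(f,g) is in the chaos of order i + j if f and g are
   in those of order i and j.  Moreover T(f,g) and a^i b^j f g have the same leading part, whence
   T(f,g) = a^i b^j P_{i+j}(f g).  Density of the polynomials in L^2 then extends the identity to all of L^2, with
   Gamma(a) f = T(f,1) as a special case, and continuity of T extends it to L^1. *)

theory Submission
  imports Defs
begin

section \<open>Square-integrable functions and finite-dimensional projections\<close>

text \<open>The formula for \<open>T\<close> can be read off from exponential vectors: for
  \<open>e_h(x) = exp(h.x - |h|^2/2)\<close>, the Gaussian integral over \<open>y\<close> of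
  \<open>e_h(ax + by) e_k(bx - ay)\<close> is \<open>e_{ah+bk}(x)\<close>, the Wick product of
  \<open>e_{ah} = Gamma(a) e_h\<close> and \<open>e_{bk} = Gamma(b) e_k\<close>. The proof works
  with polynomials instead, because every space and projection in the definitions is given by
  orthogonality to polynomials. A test polynomial \<open>q\<close> also cuts the problem down to
  finite dimension: the monomials of \<open>q(as + bt)\<close> have total degree at most
  \<open>deg q\<close>, so \<open>q\<close> sees \<open>T(f,g)\<close> only through products of
  moments of \<open>f\<close> and \<open>g\<close> up to that total degree. If
  \<open>deg q < i + j\<close>, each such monomial has degree below \<open>i\<close> in
  \<open>s\<close> or below \<open>j\<close> in \<open>t\<close>, which is the source of all
  orthogonality relations. The obstacle is that \<open>proj\<close>, \<open>L2_lim\<close> and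
  \<open>wick_uv_ext\<close> are arbitrary choices, fixed only up to null sets. Each is compared
  almost everywhere with a concrete representative: a genuine polynomial for a chaos component,
  \<open>rotprod\<close> for the operators.\<close>

definition sqint :: "'a measure \<Rightarrow> ('a \<Rightarrow> complex) \<Rightarrow> bool" where
  "sqint M f \<longleftrightarrow> f \<in> borel_measurable M \<and> integrable M (\<lambda>x. (norm (f x))\<^sup>2)"

text \<open>Squares of norms avoid roots; the quasi-triangle inequality with factor 2 in
  \<open>sqn_triangle\<close> is enough for every limit argument below.\<close>

definition sqn :: "'a measure \<Rightarrow> ('a \<Rightarrow> complex) \<Rightarrow> real" where
  "sqn M f = (\<integral>x. (norm (f x))\<^sup>2 \<partial>M)"

lemma sqint_measurable [measurable_dest]: "sqint M f \<Longrightarrow> f \<in> borel_measurable M"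
  by (simp add: sqint_def)

lemma sqint_integrable: "sqint M f \<Longrightarrow> integrable M (\<lambda>x. (norm (f x))\<^sup>2)"
  by (simp add: sqint_def)

lemma sqn_nonneg: "0 \<le> sqn M f"
  by (simp add: sqn_def)

lemma sqint_bound:
  assumes "f \<in> borel_measurable M" "sqint M g" "AE x in M. norm (f x) \<le> C * norm (g x)"
  shows "sqint M f"
  unfolding sqint_def
proof (intro conjI assms(1))
  have "AE x in M. norm ((norm (f x))\<^sup>2) \<le> norm (C\<^sup>2 * (norm (g x))\<^sup>2)"
    using assms(3)
  proof eventually_elim
    case (elim x)
    then have "(norm (f x))\<^sup>2 \<le> (C * norm (g x))\<^sup>2" by (rule power_mono) simp
    then show ?case by (simp add: power_mult_distrib)
  qed
  then show "integrable M (\<lambda>x. (norm (f x))\<^sup>2)"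
    by (rule Bochner_Integration.integrable_bound[rotated 2])
       (use assms in \<open>auto simp: sqint_def intro!: borel_measurable_power borel_measurable_norm\<close>)
qed

lemma norm_add_sq_le: "(norm (a + b))\<^sup>2 \<le> 2 * (norm a)\<^sup>2 + 2 * (norm (b::complex))\<^sup>2"
proof -
  have "(norm (a + b))\<^sup>2 \<le> (norm a + norm b)\<^sup>2"
    by (intro power_mono norm_triangle_ineq) simp
  also have "\<dots> \<le> 2 * (norm a)\<^sup>2 + 2 * (norm b)\<^sup>2"
    using sum_squares_bound[of "norm a" "norm b"] by (simp add: power2_sum)
  finally show ?thesis .
qed

lemma norm_mult_le_squares: "norm a * norm b \<le> (norm a)\<^sup>2 + (norm (b::complex))\<^sup>2"
proof -
  have "norm a * norm b \<le> 2 * norm a * norm b" by simp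
  also have "\<dots> \<le> (norm a)\<^sup>2 + (norm b)\<^sup>2" by (rule sum_squares_bound)
  finally show ?thesis .
qed

lemma sqint_add:
  assumes f: "sqint M f" and g: "sqint M g"
  shows "sqint M (\<lambda>x. f x + g x)"
proof -
  note [measurable] = sqint_measurable[OF f] sqint_measurable[OF g]
  have "integrable M (\<lambda>x. 2 * (norm (f x))\<^sup>2 + 2 * (norm (g x))\<^sup>2)"
    using f g by (simp add: sqint_def)
  then have "integrable M (\<lambda>x. (norm (f x + g x))\<^sup>2)"
    by (rule Bochner_Integration.integrable_bound) (auto simp: norm_add_sq_le)
  then show ?thesis by (simp add: sqint_def)
qed

lemma sqint_cmult: "sqint M f \<Longrightarrow> sqint M (\<lambda>x. c * f x)"
  by (auto simp: sqint_def norm_mult power_mult_distrib)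

lemma sqint_diff: "sqint M f \<Longrightarrow> sqint M g \<Longrightarrow> sqint M (\<lambda>x. f x - g x)"
  using sqint_add[of M f "\<lambda>x. (-1) * g x"] sqint_cmult[of M g "-1"] by simp

lemma sqint_zero: "sqint M (\<lambda>x. 0)"
  by (simp add: sqint_def)

lemma sqint_sum: "(\<And>i. i \<in> I \<Longrightarrow> sqint M (f i)) \<Longrightarrow> sqint M (\<lambda>x. \<Sum>i\<in>I. f i x)"
  by (induction I rule: infinite_finite_induct) (auto simp: sqint_zero sqint_add)

lemma sqint_const: "finite_measure M \<Longrightarrow> sqint M (\<lambda>x. c)"
  by (simp add: sqint_def finite_measure.integrable_const)

lemma sqint_AE_cong:
  assumes "sqint M f" "g \<in> borel_measurable M" "AE x in M. f x = g x"
  shows "sqint M g"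
  using assms(2,1) by (rule sqint_bound[where C=1]) (use assms(3) in auto)

lemma integrable_sqint_mult:
  assumes f: "sqint M f" and g: "sqint M g"
  shows "integrable M (\<lambda>x. f x * g x)"
proof -
  note [measurable] = sqint_measurable[OF f] sqint_measurable[OF g]
  have "integrable M (\<lambda>x. (norm (f x))\<^sup>2 + (norm (g x))\<^sup>2)"
    using f g by (simp add: sqint_def)
  then show ?thesis
    by (rule Bochner_Integration.integrable_bound) (auto simp: norm_mult norm_mult_le_squares)
qed

lemma borel_measurable_cnj [measurable]:
  "f \<in> borel_measurable M \<Longrightarrow> (\<lambda>x. cnj (f x)) \<in> borel_measurable M"
  by (rule borel_measurable_continuous_on[of cnj]) (auto intro: continuous_intros)

lemma sqint_cnj: "sqint M f \<Longrightarrow> sqint M (\<lambda>x. cnj (f x))"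
  by (auto simp: sqint_def)

lemma integrable_inner:
  "sqint M f \<Longrightarrow> sqint M g \<Longrightarrow> integrable M (\<lambda>x. f x * cnj (g x))"
  by (intro integrable_sqint_mult sqint_cnj)

lemma sqint_imp_integrable:
  "finite_measure M \<Longrightarrow> sqint M f \<Longrightarrow> integrable M f"
  using integrable_sqint_mult[of M f "\<lambda>_. 1"] sqint_const[of M 1] by simp

lemma sqn_add:
  assumes f: "sqint M f" and g: "sqint M g"
  shows "sqn M (\<lambda>x. f x + g x) \<le> 2 * sqn M f + 2 * sqn M g"
proof -
  have "sqn M (\<lambda>x. f x + g x) \<le> (\<integral>x. 2 * (norm (f x))\<^sup>2 + 2 * (norm (g x))\<^sup>2 \<partial>M)"
    unfolding sqn_def using f g sqint_add[OF f g]
    by (intro integral_mono) (auto simp: norm_add_sq_le sqint_def)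
  then show ?thesis using f g by (simp add: sqint_def sqn_def)
qed

lemma sqn_cmult: "sqn M (\<lambda>x. c * f x) = (norm c)\<^sup>2 * sqn M f"
  by (simp add: sqn_def norm_mult power_mult_distrib)

lemma sqn_triangle:
  assumes "sqint M f" "sqint M g" "sqint M h"
  shows "sqn M (\<lambda>x. f x - h x) \<le> 2 * sqn M (\<lambda>x. f x - g x) + 2 * sqn M (\<lambda>x. g x - h x)"
  using sqn_add[OF sqint_diff[OF assms(1,2)] sqint_diff[OF assms(2,3)]] by simp

lemma sqn_minus_commute: "sqn M (\<lambda>x. f x - g x) = sqn M (\<lambda>x. g x - f x)"
  by (simp add: sqn_def norm_minus_commute)

lemma sqn_eq_0_AE:
  assumes "sqint M f" "sqn M f = 0"
  shows "AE x in M. f x = 0"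
proof -
  have "AE x in M. (norm (f x))\<^sup>2 = 0"
    using assms integral_nonneg_eq_0_iff_AE[of M "\<lambda>x. (norm (f x))\<^sup>2"]
    by (simp add: sqint_def sqn_def)
  then show ?thesis by simp
qed

lemma sqn_AE_cong:
  "f \<in> borel_measurable M \<Longrightarrow> g \<in> borel_measurable M \<Longrightarrow> AE x in M. f x = g x \<Longrightarrow> sqn M f = sqn M g"
  unfolding sqn_def by (intro integral_cong_AE) auto

lemma L2_inner_add_left:
  "sqint M f \<Longrightarrow> sqint M g \<Longrightarrow> sqint M h \<Longrightarrow>
    L2_inner M (\<lambda>x. f x + g x) h = L2_inner M f h + L2_inner M g h"
  by (simp add: L2_inner_def ring_distribs integrable_inner)

lemma L2_inner_diff_left:
  "sqint M f \<Longrightarrow> sqint M g \<Longrightarrow> sqint M h \<Longrightarrow>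
    L2_inner M (\<lambda>x. f x - g x) h = L2_inner M f h - L2_inner M g h"
  by (simp add: L2_inner_def ring_distribs integrable_inner)

lemma L2_inner_cmult_left: "L2_inner M (\<lambda>x. c * f x) h = c * L2_inner M f h"
  by (simp add: L2_inner_def mult.assoc)

lemma L2_inner_zero_left [simp]: "L2_inner M (\<lambda>x. 0) h = 0"
  by (simp add: L2_inner_def)

lemma L2_inner_zero_right [simp]: "L2_inner M h (\<lambda>x. 0) = 0"
  by (simp add: L2_inner_def)

lemma L2_inner_cnj: "cnj (L2_inner M f g) = L2_inner M g f"
proof -
  have "cnj (L2_inner M f g) = (\<integral>x. cnj (f x * cnj (g x)) \<partial>M)"
    unfolding L2_inner_def by (rule Bochner_Integration.integral_cnj[symmetric])
  then show ?thesis by (simp add: L2_inner_def mult.commute)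
qed

lemma L2_inner_eq_0_commute: "L2_inner M f g = 0 \<longleftrightarrow> L2_inner M g f = 0"
  by (metis L2_inner_cnj complex_cnj_zero_iff)

lemma L2_inner_add_right:
  "sqint M f \<Longrightarrow> sqint M g \<Longrightarrow> sqint M h \<Longrightarrow>
    L2_inner M h (\<lambda>x. f x + g x) = L2_inner M h f + L2_inner M h g"
  by (simp add: L2_inner_def ring_distribs integrable_inner)

lemma L2_inner_cmult_right: "L2_inner M h (\<lambda>x. c * f x) = cnj c * L2_inner M h f"
  by (simp add: L2_inner_def mult.left_commute)

lemma L2_inner_sum_left:
  assumes "\<And>i. i \<in> I \<Longrightarrow> sqint M (f i)" "sqint M h"
  shows "L2_inner M (\<lambda>x. \<Sum>i\<in>I. f i x) h = (\<Sum>i\<in>I. L2_inner M (f i) h)"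
  using assms by (induction I rule: infinite_finite_induct) (auto simp: L2_inner_add_left sqint_sum)

lemma L2_inner_AE_cong:
  assumes "f \<in> borel_measurable M" "f' \<in> borel_measurable M" "h \<in> borel_measurable M"
    "AE x in M. f x = f' x"
  shows "L2_inner M f h = L2_inner M f' h"
  unfolding L2_inner_def using assms by (intro integral_cong_AE) auto

lemma L2_inner_self: "L2_inner M f f = of_real (sqn M f)"
  by (simp add: L2_inner_def sqn_def complex_norm_square[symmetric] flip: of_real_power)

lemma sqn_pythagoras:
  assumes "sqint M f" "sqint M g" "L2_inner M f g = 0"
  shows "sqn M (\<lambda>x. f x + g x) = sqn M f + sqn M g"
proof -
  have "complex_of_real (sqn M (\<lambda>x. f x + g x)) = of_real (sqn M f + sqn M g)"
    using assms L2_inner_eq_0_commute[of M f g]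
    by (simp add: L2_inner_self[symmetric] L2_inner_add_left L2_inner_add_right sqint_add)
  then show ?thesis using of_real_eq_iff by blast
qed

lemma Lp_mem_2: "Lp_mem M 2 f \<longleftrightarrow> sqint M f"
  unfolding Lp_mem_def sqint_def Lp_norm_def integrable_iff_bounded
  by (auto simp: Let_def less_top)

lemma Lp_norm_2: "sqint M f \<Longrightarrow> Lp_norm M 2 f = ennreal (sqrt (sqn M f))"
  unfolding sqint_def Lp_norm_def sqn_def
  by (simp add: Let_def nn_integral_eq_integral powr_half_sqrt)

lemma Lp_norm_2_tendsto_iff:
  assumes "\<And>k. sqint M (f k)"
  shows "(\<lambda>k. Lp_norm M 2 (f k)) \<longlonglongrightarrow> 0 \<longleftrightarrow> (\<lambda>k. sqn M (f k)) \<longlonglongrightarrow> 0"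
proof -
  have "(\<lambda>k. Lp_norm M 2 (f k)) \<longlonglongrightarrow> 0 \<longleftrightarrow> (\<lambda>k. ennreal (sqrt (sqn M (f k)))) \<longlonglongrightarrow> ennreal 0"
    using assms by (simp add: Lp_norm_2)
  also have "\<dots> \<longleftrightarrow> (\<lambda>k. sqrt (sqn M (f k))) \<longlonglongrightarrow> 0"
    by (rule tendsto_ennreal_iff) (auto simp: sqn_nonneg)
  also have "\<dots> \<longleftrightarrow> (\<lambda>k. sqn M (f k)) \<longlonglongrightarrow> 0"
  proof
    assume "(\<lambda>k. sqrt (sqn M (f k))) \<longlonglongrightarrow> 0"
    then have "(\<lambda>k. (sqrt (sqn M (f k)))\<^sup>2) \<longlonglongrightarrow> 0\<^sup>2" by (rule tendsto_power)
    then show "(\<lambda>k. sqn M (f k)) \<longlonglongrightarrow> 0" by (simp add: sqn_nonneg)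
  next
    assume "(\<lambda>k. sqn M (f k)) \<longlonglongrightarrow> 0"
    from tendsto_real_sqrt[OF this] show "(\<lambda>k. sqrt (sqn M (f k))) \<longlonglongrightarrow> 0" by simp
  qed
  finally show ?thesis .
qed

text \<open>\<open>L2_lim\<close> is a choice, so exhibiting one limit \<open>S\<close> does two
  things: it shows that the choice really is a limit, and, since L^2 limits are unique up to null
  sets, it determines the choice almost everywhere.\<close>

lemma L2_lim_AE_eq:
  assumes F: "\<And>k. sqint M (F k)" and S: "sqint M S" and lim: "(\<lambda>k. sqn M (\<lambda>x. F k x - S x)) \<longlonglongrightarrow> 0"
  shows "sqint M (L2_lim M F)" "AE x in M. L2_lim M F x = S x"
proof -
  have iff: "Lp_mem M 2 S' \<and> (\<lambda>k. Lp_norm M 2 (\<lambda>x. F k x - S' x)) \<longlonglongrightarrow> 0 \<longleftrightarrow>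
      sqint M S' \<and> (\<lambda>k. sqn M (\<lambda>x. F k x - S' x)) \<longlonglongrightarrow> 0" for S'
    using F by (auto simp: Lp_mem_2 sqint_diff Lp_norm_2_tendsto_iff)
  have *: "sqint M (L2_lim M F) \<and> (\<lambda>k. sqn M (\<lambda>x. F k x - L2_lim M F x)) \<longlonglongrightarrow> 0"
    unfolding L2_lim_def iff by (rule someI[of _ S]) (use S lim in auto)
  then show Q: "sqint M (L2_lim M F)" by simp
  have "(\<lambda>k. 2 * sqn M (\<lambda>x. L2_lim M F x - F k x) + 2 * sqn M (\<lambda>x. F k x - S x)) \<longlonglongrightarrow> 2 * 0 + 2 * 0"
    by (intro tendsto_intros lim) (use * in \<open>simp add: sqn_minus_commute\<close>)
  then have "sqn M (\<lambda>x. L2_lim M F x - S x) \<le> 0"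
    by (intro tendsto_lowerbound[where F=sequentially])
       (use sqn_triangle[OF Q F S] in \<open>auto intro!: always_eventually\<close>)
  then have "AE x in M. L2_lim M F x - S x = 0"
    using sqn_nonneg[of M "\<lambda>x. L2_lim M F x - S x"]
    by (intro sqn_eq_0_AE sqint_diff Q S) auto
  then show "AE x in M. L2_lim M F x = S x" by simp
qed

section \<open>Linear spans and orthogonal projection onto the span of a finite set\<close>

text \<open>Adding one generator at a time gives an induction rule that reduces linear statements to
  generators, with no families of coefficients to carry along.\<close>

inductive_set cspan :: "('a \<Rightarrow> complex) set \<Rightarrow> ('a \<Rightarrow> complex) set" for B where
  zero: "(\<lambda>x. 0) \<in> cspan B"
| step: "b \<in> B \<Longrightarrow> f \<in> cspan B \<Longrightarrow> (\<lambda>x. c * b x + f x) \<in> cspan B"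

lemma cspan_base: "b \<in> B \<Longrightarrow> b \<in> cspan B"
  using cspan.step[OF _ cspan.zero, of b B 1] by simp

lemma cspan_add: "f \<in> cspan B \<Longrightarrow> g \<in> cspan B \<Longrightarrow> (\<lambda>x. f x + g x) \<in> cspan B"
proof (induction rule: cspan.induct)
  case (step b f c)
  then show ?case using cspan.step[of b B "\<lambda>x. f x + g x" c] by (simp add: add.assoc)
qed simp

lemma cspan_cmult: "f \<in> cspan B \<Longrightarrow> (\<lambda>x. c * f x) \<in> cspan B"
proof (induction rule: cspan.induct)
  case zero
  then show ?case by (simp add: cspan.zero)
next
  case (step b f c')
  then show ?case using cspan.step[of b B "\<lambda>x. c * f x" "c * c'"] by (simp add: algebra_simps)
qed

lemma cspan_diff: "f \<in> cspan B \<Longrightarrow> g \<in> cspan B \<Longrightarrow> (\<lambda>x. f x - g x) \<in> cspan B"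
  using cspan_add[of f B "\<lambda>x. (-1) * g x"] cspan_cmult[of g B "-1"] by simp

lemma cspan_sum: "(\<And>i. i \<in> I \<Longrightarrow> f i \<in> cspan B) \<Longrightarrow> (\<lambda>x. \<Sum>i\<in>I. f i x) \<in> cspan B"
proof (induction I rule: infinite_finite_induct)
  case (insert i I)
  then show ?case using cspan_add[of "f i" B "\<lambda>x. \<Sum>i\<in>I. f i x"] by simp
qed (simp_all add: cspan.zero)

lemma cspan_subset: "f \<in> cspan B \<Longrightarrow> B \<subseteq> cspan C \<Longrightarrow> f \<in> cspan C"
proof (induction rule: cspan.induct)
  case (step b f c)
  then have "b \<in> cspan C" "f \<in> cspan C" by auto
  then show ?case by (intro cspan_add cspan_cmult)
qed (rule cspan.zero)

lemma cspan_mono: "B \<subseteq> C \<Longrightarrow> cspan B \<subseteq> cspan C"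
  using cspan_subset cspan_base by blast

lemma cspan_mult:
  assumes "f \<in> cspan B" "g \<in> cspan C" "\<And>b c. b \<in> B \<Longrightarrow> c \<in> C \<Longrightarrow> (\<lambda>x. b x * c x) \<in> cspan D"
  shows "(\<lambda>x. f x * g x) \<in> cspan D"
  using assms(1)
proof (induction rule: cspan.induct)
  case zero
  then show ?case by (simp add: cspan.zero)
next
  case (step b f c)
  have "(\<lambda>x. b x * g x) \<in> cspan D"
    using assms(2)
  proof (induction rule: cspan.induct)
    case zero
    then show ?case by (simp add: cspan.zero)
  next
    case (step b' f' c')
    then have "(\<lambda>x. c' * (b x * b' x) + b x * f' x) \<in> cspan D"
      using assms(3) \<open>b \<in> B\<close> by (intro cspan_add cspan_cmult) auto
    then show ?case by (simp add: algebra_simps)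
  qed
  then have "(\<lambda>x. c * (b x * g x) + f x * g x) \<in> cspan D"
    by (intro cspan_add cspan_cmult step.IH)
  then show ?case by (simp add: algebra_simps)
qed

lemma cspan_sqint: "f \<in> cspan B \<Longrightarrow> (\<And>b. b \<in> B \<Longrightarrow> sqint M b) \<Longrightarrow> sqint M f"
proof (induction rule: cspan.induct)
  case (step b f c)
  then show ?case by (intro sqint_add sqint_cmult) auto
qed (rule sqint_zero)

lemma cspan_orthogonal:
  assumes "h \<in> cspan B" "\<And>b. b \<in> B \<Longrightarrow> sqint M b" "sqint M f" "\<And>b. b \<in> B \<Longrightarrow> L2_inner M f b = 0"
  shows "L2_inner M f h = 0"
  using assms(1)
proof (induction rule: cspan.induct)
  case (step b h c)
  then show ?case
    using assms cspan_sqint[OF step.hyps(2) assms(2)]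
    by (simp add: L2_inner_add_right L2_inner_cmult_right sqint_cmult)
qed auto

text \<open>Gram-Schmidt, one vector per induction step: the projection onto the span of
  \<open>B\<close> is corrected by a multiple of the component \<open>e\<close> of the new vector
  \<open>v\<close> orthogonal to \<open>B\<close>.\<close>

lemma ex_orthogonal_projection:
  assumes "finite B" "\<And>b. b \<in> B \<Longrightarrow> sqint M b" "sqint M f"
  shows "\<exists>p\<in>cspan B. \<forall>b\<in>B. L2_inner M (\<lambda>x. f x - p x) b = 0"
  using assms
proof (induction B arbitrary: f rule: finite_induct)
  case empty
  then show ?case by (auto intro: cspan.zero)
next
  case (insert v B)
  then have v: "sqint M v" by simp
  obtain p where p: "p \<in> cspan B" "\<forall>b\<in>B. L2_inner M (\<lambda>x. f x - p x) b = 0"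
    using insert.IH[of f] insert.prems by auto
  obtain q where q: "q \<in> cspan B" "\<forall>b\<in>B. L2_inner M (\<lambda>x. v x - q x) b = 0"
    using insert.IH[OF _ v] insert.prems by auto
  have sp: "sqint M p" and sq: "sqint M q"
    using cspan_sqint p q insert.prems by blast+
  define e where "e = (\<lambda>x. v x - q x)"
  have se: "sqint M e" unfolding e_def by (intro sqint_diff v sq)
  define c where "c = L2_inner M (\<lambda>x. f x - p x) e / L2_inner M e e"
  define r where "r = (\<lambda>x. p x + c * e x)"
  have sf: "sqint M (\<lambda>x. f x - p x)" using insert.prems sp by (simp add: sqint_diff)
  have sr: "sqint M (\<lambda>x. f x - r x)"
    unfolding r_def using insert.prems sp se by (intro sqint_diff sqint_add sqint_cmult)
  have req: "L2_inner M (\<lambda>x. f x - r x) h = L2_inner M (\<lambda>x. f x - p x) h - c * L2_inner M e h"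
    if "sqint M h" for h
  proof -
    have "(\<lambda>x. f x - r x) = (\<lambda>x. (f x - p x) - c * e x)" by (simp add: r_def fun_eq_iff)
    then show ?thesis
      by (simp add: L2_inner_diff_left sf se that sqint_cmult L2_inner_cmult_left)
  qed
  have "q \<in> cspan (insert v B)" "p \<in> cspan (insert v B)"
    using p q cspan_mono[of B "insert v B"] by auto
  then have "r \<in> cspan (insert v B)"
    unfolding r_def e_def by (intro cspan_add cspan_cmult cspan_diff cspan_base[of v]) auto
  moreover have B0: "L2_inner M (\<lambda>x. f x - r x) b = 0" if "b \<in> B" for b
    using req[of b] p q that insert.prems by (auto simp: e_def)
  moreover have "L2_inner M (\<lambda>x. f x - r x) v = 0"
  proof -
    have "L2_inner M (\<lambda>x. f x - r x) q = 0"
      using q(1) by (rule cspan_orthogonal) (use insert.prems sr B0 in auto)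
    moreover have "L2_inner M (\<lambda>x. f x - r x) e = 0"
    proof (cases "L2_inner M e e = 0")
      \<comment> \<open>Here \<open>v\<close> lies in the span of \<open>B\<close> up to a null set,
        and the quotient defining \<open>c\<close> degenerates; the inner product with
        \<open>e\<close> vanishes because \<open>e\<close> does almost everywhere.\<close>
      case True
      then have "AE x in M. e x = 0"
        using se sqn_eq_0_AE by (metis L2_inner_self of_real_eq_0_iff)
      then have "L2_inner M e (\<lambda>x. f x - r x) = L2_inner M (\<lambda>x. 0) (\<lambda>x. f x - r x)"
        using se sr by (intro L2_inner_AE_cong) (auto dest: sqint_measurable)
      then show ?thesis using L2_inner_eq_0_commute by auto
    next
      case False
      then show ?thesis using req[OF se] by (simp add: c_def)
    qed
    ultimately show ?thesis
      using L2_inner_add_right[OF se sq sr] by (simp add: e_def)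
  qed
  ultimately show ?case by auto
qed

section \<open>Rotation invariance of the Gaussian measure\<close>

abbreviation gauss1 :: "real measure" where
  "gauss1 \<equiv> density lborel std_normal_density"

lemma prob_space_gauss1: "prob_space gauss1"
  by (rule prob_space_normal_density) simp

interpretation gauss1: prob_space gauss1
  by (rule prob_space_gauss1)

interpretation gaussP: product_sigma_finite "\<lambda>_::nat. gauss1"
  by (simp add: product_sigma_finite_def gauss1.sigma_finite_measure_axioms)

lemma prob_space_gauss: "prob_space (gauss d)"
  unfolding gauss_def by (rule prob_space_PiM) (rule prob_space_gauss1)

interpretation gauss: prob_space "gauss d"
  by (rule prob_space_gauss)

interpretation gauss2: pair_prob_space "gauss d" "gauss d'" ..

text \<open>The product of the two densities depends only on \<open>x^2 + y^2\<close>, which the map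
  preserves.\<close>

lemma std_normal_density_rotation:
  assumes "a\<^sup>2 + b\<^sup>2 = 1"
  shows "std_normal_density (a * x + b * y) * std_normal_density (b * x - a * y)
    = std_normal_density x * std_normal_density y"
proof -
  have "(a * x + b * y)\<^sup>2 + (b * x - a * y)\<^sup>2 = (a\<^sup>2 + b\<^sup>2) * (x\<^sup>2 + y\<^sup>2)"
    by (simp add: power2_eq_square algebra_simps)
  then have "- ((a * x + b * y)\<^sup>2 / 2) + - ((b * x - a * y)\<^sup>2 / 2) = - (x\<^sup>2 / 2) + - (y\<^sup>2 / 2)"
    using assms by simp
  then show ?thesis
    by (simp add: std_normal_density_def exp_add[symmetric])
qed

text \<open>The planar map is split into two affine substitutions on the line:
  \<open>s = a x + b y\<close> at fixed \<open>x\<close>, and, after exchanging the integrals,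
  \<open>t = (x - a s) / b\<close> at fixed \<open>s\<close>. Their factors \<open>1 / b\<close> and
  \<open>b\<close> cancel.\<close>

lemma nn_integral_lborel_rotation:
  fixes H :: "real \<times> real \<Rightarrow> ennreal"
  assumes [measurable]: "H \<in> borel_measurable borel" and ab: "a > 0" "b > 0" "a\<^sup>2 + b\<^sup>2 = 1"
  shows "(\<integral>\<^sup>+x. \<integral>\<^sup>+y. H (a * x + b * y, b * x - a * y) \<partial>lborel \<partial>lborel) = (\<integral>\<^sup>+x. \<integral>\<^sup>+y. H (x, y) \<partial>lborel \<partial>lborel)"
proof -
  \<comment> \<open>The second coordinate of the image, expressed by \<open>x\<close> and the new
    variable \<open>s\<close>; this is where \<open>a^2 + b^2 = 1\<close> enters.\<close>
  have eq: "b * x - a * ((s - a * x) / b) = (x - a * s) / b" for x s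
  proof -
    have "b * x - a * ((s - a * x) / b) = ((a\<^sup>2 + b\<^sup>2) * x - a * s) / b"
      using ab(1,2) by (simp add: field_simps power2_eq_square)
    then show ?thesis by (simp only: ab(3) mult_1)
  qed
  have 1: "(\<integral>\<^sup>+y. H (a * x + b * y, b * x - a * y) \<partial>lborel) = (1 / b) * (\<integral>\<^sup>+s. H (s, (x - a * s) / b) \<partial>lborel)" for x
    using ab eq[of x]
    by (subst nn_integral_real_affine[of _ "1 / b" "- a * x / b"]) (auto simp: field_simps)
  have 2: "(1 / b) * (\<integral>\<^sup>+x. H (s, (x - a * s) / b) \<partial>lborel) = (\<integral>\<^sup>+t. H (s, t) \<partial>lborel)" for s
    using ab
    by (subst (2) nn_integral_real_affine[of _ "1 / b" "- a * s / b"]) (auto simp: field_simps)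
  have "(\<integral>\<^sup>+x. \<integral>\<^sup>+y. H (a * x + b * y, b * x - a * y) \<partial>lborel \<partial>lborel)
      = (\<integral>\<^sup>+x. \<integral>\<^sup>+s. (1 / b) * H (s, (x - a * s) / b) \<partial>lborel \<partial>lborel)"
    by (simp add: 1 nn_integral_cmult)
  also have "\<dots> = (\<integral>\<^sup>+s. \<integral>\<^sup>+x. (1 / b) * H (s, (x - a * s) / b) \<partial>lborel \<partial>lborel)"
    by (rule lborel_pair.Fubini') (simp add: split_def)
  also have "\<dots> = (\<integral>\<^sup>+s. \<integral>\<^sup>+t. H (s, t) \<partial>lborel \<partial>lborel)"
    by (subst nn_integral_cmult) (simp_all add: 2)
  finally show ?thesis .
qed

lemma nn_integral_gauss1_rotation:
  fixes F :: "real \<times> real \<Rightarrow> ennreal"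
  assumes [measurable]: "F \<in> borel_measurable borel" and ab: "a > 0" "b > 0" "a\<^sup>2 + b\<^sup>2 = 1"
  shows "(\<integral>\<^sup>+x. \<integral>\<^sup>+y. F (a * x + b * y, b * x - a * y) \<partial>gauss1 \<partial>gauss1) = (\<integral>\<^sup>+x. \<integral>\<^sup>+y. F (x, y) \<partial>gauss1 \<partial>gauss1)"
proof -
  define n where "n = std_normal_density"
  have nn: "n x \<ge> 0" for x by (simp add: n_def)
  have [measurable]: "n \<in> borel_measurable borel" unfolding n_def by measurable
  have dens: "(\<integral>\<^sup>+x. \<integral>\<^sup>+y. K (x, y) \<partial>gauss1 \<partial>gauss1)
      = (\<integral>\<^sup>+x. \<integral>\<^sup>+y. ennreal (n x * n y) * K (x, y) \<partial>lborel \<partial>lborel)"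
    if [measurable]: "K \<in> borel_measurable borel" for K
  proof -
    have "(\<integral>\<^sup>+x. \<integral>\<^sup>+y. K (x, y) \<partial>gauss1 \<partial>gauss1)
       = (\<integral>\<^sup>+x. n x * (\<integral>\<^sup>+y. n y * K (x, y) \<partial>lborel) \<partial>lborel)"
      by (simp add: nn_integral_density n_def)
    also have "\<dots> = (\<integral>\<^sup>+x. \<integral>\<^sup>+y. ennreal (n x * n y) * K (x, y) \<partial>lborel \<partial>lborel)"
      by (subst nn_integral_cmult[symmetric]) (simp_all add: ennreal_mult nn mult.assoc)
    finally show ?thesis .
  qed
  define H where "H = (\<lambda>(x, y). ennreal (n x * n y) * F (x, y))"
  have [measurable]: "H \<in> borel_measurable borel"
    unfolding H_def split_def borel_prod[symmetric] by measurable
  have "(\<lambda>z. F (a * fst z + b * snd z, b * fst z - a * snd z)) \<in> borel_measurable borel"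
    unfolding borel_prod[symmetric] by measurable
  from dens[OF this] have "(\<integral>\<^sup>+x. \<integral>\<^sup>+y. F (a * x + b * y, b * x - a * y) \<partial>gauss1 \<partial>gauss1)
      = (\<integral>\<^sup>+x. \<integral>\<^sup>+y. H (a * x + b * y, b * x - a * y) \<partial>lborel \<partial>lborel)"
    using std_normal_density_rotation[OF ab(3)] by (simp add: H_def n_def)
  also have "\<dots> = (\<integral>\<^sup>+x. \<integral>\<^sup>+y. H (x, y) \<partial>lborel \<partial>lborel)"
    by (rule nn_integral_lborel_rotation) (use ab in auto)
  also have "\<dots> = (\<integral>\<^sup>+x. \<integral>\<^sup>+y. F (x, y) \<partial>gauss1 \<partial>gauss1)"
    by (subst dens) (simp_all add: H_def)
  finally show ?thesis .
qed

section \<open>Invariance for finite products of Gaussians\<close>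

text \<open>The restriction keeps the result extensional, hence inside the space of the product
  measure, whatever the two arguments are outside \<open>I\<close>.\<close>

definition lincomb :: "nat set \<Rightarrow> real \<Rightarrow> real \<Rightarrow> (nat \<Rightarrow> real) \<Rightarrow> (nat \<Rightarrow> real) \<Rightarrow> (nat \<Rightarrow> real)" where
  "lincomb I a b x y = (\<lambda>i\<in>I. a * x i + b * y i)"

lemma lincomb_measurable [measurable]:
  "f \<in> N \<rightarrow>\<^sub>M PiM I (\<lambda>_. gauss1) \<Longrightarrow> g \<in> N \<rightarrow>\<^sub>M PiM I (\<lambda>_. gauss1) \<Longrightarrow>
    (\<lambda>z. lincomb I a b (f z) (g z)) \<in> N \<rightarrow>\<^sub>M PiM I (\<lambda>_. gauss1)"
  unfolding lincomb_def
proof (rule measurable_restrict)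
  fix i assume f: "f \<in> N \<rightarrow>\<^sub>M PiM I (\<lambda>_. gauss1)" and g: "g \<in> N \<rightarrow>\<^sub>M PiM I (\<lambda>_. gauss1)" and i: "i \<in> I"
  have "(\<lambda>z. f z i) \<in> N \<rightarrow>\<^sub>M gauss1" "(\<lambda>z. g z i) \<in> N \<rightarrow>\<^sub>M gauss1"
    using measurable_compose[OF f measurable_component_singleton[OF i]]
      measurable_compose[OF g measurable_component_singleton[OF i]] by auto
  then show "(\<lambda>z. a * f z i + b * g z i) \<in> N \<rightarrow>\<^sub>M gauss1"
    by simp
qed

text \<open>Splits coordinate \<open>i\<close> off both vectors and makes it the innermost double
  integral, where the planar invariance can be applied with all other coordinates frozen.\<close>

lemma nn_integral_pair_PiM_insert:
  fixes I :: "nat set"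
  assumes I: "finite I" "i \<notin> I"
    and [measurable]: "F \<in> borel_measurable (PiM (insert i I) (\<lambda>_. gauss1) \<Otimes>\<^sub>M PiM (insert i I) (\<lambda>_. gauss1))"
  shows "(\<integral>\<^sup>+x. \<integral>\<^sup>+y. F (x, y) \<partial>PiM (insert i I) (\<lambda>_. gauss1) \<partial>PiM (insert i I) (\<lambda>_. gauss1))
    = (\<integral>\<^sup>+x. \<integral>\<^sup>+y. \<integral>\<^sup>+s. \<integral>\<^sup>+t. F (x(i := s), y(i := t)) \<partial>gauss1 \<partial>gauss1 \<partial>PiM I (\<lambda>_. gauss1) \<partial>PiM I (\<lambda>_. gauss1))"
proof -
  let ?P = "PiM I (\<lambda>_. gauss1)" and ?Q = "PiM (insert i I) (\<lambda>_. gauss1)"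
  interpret P: prob_space ?P by (rule prob_space_PiM) (rule prob_space_gauss1)
  interpret Q: prob_space ?Q by (rule prob_space_PiM) (rule prob_space_gauss1)
  interpret pair_sigma_finite gauss1 ?P ..
  have "(\<integral>\<^sup>+x. \<integral>\<^sup>+y. F (x, y) \<partial>?Q \<partial>?Q) = (\<integral>\<^sup>+x. \<integral>\<^sup>+s. \<integral>\<^sup>+y. F (x(i := s), y) \<partial>?Q \<partial>gauss1 \<partial>?P)"
    by (rule gaussP.product_nn_integral_insert[OF I]) measurable
  also have "\<dots> = (\<integral>\<^sup>+x. \<integral>\<^sup>+s. \<integral>\<^sup>+y. \<integral>\<^sup>+t. F (x(i := s), y(i := t)) \<partial>gauss1 \<partial>?P \<partial>gauss1 \<partial>?P)"
  proof (intro nn_integral_cong)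
    fix x s assume "x \<in> space ?P" "s \<in> space gauss1"
    then have "x(i := s) \<in> space ?Q" by (auto simp: space_PiM PiE_iff extensional_def)
    then have [measurable]: "(\<lambda>y. F (x(i := s), y)) \<in> borel_measurable ?Q" by simp
    show "(\<integral>\<^sup>+y. F (x(i := s), y) \<partial>?Q) = (\<integral>\<^sup>+y. \<integral>\<^sup>+t. F (x(i := s), y(i := t)) \<partial>gauss1 \<partial>?P)"
      by (rule gaussP.product_nn_integral_insert[OF I]) measurable
  qed
  also have "\<dots> = (\<integral>\<^sup>+x. \<integral>\<^sup>+y. \<integral>\<^sup>+s. \<integral>\<^sup>+t. F (x(i := s), y(i := t)) \<partial>gauss1 \<partial>gauss1 \<partial>?P \<partial>?P)"
  proof (rule nn_integral_cong)
    fix x assume x: "x \<in> space ?P"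
    have [measurable]: "(\<lambda>z. x(i := fst (fst z))) \<in> (gauss1 \<Otimes>\<^sub>M ?P) \<Otimes>\<^sub>M gauss1 \<rightarrow>\<^sub>M ?Q"
      using x by (intro measurable_fun_upd[where J=I]) auto
    have [measurable]: "(\<lambda>z. (snd (fst z))(i := snd z)) \<in> (gauss1 \<Otimes>\<^sub>M ?P) \<Otimes>\<^sub>M gauss1 \<rightarrow>\<^sub>M ?Q"
      by (intro measurable_fun_upd[where J=I]) auto
    have "(\<lambda>(s, y). \<integral>\<^sup>+t. F (x(i := s), y(i := t)) \<partial>gauss1) \<in> borel_measurable (gauss1 \<Otimes>\<^sub>M ?P)"
      unfolding split_def by measurable
    then show "(\<integral>\<^sup>+s. \<integral>\<^sup>+y. \<integral>\<^sup>+t. F (x(i := s), y(i := t)) \<partial>gauss1 \<partial>?P \<partial>gauss1)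
        = (\<integral>\<^sup>+y. \<integral>\<^sup>+s. \<integral>\<^sup>+t. F (x(i := s), y(i := t)) \<partial>gauss1 \<partial>gauss1 \<partial>?P)"
      by (rule Fubini'[symmetric])
  qed
  finally show ?thesis .
qed

lemma lincomb_fun_upd:
  assumes "i \<notin> I"
  shows "lincomb (insert i I) a b (x(i := s)) (y(i := t)) = (lincomb I a b x y)(i := a * s + b * t)"
  using assms by (auto simp: lincomb_def fun_eq_iff)

text \<open>The map acts separately on each pair of coordinates \<open>(x i, y i)\<close>, so
  induction on \<open>I\<close> rotates one pair at a time.\<close>

lemma nn_integral_PiM_rotation:
  assumes "finite I" and ab: "a > 0" "b > 0" "a\<^sup>2 + b\<^sup>2 = 1"
    and "F \<in> borel_measurable (PiM I (\<lambda>_. gauss1) \<Otimes>\<^sub>M PiM I (\<lambda>_. gauss1))"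
  shows "(\<integral>\<^sup>+x. \<integral>\<^sup>+y. F (lincomb I a b x y, lincomb I b (-a) x y) \<partial>PiM I (\<lambda>_. gauss1) \<partial>PiM I (\<lambda>_. gauss1))
    = (\<integral>\<^sup>+x. \<integral>\<^sup>+y. F (x, y) \<partial>PiM I (\<lambda>_. gauss1) \<partial>PiM I (\<lambda>_. gauss1))"
  using assms(1,5)
proof (induction I arbitrary: F rule: finite_induct)
  case empty
  have "lincomb {} a b x y = (\<lambda>_. undefined)" for a b x y by (simp add: lincomb_def fun_eq_iff)
  then show ?case by (simp add: PiM_empty nn_integral_count_space_finite)
next
  case (insert i I)
  let ?P = "PiM I (\<lambda>_. gauss1)" and ?Q = "PiM (insert i I) (\<lambda>_. gauss1)"
  note [measurable] = insert.prems
  interpret P: prob_space ?P by (rule prob_space_PiM) (rule prob_space_gauss1)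
  have upd: "x(i := s) \<in> space ?Q" if "x \<in> space ?P" for x and s :: real
    using that by (auto simp: space_PiM PiE_iff extensional_def)
  \<comment> \<open>\<open>F\<close> with coordinate \<open>i\<close> of both arguments integrated
    out; the induction hypothesis is applied to this function, which is why \<open>F\<close> is
    generalized.\<close>
  define G where "G = (\<lambda>(x, y). \<integral>\<^sup>+s. \<integral>\<^sup>+t. F (x(i := s), y(i := t)) \<partial>gauss1 \<partial>gauss1)"
  have [measurable]: "G \<in> borel_measurable (?P \<Otimes>\<^sub>M ?P)"
  proof -
    have [measurable]: "(\<lambda>z. (fst (fst (fst z)))(i := snd (fst z))) \<in> ((?P \<Otimes>\<^sub>M ?P) \<Otimes>\<^sub>M gauss1) \<Otimes>\<^sub>M gauss1 \<rightarrow>\<^sub>M ?Q"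
      by (intro measurable_fun_upd[where J=I]) auto
    have [measurable]: "(\<lambda>z. (snd (fst (fst z)))(i := snd z)) \<in> ((?P \<Otimes>\<^sub>M ?P) \<Otimes>\<^sub>M gauss1) \<Otimes>\<^sub>M gauss1 \<rightarrow>\<^sub>M ?Q"
      by (intro measurable_fun_upd[where J=I]) auto
    show ?thesis unfolding G_def split_def by measurable
  qed
  have "(\<lambda>z. F (lincomb (insert i I) a b (fst z) (snd z), lincomb (insert i I) b (-a) (fst z) (snd z)))
      \<in> borel_measurable (?Q \<Otimes>\<^sub>M ?Q)"
    by measurable
  from nn_integral_pair_PiM_insert[OF insert.hyps this]
  have "(\<integral>\<^sup>+x. \<integral>\<^sup>+y. F (lincomb (insert i I) a b x y, lincomb (insert i I) b (-a) x y) \<partial>?Q \<partial>?Q)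
     = (\<integral>\<^sup>+x. \<integral>\<^sup>+y. \<integral>\<^sup>+s. \<integral>\<^sup>+t. F ((lincomb I a b x y)(i := a * s + b * t), (lincomb I b (-a) x y)(i := b * s - a * t))
         \<partial>gauss1 \<partial>gauss1 \<partial>?P \<partial>?P)"
    by (simp add: lincomb_fun_upd insert.hyps)
  also have "\<dots> = (\<integral>\<^sup>+x. \<integral>\<^sup>+y. G (lincomb I a b x y, lincomb I b (-a) x y) \<partial>?P \<partial>?P)"
  proof (intro nn_integral_cong)
    fix x y assume "x \<in> space ?P" "y \<in> space ?P"
    have sp: "lincomb I a b x y \<in> space ?P" "lincomb I b (-a) x y \<in> space ?P"
      by (auto simp: space_PiM lincomb_def)
    have [measurable]: "(\<lambda>z. (lincomb I a b x y)(i := fst z)) \<in> borel \<Otimes>\<^sub>M borel \<rightarrow>\<^sub>M ?Q"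
      "(\<lambda>z. (lincomb I b (-a) x y)(i := snd z)) \<in> borel \<Otimes>\<^sub>M borel \<rightarrow>\<^sub>M ?Q"
      using sp by (auto intro!: measurable_fun_upd[where J=I])
    have "(\<lambda>z. F ((lincomb I a b x y)(i := fst z), (lincomb I b (-a) x y)(i := snd z))) \<in> borel_measurable borel"
      unfolding borel_prod[symmetric] by measurable
    from nn_integral_gauss1_rotation[OF this ab]
    show "(\<integral>\<^sup>+s. \<integral>\<^sup>+t. F ((lincomb I a b x y)(i := a * s + b * t), (lincomb I b (-a) x y)(i := b * s - a * t))
         \<partial>gauss1 \<partial>gauss1) = G (lincomb I a b x y, lincomb I b (-a) x y)"
      by (simp add: G_def)
  qed
  also have "\<dots> = (\<integral>\<^sup>+x. \<integral>\<^sup>+y. G (x, y) \<partial>?P \<partial>?P)"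
    by (rule insert.IH) measurable
  also have "\<dots> = (\<integral>\<^sup>+x. \<integral>\<^sup>+y. F (x, y) \<partial>?Q \<partial>?Q)"
    by (simp add: G_def nn_integral_pair_PiM_insert[OF insert.hyps insert.prems])
  finally show ?case .
qed

abbreviation lc :: "nat \<Rightarrow> real \<Rightarrow> real \<Rightarrow> (nat \<Rightarrow> real) \<Rightarrow> (nat \<Rightarrow> real) \<Rightarrow> (nat \<Rightarrow> real)" where
  "lc d \<equiv> lincomb {..<d}"

definition rot :: "nat \<Rightarrow> real \<Rightarrow> real \<Rightarrow> (nat \<Rightarrow> real) \<times> (nat \<Rightarrow> real) \<Rightarrow> (nat \<Rightarrow> real) \<times> (nat \<Rightarrow> real)" where
  "rot d a b z = (lc d a b (fst z) (snd z), lc d b (-a) (fst z) (snd z))"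

lemma lc_measurable [measurable]:
  "f \<in> N \<rightarrow>\<^sub>M gauss d \<Longrightarrow> g \<in> N \<rightarrow>\<^sub>M gauss d \<Longrightarrow> (\<lambda>z. lc d a b (f z) (g z)) \<in> N \<rightarrow>\<^sub>M gauss d"
  unfolding gauss_def by (rule lincomb_measurable)

lemma rot_measurable [measurable]: "rot d a b \<in> gauss d \<Otimes>\<^sub>M gauss d \<rightarrow>\<^sub>M gauss d \<Otimes>\<^sub>M gauss d"
  unfolding rot_def by measurable

text \<open>The first component of \<open>rot\<close> applied twice. Below \<open>d\<close> the
  terms in \<open>y\<close> cancel and \<open>a^2 + b^2 = 1\<close> remains; elsewhere both sides
  are \<open>undefined\<close> because points are extensional.\<close>

lemma lc_inverse:
  assumes "a\<^sup>2 + b\<^sup>2 = 1" "x \<in> space (gauss d)" "y \<in> space (gauss d)"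
  shows "lc d a b (lc d a b x y) (lc d b (-a) x y) = x"
proof
  fix i
  show "lc d a b (lc d a b x y) (lc d b (-a) x y) i = x i"
  proof (cases "i < d")
    case True
    then have "lc d a b (lc d a b x y) (lc d b (-a) x y) i = (a\<^sup>2 + b\<^sup>2) * x i"
      by (simp add: lincomb_def algebra_simps power2_eq_square)
    then show ?thesis using assms by simp
  next
    case False
    then show ?thesis using assms by (auto simp: lincomb_def gauss_def space_PiM PiE_iff extensional_def)
  qed
qed

text \<open>The hypotheses are symmetric in \<open>a\<close> and \<open>b\<close>, so the locale can
  be interpreted with the two exchanged; results on \<open>second_quant d a\<close> then give those
  on \<open>second_quant d b\<close>.\<close>

locale rotation =
  fixes a b :: real
  assumes a_pos: "a > 0" and b_pos: "b > 0" and ab1: "a\<^sup>2 + b\<^sup>2 = 1"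
begin

lemma nn_integral_rot:
  assumes [measurable]: "F \<in> borel_measurable (gauss d \<Otimes>\<^sub>M gauss d)"
  shows "(\<integral>\<^sup>+z. F (rot d a b z) \<partial>(gauss d \<Otimes>\<^sub>M gauss d)) = (\<integral>\<^sup>+z. F z \<partial>(gauss d \<Otimes>\<^sub>M gauss d))"
proof -
  have "(\<integral>\<^sup>+x. \<integral>\<^sup>+y. F (rot d a b (x, y)) \<partial>gauss d \<partial>gauss d) = (\<integral>\<^sup>+x. \<integral>\<^sup>+y. F (x, y) \<partial>gauss d \<partial>gauss d)"
    using nn_integral_PiM_rotation[OF _ a_pos b_pos ab1, of "{..<d}" F] assms
    by (simp add: gauss_def rot_def)
  then show ?thesis
    by (simp add: gauss.nn_integral_fst[symmetric])
qed

text \<open>Invariance as an identity of image measures, from which complex integrals, integrability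
  and null sets all transfer.\<close>

lemma distr_rot: "distr (gauss d \<Otimes>\<^sub>M gauss d) (gauss d \<Otimes>\<^sub>M gauss d) (rot d a b) = gauss d \<Otimes>\<^sub>M gauss d"
proof (rule measure_eqI)
  fix A assume "A \<in> sets (distr (gauss d \<Otimes>\<^sub>M gauss d) (gauss d \<Otimes>\<^sub>M gauss d) (rot d a b))"
  then have A [measurable]: "A \<in> sets (gauss d \<Otimes>\<^sub>M gauss d)" by simp
  have "emeasure (distr (gauss d \<Otimes>\<^sub>M gauss d) (gauss d \<Otimes>\<^sub>M gauss d) (rot d a b)) A
      = (\<integral>\<^sup>+z. indicator A z \<partial>distr (gauss d \<Otimes>\<^sub>M gauss d) (gauss d \<Otimes>\<^sub>M gauss d) (rot d a b))"
    by simp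
  also have "\<dots> = (\<integral>\<^sup>+z. indicator A (rot d a b z) \<partial>(gauss d \<Otimes>\<^sub>M gauss d))"
    by (rule nn_integral_distr) measurable
  also have "\<dots> = emeasure (gauss d \<Otimes>\<^sub>M gauss d) A"
    by (subst nn_integral_rot) auto
  finally show "emeasure (distr (gauss d \<Otimes>\<^sub>M gauss d) (gauss d \<Otimes>\<^sub>M gauss d) (rot d a b)) A
      = emeasure (gauss d \<Otimes>\<^sub>M gauss d) A" .
qed simp

lemma integral_rot:
  fixes F :: "(nat \<Rightarrow> real) \<times> (nat \<Rightarrow> real) \<Rightarrow> complex"
  assumes [measurable]: "F \<in> borel_measurable (gauss d \<Otimes>\<^sub>M gauss d)"
  shows "(\<integral>z. F (rot d a b z) \<partial>(gauss d \<Otimes>\<^sub>M gauss d)) = (\<integral>z. F z \<partial>(gauss d \<Otimes>\<^sub>M gauss d))"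
  using integral_distr[OF rot_measurable assms, of a b] by (simp add: distr_rot)

lemma integrable_rot:
  fixes F :: "(nat \<Rightarrow> real) \<times> (nat \<Rightarrow> real) \<Rightarrow> complex"
  assumes F: "integrable (gauss d \<Otimes>\<^sub>M gauss d) F"
  shows "integrable (gauss d \<Otimes>\<^sub>M gauss d) (\<lambda>z. F (rot d a b z))"
  using F by (intro integrable_distr[OF rot_measurable, where f=F]) (simp add: distr_rot)

lemma AE_rot:
  assumes "AE z in gauss d \<Otimes>\<^sub>M gauss d. P z"
  shows "AE z in gauss d \<Otimes>\<^sub>M gauss d. P (rot d a b z)"
  using assms by (intro AE_distrD[OF rot_measurable]) (unfold distr_rot)

end

section \<open>Polynomials\<close>

text \<open>A monomial is coded by the list of its factors: length is degree, append is
  multiplication, and induction peels off one coordinate at a time. Different lists may code the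
  same monomial.\<close>

definition xmon :: "nat list \<Rightarrow> (nat \<Rightarrow> real) \<Rightarrow> complex" where
  "xmon l x = (\<Prod>i\<leftarrow>l. complex_of_real (x i))"

definition xmons :: "nat \<Rightarrow> nat \<Rightarrow> ((nat \<Rightarrow> real) \<Rightarrow> complex) set" where
  "xmons d n = xmon ` {l. set l \<subseteq> {..<d} \<and> length l \<le> n}"

lemma xmon_simps [simp]: "xmon [] x = 1" "xmon (i # l) x = x i * xmon l x"
  by (simp_all add: xmon_def)

lemma xmon_append: "xmon (l @ l') x = xmon l x * xmon l' x"
  by (induction l) (simp_all add: mult.assoc)

lemma xmon_in_xmons: "set l \<subseteq> {..<d} \<Longrightarrow> length l \<le> n \<Longrightarrow> xmon l \<in> xmons d n"
  by (auto simp: xmons_def)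

lemma xmons_mono: "m \<le> n \<Longrightarrow> xmons d m \<subseteq> xmons d n"
  by (auto simp: xmons_def)

lemma xmon_eq_prod_power:
  assumes "set l \<subseteq> {..<d}"
  shows "xmon l x = (\<Prod>i<d. complex_of_real (x i) ^ count (mset l) i)"
  using assms
proof (induction l)
  case (Cons j l)
  have "(\<Prod>i<d. complex_of_real (x i) ^ count (mset (j # l)) i)
      = (\<Prod>i<d. (if i = j then complex_of_real (x i) else 1) * complex_of_real (x i) ^ count (mset l) i)"
    by (intro prod.cong) auto
  also have "\<dots> = (\<Prod>i<d. if i = j then complex_of_real (x i) else 1) * (\<Prod>i<d. complex_of_real (x i) ^ count (mset l) i)"
    by (rule prod.distrib)
  also have "(\<Prod>i<d. if i = j then complex_of_real (x i) else 1) = complex_of_real (x j)"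
    using Cons.prems by (simp add: prod.delta')
  finally show ?case using Cons by simp
qed simp

lemma sum_count_mset_lessThan:
  fixes l :: "nat list"
  assumes "set l \<subseteq> {..<d}"
  shows "(\<Sum>i<d. count (mset l) i) = length l"
proof -
  have "size (mset l) = (\<Sum>i\<in>{..<d}. count (mset l) i)"
    unfolding size_multiset_overloaded_eq
    using assms by (intro sum.mono_neutral_left) (auto simp: count_eq_zero_iff)
  then show ?thesis by simp
qed

lemma xmon_concat_replicate:
  "xmon (concat (map (\<lambda>i. replicate (a i) i) l)) x = (\<Prod>i\<leftarrow>l. complex_of_real (x i) ^ a i)"
proof (induction l)
  case (Cons j l)
  have "xmon (replicate n j) x = complex_of_real (x j) ^ n" for n
    by (induction n) auto
  then show ?case using Cons by (simp add: xmon_append)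
qed simp

text \<open>Exponent functions and lists of factors are translated into each other by repeating
  index \<open>i\<close> as often as its exponent says, and by counting occurrences.\<close>

lemma polys_eq_cspan: "polys d n = cspan (xmons d n)"
proof (intro equalityI subsetI)
  fix f assume "f \<in> polys d n"
  then obtain A c where f: "f = (\<lambda>x. \<Sum>a\<in>A. c a * (\<Prod>i<d. complex_of_real (x i) ^ a i))"
    and A: "finite A" "\<forall>a\<in>A. (\<Sum>i<d. a i) \<le> n"
    unfolding polys_def by auto
  show "f \<in> cspan (xmons d n)"
    unfolding f
  proof (intro cspan_sum cspan_cmult)
    fix a :: "nat \<Rightarrow> nat" assume "a \<in> A"
    define l where "l = concat (map (\<lambda>i. replicate (a i) i) [0..<d])"
    have "length l = (\<Sum>i<d. a i)"
      by (simp add: l_def length_concat comp_def interv_sum_list_conv_sum_set_nat atLeast0LessThan)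
    then have "xmon l \<in> xmons d n"
      using A \<open>a \<in> A\<close> by (intro xmon_in_xmons) (auto simp: l_def)
    moreover have "xmon l = (\<lambda>x. \<Prod>i<d. complex_of_real (x i) ^ a i)"
      unfolding l_def xmon_concat_replicate fun_eq_iff
      by (simp add: prod.distinct_set_conv_list[symmetric] atLeast0LessThan)
    ultimately show "(\<lambda>x. \<Prod>i<d. complex_of_real (x i) ^ a i) \<in> cspan (xmons d n)"
      using cspan_base by metis
  qed
next
  fix f assume "f \<in> cspan (xmons d n)"
  then show "f \<in> polys d n"
  proof (induction rule: cspan.induct)
    case zero
    show ?case unfolding polys_def by (intro CollectI exI[of _ "{}"]) simp
  next
    case (step b f k)
    then obtain A c where f: "f = (\<lambda>x. \<Sum>a\<in>A. c a * (\<Prod>i<d. complex_of_real (x i) ^ a i))"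
      and A: "finite A" "\<forall>a\<in>A. (\<Sum>i<d. a i) \<le> n"
      unfolding polys_def by auto
    obtain l where l: "set l \<subseteq> {..<d}" "length l \<le> n" "b = xmon l"
      using step(1) by (auto simp: xmons_def)
    define \<alpha> where "\<alpha> = count (mset l)"
    \<comment> \<open>The exponent of the new monomial may already occur in \<open>A\<close>, so the
      two contributions to its coefficient are added.\<close>
    define c' where "c' a = (if a = \<alpha> then k else 0) + (if a \<in> A then c a else 0)" for a
    have "k * b x + f x = (\<Sum>a\<in>insert \<alpha> A. c' a * (\<Prod>i<d. complex_of_real (x i) ^ a i))" for x
    proof -
      let ?m = "\<lambda>a. \<Prod>i<d. complex_of_real (x i) ^ a i"
      have "(\<Sum>a\<in>insert \<alpha> A. c' a * ?m a)
        = (\<Sum>a\<in>insert \<alpha> A. if a = \<alpha> then k * ?m a else 0) + (\<Sum>a\<in>insert \<alpha> A. if a \<in> A then c a * ?m a else 0)"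
        unfolding sum.distrib[symmetric] by (intro sum.cong) (auto simp: c'_def algebra_simps)
      also have "(\<Sum>a\<in>insert \<alpha> A. if a = \<alpha> then k * ?m a else 0) = k * ?m \<alpha>"
        using A(1) by (subst sum.delta) auto
      also have "(\<Sum>a\<in>insert \<alpha> A. if a \<in> A then c a * ?m a else 0) = (\<Sum>a\<in>A. c a * ?m a)"
        using A(1) by (intro sum.mono_neutral_cong_right) auto
      finally show ?thesis using l by (simp add: f xmon_eq_prod_power \<alpha>_def)
    qed
    moreover have "(\<Sum>i<d. \<alpha> i) \<le> n"
      using l by (simp add: \<alpha>_def sum_count_mset_lessThan)
    ultimately show ?case
      unfolding polys_def using A by (intro CollectI exI[of _ "insert \<alpha> A"] exI[of _ c']) auto
  qed
qed

lemma polys_add: "f \<in> polys d n \<Longrightarrow> g \<in> polys d n \<Longrightarrow> (\<lambda>x. f x + g x) \<in> polys d n"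
  unfolding polys_eq_cspan by (rule cspan_add)

lemma polys_diff: "f \<in> polys d n \<Longrightarrow> g \<in> polys d n \<Longrightarrow> (\<lambda>x. f x - g x) \<in> polys d n"
  unfolding polys_eq_cspan by (rule cspan_diff)

lemma polys_cmult: "f \<in> polys d n \<Longrightarrow> (\<lambda>x. c * f x) \<in> polys d n"
  unfolding polys_eq_cspan by (rule cspan_cmult)

lemma polys_sum: "(\<And>i. i \<in> I \<Longrightarrow> f i \<in> polys d n) \<Longrightarrow> (\<lambda>x. \<Sum>i\<in>I. f i x) \<in> polys d n"
  unfolding polys_eq_cspan by (rule cspan_sum)

lemma polys_zero: "(\<lambda>x. 0) \<in> polys d n"
  unfolding polys_eq_cspan by (rule cspan.zero)

lemma polys_mono: "m \<le> n \<Longrightarrow> f \<in> polys d m \<Longrightarrow> f \<in> polys d n"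
  unfolding polys_eq_cspan using cspan_mono[OF xmons_mono] by blast

lemma xmon_in_polys: "set l \<subseteq> {..<d} \<Longrightarrow> length l \<le> n \<Longrightarrow> xmon l \<in> polys d n"
  unfolding polys_eq_cspan by (intro cspan_base xmon_in_xmons)

lemma one_in_polys: "(\<lambda>x. 1) \<in> polys d n"
proof -
  have "xmon [] = (\<lambda>x. 1)" by (rule ext) simp
  then show ?thesis using xmon_in_polys[of "[]" d n] by simp
qed

lemma polys_mult: "f \<in> polys d m \<Longrightarrow> g \<in> polys d n \<Longrightarrow> (\<lambda>x. f x * g x) \<in> polys d (m + n)"
  unfolding polys_eq_cspan
proof (erule (1) cspan_mult)
  fix b c assume "b \<in> xmons d m" "c \<in> xmons d n"
  then obtain l l' where l: "b = xmon l" "set l \<subseteq> {..<d}" "length l \<le> m"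
    "c = xmon l'" "set l' \<subseteq> {..<d}" "length l' \<le> n"
    by (auto simp: xmons_def)
  have "xmon (l @ l') \<in> cspan (xmons d (m + n))"
    using l by (intro cspan_base xmon_in_xmons) auto
  moreover have "xmon (l @ l') = (\<lambda>x. b x * c x)" by (simp add: fun_eq_iff xmon_append l)
  ultimately show "(\<lambda>x. b x * c x) \<in> cspan (xmons d (m + n))" by simp
qed

section \<open>Exponential domination of polynomials\<close>

text \<open>One family of dominating functions: the parameters add under products, monomials and
  partial sums of exponential series are bounded by it, and it is square integrable for every
  \<open>c\<close>.\<close>

definition gexp :: "nat \<Rightarrow> real \<Rightarrow> (nat \<Rightarrow> real) \<Rightarrow> real" where
  "gexp d c x = exp (c * (\<Sum>i<d. \<bar>x i\<bar>))"

lemma component_measurable_gauss [measurable]: "i < d \<Longrightarrow> (\<lambda>x. x i) \<in> borel_measurable (gauss d)"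
  unfolding gauss_def using measurable_component_singleton[of i "{..<d}" "\<lambda>_. gauss1"] by simp

lemma gexp_measurable [measurable]: "gexp d c \<in> borel_measurable (gauss d)"
  unfolding gexp_def by measurable

text \<open>Completing the square absorbs the exponential factor into half of the exponent of the
  density, leaving a multiple of the normal density of variance 2.\<close>

lemma gauss1_exp_abs_finite: "(\<integral>\<^sup>+x. ennreal (exp (c * \<bar>x\<bar>)) \<partial>gauss1) < \<infinity>"
proof -
  have "std_normal_density x * exp (c * \<bar>x\<bar>) \<le> exp (c\<^sup>2) * sqrt 2 * normal_density 0 (sqrt 2) x" for x
  proof -
    have "0 \<le> (\<bar>x\<bar> / 2 - c)\<^sup>2" by simp
    then have "- (x\<^sup>2 / 2) + c * \<bar>x\<bar> \<le> c\<^sup>2 - x\<^sup>2 / 4"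
      by (simp add: power2_diff field_simps)
    then have "exp (- (x\<^sup>2 / 2)) * exp (c * \<bar>x\<bar>) \<le> exp (c\<^sup>2) * exp (- (x\<^sup>2 / 4))"
      by (simp add: exp_add[symmetric])
    then have "1 / sqrt (2 * pi) * (exp (- (x\<^sup>2 / 2)) * exp (c * \<bar>x\<bar>)) \<le> 1 / sqrt (2 * pi) * (exp (c\<^sup>2) * exp (- (x\<^sup>2 / 4)))"
      by (rule mult_left_mono) simp
    moreover have "sqrt 2 * normal_density 0 (sqrt 2) x = 1 / sqrt (2 * pi) * exp (- (x\<^sup>2 / 4))"
      by (simp add: normal_density_def real_sqrt_mult field_simps)
    ultimately show ?thesis
      by (simp add: std_normal_density_def mult.assoc)
  qed
  then have "(\<integral>\<^sup>+x. ennreal (std_normal_density x) * ennreal (exp (c * \<bar>x\<bar>)) \<partial>lborel)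
     \<le> (\<integral>\<^sup>+x. ennreal (exp (c\<^sup>2) * sqrt 2 * normal_density 0 (sqrt 2) x) \<partial>lborel)"
    by (intro nn_integral_mono) (simp add: ennreal_mult[symmetric])
  also have "\<dots> < \<infinity>"
    by (subst nn_integral_eq_integral) (auto intro!: integrable_mult_right integrable_normal_density)
  finally show ?thesis
    by (subst nn_integral_density) auto
qed

lemma integrable_gexp: "integrable (gauss d) (gexp d c)"
proof (rule integrableI_nonneg)
  have "(\<integral>\<^sup>+x. ennreal (gexp d c x) \<partial>gauss d)
    = (\<integral>\<^sup>+x. (\<Prod>i<d. ennreal (exp (c * \<bar>x i\<bar>))) \<partial>PiM {..<d} (\<lambda>_. gauss1))"
    unfolding gauss_def gexp_def by (simp add: sum_distrib_left exp_sum prod_ennreal)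
  also have "\<dots> = (\<Prod>i<d. \<integral>\<^sup>+x. ennreal (exp (c * \<bar>x\<bar>)) \<partial>gauss1)"
    by (rule gaussP.product_nn_integral_prod) auto
  also have "\<dots> < \<infinity>"
    using gauss1_exp_abs_finite[of c] by (simp add: power_less_top_ennreal)
  finally show "(\<integral>\<^sup>+x. ennreal (gexp d c x) \<partial>gauss d) < \<infinity>" .
qed (auto simp: gexp_def)

lemma sqint_gexp: "sqint (gauss d) (\<lambda>x. complex_of_real (gexp d c x))"
proof -
  have "(norm (complex_of_real (gexp d c x)))\<^sup>2 = gexp d (2 * c) x" for x
    by (simp add: gexp_def exp_double[symmetric] mult.assoc)
  then show ?thesis
    using integrable_gexp by (simp add: sqint_def)
qed

lemma gexp_mult: "gexp d c x * gexp d c' x = gexp d (c + c') x"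
  by (simp add: gexp_def exp_add[symmetric] ring_distribs)

lemma abs_le_sum: "i < d \<Longrightarrow> \<bar>x i\<bar> \<le> (\<Sum>i<d. \<bar>x i\<bar>)" for x :: "nat \<Rightarrow> real"
  by (rule member_le_sum) auto

lemma norm_xmon_le_gexp: "set l \<subseteq> {..<d} \<Longrightarrow> norm (xmon l x) \<le> gexp d (length l) x"
proof (induction l)
  case Nil
  show ?case by (simp add: gexp_def)
next
  case (Cons i l)
  have "\<bar>x i\<bar> \<le> gexp d 1 x"
    using abs_le_sum[of i d x] exp_ge_add_one_self[of "\<Sum>i<d. \<bar>x i\<bar>"] Cons.prems
    unfolding gexp_def by (simp del: exp_ge_add_one_self)
  then have "norm (xmon (i # l) x) \<le> gexp d 1 x * gexp d (length l) x"
    using Cons by (auto simp: norm_mult intro!: mult_mono simp: gexp_def)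
  then show ?case by (simp add: gexp_mult add.commute)
qed

lemma gexp_mono: "c \<le> c' \<Longrightarrow> gexp d c x \<le> gexp d c' x"
  unfolding gexp_def by (auto intro!: mult_right_mono sum_nonneg)

lemma xmon_measurable: "set l \<subseteq> {..<d} \<Longrightarrow> xmon l \<in> borel_measurable (gauss d)"
proof (induction l)
  case (Cons i l)
  then have [measurable]: "xmon l \<in> borel_measurable (gauss d)" "(\<lambda>x. x i) \<in> borel_measurable (gauss d)"
    by auto
  have "xmon (i # l) = (\<lambda>x. complex_of_real (x i) * xmon l x)" by (rule ext) simp
  moreover have "(\<lambda>x. complex_of_real (x i) * xmon l x) \<in> borel_measurable (gauss d)" by measurable
  ultimately show ?case by simp
next
  case Nil
  have "xmon [] = (\<lambda>x. 1)" by (rule ext) simp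
  then show ?case by simp
qed

lemma polys_gexp_bound:
  assumes "p \<in> polys d n"
  shows "p \<in> borel_measurable (gauss d) \<and> (\<exists>C\<ge>0. \<forall>x. norm (p x) \<le> C * gexp d n x)"
  using assms unfolding polys_eq_cspan
proof (induction rule: cspan.induct)
  case zero
  show ?case by (auto intro!: exI[of _ 0])
next
  case (step b f c)
  then obtain l where l: "b = xmon l" "set l \<subseteq> {..<d}" "length l \<le> n" by (auto simp: xmons_def)
  obtain C where C: "C \<ge> 0" "\<forall>x. norm (f x) \<le> C * gexp d n x" using step by auto
  have [measurable]: "b \<in> borel_measurable (gauss d)" "f \<in> borel_measurable (gauss d)"
    using l xmon_measurable step by auto
  have "norm (c * b x + f x) \<le> (norm c + C) * gexp d n x" for x
  proof -
    have "norm (b x) \<le> gexp d n x"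
      using order_trans[OF norm_xmon_le_gexp[OF l(2)] gexp_mono[of "length l" n]] l by auto
    then have "norm (c * b x) \<le> norm c * gexp d n x" by (simp add: norm_mult mult_left_mono)
    then show ?thesis
      using norm_triangle_ineq[of "c * b x" "f x"] C(2)[rule_format, of x] by (simp add: ring_distribs)
  qed
  then show ?case using C(1) by (auto intro!: exI[of _ "norm c + C"])
qed

lemma polys_sqint: "p \<in> polys d n \<Longrightarrow> sqint (gauss d) p"
proof -
  assume "p \<in> polys d n"
  then obtain C where "p \<in> borel_measurable (gauss d)" "\<And>x. norm (p x) \<le> C * gexp d n x"
    using polys_gexp_bound by blast
  then show ?thesis
    by (intro sqint_bound[OF _ sqint_gexp[of d n], of p C]) (auto simp: gexp_def)
qed

section \<open>Density of the polynomials\<close>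

lemma sqn_dominated:
  assumes f: "f \<in> borel_measurable M" and F: "\<And>k. F k \<in> borel_measurable M" and g: "sqint M g"
    and lim: "AE x in M. (\<lambda>k. F k x) \<longlonglongrightarrow> f x" and bd: "\<And>k. AE x in M. norm (F k x) \<le> norm (g x)"
  shows "sqint M f" "\<And>k. sqint M (F k)" "(\<lambda>k. sqn M (\<lambda>x. F k x - f x)) \<longlonglongrightarrow> 0"
proof -
  note [measurable] = f F sqint_measurable[OF g]
  have "AE x in M. \<forall>k. norm (F k x) \<le> norm (g x)"
    using bd by (simp add: AE_all_countable)
  with lim have bf: "AE x in M. norm (f x) \<le> norm (g x)"
  proof eventually_elim
    case (elim x)
    then show ?case
      by (intro tendsto_upperbound[OF tendsto_norm[OF elim(1)]]) auto
  qed
  show "sqint M f" by (rule sqint_bound[OF f g, of 1]) (use bf in simp)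
  show "sqint M (F k)" for k by (rule sqint_bound[OF F[of k] g, of 1]) (use bd in simp)
  have "(\<lambda>k. \<integral>x. (norm (F k x - f x))\<^sup>2 \<partial>M) \<longlonglongrightarrow> (\<integral>x. 0 \<partial>M)"
  proof (rule integral_dominated_convergence)
    show "integrable M (\<lambda>x. 4 * (norm (g x))\<^sup>2)" using g by (simp add: sqint_def)
    show "AE x in M. (\<lambda>k. (norm (F k x - f x))\<^sup>2) \<longlonglongrightarrow> 0"
      using lim
    proof eventually_elim
      case (elim x)
      have "(\<lambda>k. (norm (F k x - f x))\<^sup>2) \<longlonglongrightarrow> (norm (f x - f x))\<^sup>2"
        by (intro tendsto_intros elim)
      then show ?case by simp
    qed
    show "AE x in M. norm ((norm (F k x - f x))\<^sup>2) \<le> 4 * (norm (g x))\<^sup>2" for k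
      using bd[of k] bf
    proof eventually_elim
      case (elim x)
      have "norm (F k x - f x) \<le> 2 * norm (g x)"
        using norm_triangle_ineq4[of "F k x" "f x"] elim by simp
      then have "(norm (F k x - f x))\<^sup>2 \<le> (2 * norm (g x))\<^sup>2" by (rule power_mono) simp
      then show ?case by (simp add: power_mult_distrib)
    qed
  qed auto
  then show "(\<lambda>k. sqn M (\<lambda>x. F k x - f x)) \<longlonglongrightarrow> 0" by (simp add: sqn_def)
qed

definition polyL2 :: "nat \<Rightarrow> ((nat \<Rightarrow> real) \<Rightarrow> complex) set" where
  "polyL2 d = {f. sqint (gauss d) f \<and> (\<forall>e>0. \<exists>n. \<exists>p\<in>polys d n. sqn (gauss d) (\<lambda>x. f x - p x) < e)}"

lemma polyL2_sqint: "f \<in> polyL2 d \<Longrightarrow> sqint (gauss d) f"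
  by (simp add: polyL2_def)

lemma polyL2D: "f \<in> polyL2 d \<Longrightarrow> e > 0 \<Longrightarrow> \<exists>n. \<exists>p\<in>polys d n. sqn (gauss d) (\<lambda>x. f x - p x) < e"
  by (simp add: polyL2_def)

lemma polys_polyL2: "p \<in> polys d n \<Longrightarrow> p \<in> polyL2 d"
  unfolding polyL2_def using polys_sqint[of p d n]
  by (auto intro!: exI[of _ n] bexI[of _ p] simp: sqn_def)

lemma polyL2_lim:
  assumes v: "\<And>k. v k \<in> polyL2 d" and f: "sqint (gauss d) f"
    and lim: "(\<lambda>k. sqn (gauss d) (\<lambda>x. v k x - f x)) \<longlonglongrightarrow> 0"
  shows "f \<in> polyL2 d"
  unfolding polyL2_def
proof (intro CollectI conjI allI impI f)
  fix e :: real assume e: "e > 0"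
  then obtain k where k: "sqn (gauss d) (\<lambda>x. v k x - f x) < e / 4"
    using order_tendstoD(2)[OF lim, of "e / 4"] by (auto simp: eventually_sequentially)
  obtain n p where p: "p \<in> polys d n" "sqn (gauss d) (\<lambda>x. v k x - p x) < e / 4"
    using polyL2D[OF v[of k], of "e / 4"] e by auto
  have "sqn (gauss d) (\<lambda>x. f x - p x) \<le> 2 * sqn (gauss d) (\<lambda>x. f x - v k x) + 2 * sqn (gauss d) (\<lambda>x. v k x - p x)"
    by (rule sqn_triangle[OF f polyL2_sqint[OF v] polys_sqint[OF p(1)]])
  also have "\<dots> < e"
    using k p by (subst sqn_minus_commute) simp
  finally show "\<exists>n. \<exists>p\<in>polys d n. sqn (gauss d) (\<lambda>x. f x - p x) < e"
    using p by blast
qed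

lemma polyL2_dominated:
  assumes "\<And>k. v k \<in> polyL2 d" "f \<in> borel_measurable (gauss d)" "sqint (gauss d) g"
    "\<And>x. x \<in> space (gauss d) \<Longrightarrow> (\<lambda>k. v k x) \<longlonglongrightarrow> f x"
    "\<And>k x. x \<in> space (gauss d) \<Longrightarrow> norm (v k x) \<le> norm (g x)"
  shows "f \<in> polyL2 d"
proof (rule polyL2_lim[OF assms(1)])
  have v: "v k \<in> borel_measurable (gauss d)" for k
    using polyL2_sqint[OF assms(1)] by (rule sqint_measurable)
  show "sqint (gauss d) f" "(\<lambda>k. sqn (gauss d) (\<lambda>x. v k x - f x)) \<longlonglongrightarrow> 0"
    by (rule sqn_dominated[OF assms(2), of v, OF v assms(3)]; use assms(4,5) in auto)+
qed

lemma polyL2_add: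
  assumes "f \<in> polyL2 d" "g \<in> polyL2 d" shows "(\<lambda>x. f x + g x) \<in> polyL2 d"
  unfolding polyL2_def
proof (intro CollectI conjI allI impI sqint_add polyL2_sqint assms)
  fix e :: real assume e: "e > 0"
  obtain n p where p: "p \<in> polys d n" "sqn (gauss d) (\<lambda>x. f x - p x) < e / 4"
    using polyL2D[OF assms(1), of "e / 4"] e by auto
  obtain m q where q: "q \<in> polys d m" "sqn (gauss d) (\<lambda>x. g x - q x) < e / 4"
    using polyL2D[OF assms(2), of "e / 4"] e by auto
  have "(\<lambda>x. p x + q x) \<in> polys d (max m n)"
    using p q by (intro polys_add) (auto intro: polys_mono[of n "max m n"] polys_mono[of m "max m n"])
  moreover have "sqn (gauss d) (\<lambda>x. (f x - p x) + (g x - q x)) \<le> 2 * sqn (gauss d) (\<lambda>x. f x - p x) + 2 * sqn (gauss d) (\<lambda>x. g x - q x)"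
    by (intro sqn_add sqint_diff polyL2_sqint[OF assms(1)] polyL2_sqint[OF assms(2)]
      polys_sqint[OF p(1)] polys_sqint[OF q(1)])
  then have "sqn (gauss d) (\<lambda>x. (f x + g x) - (p x + q x)) < e"
    using p q by (simp add: algebra_simps)
  ultimately show "\<exists>n. \<exists>p\<in>polys d n. sqn (gauss d) (\<lambda>x. f x + g x - p x) < e"
    by (intro exI[of _ "max m n"] bexI[of _ "\<lambda>x. p x + q x"])
qed

lemma polyL2_cmult:
  assumes "f \<in> polyL2 d" shows "(\<lambda>x. c * f x) \<in> polyL2 d"
  unfolding polyL2_def
proof (intro CollectI conjI allI impI sqint_cmult polyL2_sqint assms)
  fix e :: real assume e: "e > 0"
  \<comment> \<open>The added 1 keeps the divisor positive when \<open>c = 0\<close>.\<close>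
  have pos: "0 < (norm c)\<^sup>2 + 1" by (simp add: add_nonneg_pos)
  obtain n p where p: "p \<in> polys d n" "sqn (gauss d) (\<lambda>x. f x - p x) < e / ((norm c)\<^sup>2 + 1)"
    using polyL2D[OF assms, of "e / ((norm c)\<^sup>2 + 1)"] e pos by auto
  have "sqn (gauss d) (\<lambda>x. c * f x - c * p x) = (norm c)\<^sup>2 * sqn (gauss d) (\<lambda>x. f x - p x)"
    by (simp add: sqn_cmult flip: right_diff_distrib)
  also have "\<dots> \<le> ((norm c)\<^sup>2 + 1) * sqn (gauss d) (\<lambda>x. f x - p x)"
    by (intro mult_right_mono sqn_nonneg) simp
  also have "\<dots> < e" using p(2) pos by (simp add: field_simps)
  finally show "\<exists>n. \<exists>p\<in>polys d n. sqn (gauss d) (\<lambda>x. c * f x - p x) < e"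
    by (intro exI[of _ n] bexI[OF _ polys_cmult[OF p(1), of c]])
qed

text \<open>The multiplier algebra of \<^const>\<open>polyL2\<close>: unlike \<^const>\<open>polyL2\<close> itself it is visibly closed under products,
  which replaces a monotone class argument.\<close>

definition pmult :: "nat \<Rightarrow> ((nat \<Rightarrow> real) \<Rightarrow> complex) set" where
  "pmult d = {w. w \<in> borel_measurable (gauss d) \<and> (\<exists>C. \<forall>x\<in>space (gauss d). norm (w x) \<le> C) \<and>
     (\<forall>v\<in>polyL2 d. (\<lambda>x. w x * v x) \<in> polyL2 d)}"

lemma pmult_measurable: "w \<in> pmult d \<Longrightarrow> w \<in> borel_measurable (gauss d)"
  by (simp add: pmult_def)

lemma pmult_mult:
  assumes w: "w \<in> pmult d" and w': "w' \<in> pmult d"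
  shows "(\<lambda>x. w x * w' x) \<in> pmult d"
proof -
  note [measurable] = pmult_measurable[OF w] pmult_measurable[OF w']
  obtain C where C: "\<And>x. x \<in> space (gauss d) \<Longrightarrow> norm (w x) \<le> C"
    using w by (auto simp: pmult_def)
  obtain C' where C': "\<And>x. x \<in> space (gauss d) \<Longrightarrow> norm (w' x) \<le> C'"
    using w' by (auto simp: pmult_def)
  have "norm (w x * w' x) \<le> C * C'" if "x \<in> space (gauss d)" for x
    using C[OF that] C'[OF that] unfolding norm_mult by (intro mult_mono) (auto intro: order_trans[OF norm_ge_zero])
  then show ?thesis
    using w w' unfolding pmult_def by (auto simp: mult.assoc)
qed

lemma pmult_add:
  assumes w: "w \<in> pmult d" and w': "w' \<in> pmult d"
  shows "(\<lambda>x. w x + w' x) \<in> pmult d"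
proof -
  note [measurable] = pmult_measurable[OF w] pmult_measurable[OF w']
  obtain C where C: "\<And>x. x \<in> space (gauss d) \<Longrightarrow> norm (w x) \<le> C"
    using w by (auto simp: pmult_def)
  obtain C' where C': "\<And>x. x \<in> space (gauss d) \<Longrightarrow> norm (w' x) \<le> C'"
    using w' by (auto simp: pmult_def)
  have "norm (w x + w' x) \<le> C + C'" if "x \<in> space (gauss d)" for x
    using C[OF that] C'[OF that] norm_triangle_mono by blast
  then show ?thesis
    using w w' unfolding pmult_def by (auto simp: distrib_right intro!: polyL2_add)
qed

lemma pmult_const: "(\<lambda>x. c) \<in> pmult d"
  unfolding pmult_def by (auto intro: polyL2_cmult)

lemma pmult_cmult: "w \<in> pmult d \<Longrightarrow> (\<lambda>x. c * w x) \<in> pmult d"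
  by (rule pmult_mult[OF pmult_const])

lemma pmult_diff: "w \<in> pmult d \<Longrightarrow> w' \<in> pmult d \<Longrightarrow> (\<lambda>x. w x - w' x) \<in> pmult d"
  using pmult_add[of w d "\<lambda>x. (-1) * w' x"] pmult_cmult[of w' d "-1"] by simp

lemma pmult_sum: "(\<And>i. i \<in> I \<Longrightarrow> w i \<in> pmult d) \<Longrightarrow> (\<lambda>x. \<Sum>i\<in>I. w i x) \<in> pmult d"
  by (induction I rule: infinite_finite_induct) (simp_all add: pmult_const pmult_add)

lemma pmult_prod: "(\<And>i. i \<in> I \<Longrightarrow> w i \<in> pmult d) \<Longrightarrow> (\<lambda>x. \<Prod>i\<in>I. w i x) \<in> pmult d"
  by (induction I rule: infinite_finite_induct) (simp_all add: pmult_const pmult_mult)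

lemma pmult_power: "w \<in> pmult d \<Longrightarrow> (\<lambda>x. w x ^ n) \<in> pmult d"
  by (induction n) (simp_all add: pmult_const pmult_mult)

text \<open>For \<open>v\<close> in \<open>polyL2 d\<close>, the uniform bound gives the majorant
  \<open>C * v\<close>, so dominated convergence carries the multiplier property to the limit.
  Closure under bounded pointwise limits is what leads from trigonometric functions to
  indicators.\<close>

lemma pmult_lim:
  assumes w: "\<And>k. w k \<in> pmult d" and bd: "\<And>k x. x \<in> space (gauss d) \<Longrightarrow> norm (w k x) \<le> C"
    and lim: "\<And>x. x \<in> space (gauss d) \<Longrightarrow> (\<lambda>k. w k x) \<longlonglongrightarrow> f x"
  shows "f \<in> pmult d"
proof -
  have [measurable]: "f \<in> borel_measurable (gauss d)"
    by (rule borel_measurable_LIMSEQ_metric[OF pmult_measurable[OF w] lim])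
  have "norm (f x) \<le> C" if "x \<in> space (gauss d)" for x
    using bd[OF that] by (intro tendsto_upperbound[OF tendsto_norm[OF lim[OF that]]]) auto
  moreover have "(\<lambda>x. f x * v x) \<in> polyL2 d" if v: "v \<in> polyL2 d" for v
  proof (rule polyL2_dominated)
    note [measurable] = sqint_measurable[OF polyL2_sqint[OF v]]
    show "(\<lambda>x. w k x * v x) \<in> polyL2 d" for k using w[of k] v by (auto simp: pmult_def)
    show "(\<lambda>x. f x * v x) \<in> borel_measurable (gauss d)" by measurable
    show "sqint (gauss d) (\<lambda>x. complex_of_real C * v x)" by (intro sqint_cmult polyL2_sqint v)
    show "(\<lambda>k. w k x * v x) \<longlonglongrightarrow> f x * v x" if "x \<in> space (gauss d)" for x
      by (intro tendsto_intros lim that)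
    show "norm (w k x * v x) \<le> norm (complex_of_real C * v x)" if "x \<in> space (gauss d)" for k x
      using bd[OF that, of k] unfolding norm_mult by (intro mult_right_mono) auto
  qed
  ultimately show ?thesis by (auto simp: pmult_def)
qed

text \<open>A polynomial times a partial sum of the exponential series is a polynomial, and these
  products are dominated by a square integrable \<open>gexp\<close>; the decay of the Gaussian
  density enters here. Since \<open>e\<close> has modulus 1, multiplying by it preserves L^2
  distances, which extends the claim from polynomials to their closure.\<close>

lemma pmult_exp_linear:
  assumes i: "i < d"
  shows "(\<lambda>x. exp (\<i> * complex_of_real (t * x i))) \<in> pmult d"
proof -
  define e where "e x = exp (\<i> * complex_of_real (t * x i))" for x :: "nat \<Rightarrow> real"
  note [measurable] = component_measurable_gauss[OF i]
  have [measurable]: "e \<in> borel_measurable (gauss d)" unfolding e_def by measurable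
  have ne: "norm (e x) = 1" for x by (simp add: e_def)
  have ep: "(\<lambda>x. e x * p x) \<in> polyL2 d" if p: "p \<in> polys d n" for p n
  proof -
    define S where "S k x = (\<Sum>j<k. (\<i> * complex_of_real (t * x i)) ^ j /\<^sub>R fact j)" for k and x :: "nat \<Rightarrow> real"
    obtain C where C: "C \<ge> 0" "\<And>x. norm (p x) \<le> C * gexp d n x" and [measurable]: "p \<in> borel_measurable (gauss d)"
      using polys_gexp_bound[OF p] by blast
    have S: "S k \<in> polys d k" for k
      unfolding S_def
    proof (rule polys_sum)
      fix j assume "j \<in> {..<k}"
      then have "xmon (replicate j i) \<in> polys d k"
        using i by (intro xmon_in_polys) auto
      from polys_cmult[OF this, of "(\<i> * complex_of_real t) ^ j / fact j"]
      have "(\<lambda>x. (\<i> * complex_of_real t) ^ j / fact j * xmon (replicate j i) x) \<in> polys d k" .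
      moreover have "xmon (replicate j i) x = complex_of_real (x i) ^ j" for x
        by (induction j) simp_all
      ultimately show "(\<lambda>x. (\<i> * complex_of_real (t * x i)) ^ j /\<^sub>R fact j) \<in> polys d k"
        by (simp add: scaleR_conv_of_real power_mult_distrib field_simps)
    qed
    show ?thesis
    proof (rule polyL2_dominated)
      show "(\<lambda>x. S k x * p x) \<in> polyL2 d" for k
        using polys_mult[OF S p] by (rule polys_polyL2)
      show "(\<lambda>x. e x * p x) \<in> borel_measurable (gauss d)" by measurable
      \<comment> \<open>In the parameter, \<open>\<bar>t\<bar>\<close> comes from the exponential
        series and \<open>n\<close> from the growth of \<open>p\<close>.\<close>
      show "sqint (gauss d) (\<lambda>x. complex_of_real C * complex_of_real (gexp d (\<bar>t\<bar> + n) x))"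
        by (intro sqint_cmult sqint_gexp)
      show "(\<lambda>k. S k x * p x) \<longlonglongrightarrow> e x * p x" for x
      proof (rule tendsto_mult_right)
        have "(\<lambda>j. (\<i> * complex_of_real (t * x i)) ^ j /\<^sub>R fact j) sums exp (\<i> * complex_of_real (t * x i))"
          by (rule exp_converges)
        then show "(\<lambda>k. S k x) \<longlonglongrightarrow> e x" unfolding sums_def S_def e_def .
      qed
      show "norm (S k x * p x) \<le> norm (complex_of_real C * complex_of_real (gexp d (\<bar>t\<bar> + n) x))" for k x
      proof -
        have "norm (S k x) \<le> (\<Sum>j<k. norm ((\<i> * complex_of_real (t * x i)) ^ j /\<^sub>R fact j))"
          unfolding S_def by (rule norm_sum)
        also have "\<dots> = (\<Sum>j<k. (\<bar>t\<bar> * \<bar>x i\<bar>) ^ j /\<^sub>R fact j)"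
          by (intro sum.cong) (auto simp: norm_mult norm_power norm_divide abs_mult divide_inverse)
        also have "\<dots> \<le> exp (\<bar>t\<bar> * \<bar>x i\<bar>)"
          unfolding exp_def by (rule sum_le_suminf[OF summable_exp_generic]) auto
        also have "\<dots> \<le> gexp d \<bar>t\<bar> x"
          unfolding gexp_def using abs_le_sum[OF i, of x] by (simp add: mult_left_mono)
        finally have "norm (S k x) \<le> gexp d \<bar>t\<bar> x" .
        then have "norm (S k x) * norm (p x) \<le> gexp d \<bar>t\<bar> x * (C * gexp d n x)"
          using C by (intro mult_mono) (auto simp: gexp_def)
        also have "\<dots> = C * gexp d (\<bar>t\<bar> + n) x" by (simp add: gexp_mult[symmetric])
        finally show ?thesis using C(1) by (simp add: norm_mult gexp_def)
      qed
    qed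
  qed
  have "(\<lambda>x. e x * v x) \<in> polyL2 d" if v: "v \<in> polyL2 d" for v
  proof -
    note [measurable] = sqint_measurable[OF polyL2_sqint[OF v]]
    have "\<exists>p n. p \<in> polys d n \<and> sqn (gauss d) (\<lambda>x. v x - p x) < inverse (real (Suc k))" for k
      using polyL2D[OF v, of "inverse (real (Suc k))"] by auto
    then obtain p n where p: "\<And>k. p k \<in> polys d (n k)"
      "\<And>k. sqn (gauss d) (\<lambda>x. v x - p k x) < inverse (real (Suc k))" by metis
    show ?thesis
    proof (rule polyL2_lim[OF ep[OF p(1)]])
      show "sqint (gauss d) (\<lambda>x. e x * v x)"
        by (rule sqint_bound[OF _ polyL2_sqint[OF v], of _ 1]) (auto simp: norm_mult ne)
      have eq: "sqn (gauss d) (\<lambda>x. e x * p k x - e x * v x) = sqn (gauss d) (\<lambda>x. v x - p k x)" for k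
        unfolding sqn_def right_diff_distrib[symmetric] norm_mult ne by (simp add: norm_minus_commute)
      show "(\<lambda>k. sqn (gauss d) (\<lambda>x. e x * p k x - e x * v x)) \<longlonglongrightarrow> 0"
        unfolding eq
        by (rule tendsto_sandwich[OF _ _ tendsto_const LIMSEQ_inverse_real_of_nat])
           (use p(2) in \<open>auto intro!: always_eventually less_imp_le simp: sqn_nonneg simp del: of_nat_Suc\<close>)
    qed
  qed
  then show ?thesis
    unfolding pmult_def e_def[symmetric] using ne by auto
qed

lemma pmult_sin:
  assumes "i < d"
  shows "(\<lambda>x. complex_of_real (sin (t * x i))) \<in> pmult d"
proof -
  have "complex_of_real (sin (t * x i)) = (1 / (2 * \<i>)) * (exp (\<i> * complex_of_real (t * x i)) - exp (\<i> * complex_of_real ((-t) * x i)))" for x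
    by (simp add: sin_of_real[symmetric] sin_exp_eq)
  then show ?thesis
    by (simp only:) (intro pmult_cmult pmult_diff pmult_exp_linear assms)
qed

text \<open>Bernstein polynomials of \<open>G\<close> in \<open>y\<close> are multipliers because
  \<open>pmult d\<close> is an algebra, and they converge to \<open>G\<close> uniformly on the unit
  interval.\<close>

lemma pmult_continuous:
  fixes y :: "(nat \<Rightarrow> real) \<Rightarrow> real" and G :: "real \<Rightarrow> real"
  assumes y: "(\<lambda>x. complex_of_real (y x)) \<in> pmult d" "\<And>x. y x \<in> {0..1}" and G: "continuous_on {0..1} G"
  shows "(\<lambda>x. complex_of_real (G (y x))) \<in> pmult d"
proof -
  define B where "B n x = (\<Sum>k\<le>n. G (k / n) * Bernstein n k x)" for n x
  have "\<exists>n. \<forall>x\<in>{0..1}. \<bar>G x - B n x\<bar> < inverse (real (Suc m))" for m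
  proof -
    obtain N where "\<forall>n x. N \<le> n \<and> x \<in> {0..1} \<longrightarrow> \<bar>G x - B n x\<bar> < inverse (real (Suc m))"
      using Bernstein_Weierstrass[OF G, of "inverse (real (Suc m))"] unfolding B_def by auto
    then show ?thesis by blast
  qed
  then obtain n where n: "\<And>m x. x \<in> {0..1} \<Longrightarrow> \<bar>G x - B (n m) x\<bar> < inverse (real (Suc m))"
    by metis
  have "bounded (G ` {0..1})"
    using G by (intro compact_imp_bounded compact_continuous_image) auto
  then obtain C where C: "\<And>x. x \<in> {0..1} \<Longrightarrow> \<bar>G x\<bar> \<le> C"
    by (auto simp: bounded_iff simp del: atLeastAtMost_iff)
  show ?thesis
  proof (rule pmult_lim)
    show "(\<lambda>x. complex_of_real (B (n m) (y x))) \<in> pmult d" for m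
      unfolding B_def Bernstein_def of_real_sum of_real_mult of_real_power of_real_diff
      by (intro pmult_sum pmult_mult pmult_const pmult_power pmult_diff y)
    \<comment> \<open>\<open>C\<close> bounds \<open>G\<close>, and the approximation error is at
      most 1 for every \<open>m\<close>.\<close>
    show "norm (complex_of_real (B (n m) (y x))) \<le> C + 1" for m x
    proof -
      have "inverse (real (Suc m)) \<le> 1" by (simp add: field_simps)
      then show ?thesis using n[OF y(2), of x m] C[OF y(2), of x] by auto
    qed
    show "(\<lambda>m. complex_of_real (B (n m) (y x))) \<longlonglongrightarrow> complex_of_real (G (y x))" for x
    proof (intro tendsto_intros LIM_zero_cancel[where l="G (y x)"])
      show "(\<lambda>m. B (n m) (y x) - G (y x)) \<longlonglongrightarrow> 0"
      proof (rule Lim_null_comparison[OF always_eventually LIMSEQ_inverse_real_of_nat], rule allI)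
        show "norm (B (n m) (y x) - G (y x)) \<le> inverse (real (Suc m))" for m
          using n[OF y(2), of x m] by (simp add: abs_minus_commute del: of_nat_Suc)
      qed
    qed
  qed
qed

text \<open>Continuous ramps of slope \<open>m\<close> starting at \<open>c\<close>; they vanish at
  \<open>c\<close> itself, so the limit is the indicator of the open half-line.\<close>

lemma clamp_tendsto_indicator:
  "(\<lambda>m. min 1 (max 0 (real m * (y - c)))) \<longlonglongrightarrow> indicator {c<..} y" for y c :: real
proof (cases "y > c")
  case True
  then obtain m0 where m0: "1 / (y - c) \<le> real m0" using real_arch_simple by blast
  have "min 1 (max 0 (real m * (y - c))) = 1" if "m \<ge> m0" for m
  proof -
    have "1 \<le> real m0 * (y - c)" using m0 True by (simp add: field_simps)
    also have "\<dots> \<le> real m * (y - c)" using that True by (intro mult_right_mono) auto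
    finally show ?thesis by simp
  qed
  then have "\<forall>\<^sub>F m in sequentially. min 1 (max 0 (real m * (y - c))) = 1"
    unfolding eventually_sequentially by blast
  then show ?thesis using True by (simp add: tendsto_eventually)
next
  case False
  then have "real m * (y - c) \<le> 0" for m by (simp add: mult_nonneg_nonpos)
  then have "min 1 (max 0 (real m * (y - c))) = 0" for m by (simp add: max_absorb1)
  then show ?thesis using False by simp
qed

lemma pmult_indicator_greater:
  fixes y :: "(nat \<Rightarrow> real) \<Rightarrow> real"
  assumes y: "(\<lambda>x. complex_of_real (y x)) \<in> pmult d" "\<And>x. y x \<in> {0..1}"
  shows "(\<lambda>x. complex_of_real (indicator {c<..} (y x))) \<in> pmult d"
proof (rule pmult_lim)
  show "(\<lambda>x. complex_of_real (min 1 (max 0 (real m * (y x - c))))) \<in> pmult d" for m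
    by (rule pmult_continuous[OF y]) (intro continuous_intros)
  show "norm (complex_of_real (min 1 (max 0 (real m * (y x - c))))) \<le> 1" for m x
    by auto
  show "(\<lambda>m. complex_of_real (min 1 (max 0 (real m * (y x - c))))) \<longlonglongrightarrow> complex_of_real (indicator {c<..} (y x))" for x
    by (intro tendsto_of_real clamp_tendsto_indicator)
qed

text \<open>Trigonometric functions being the multipliers at hand, the half-space \<open>x\<^sub>i > c\<close> is obtained as the
  pointwise limit of the sets \<open>sin (x\<^sub>i / m) > sin (c / m)\<close>.\<close>

lemma pmult_indicator_halfspace:
  assumes "i < d"
  shows "(\<lambda>x. complex_of_real (indicator {c<..} (x i))) \<in> pmult d"
proof (rule pmult_lim)
  let ?y = "\<lambda>m x. (1 + sin (inverse (real (Suc m)) * x i)) / 2 :: real"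
  let ?c = "\<lambda>m. (1 + sin (inverse (real (Suc m)) * c)) / 2 :: real"
  show "(\<lambda>x. complex_of_real (indicator {?c m<..} (?y m x))) \<in> pmult d" for m
  proof (rule pmult_indicator_greater)
    have "(\<lambda>x. (1 / 2) * (1 + complex_of_real (sin (inverse (real (Suc m)) * x i)))) \<in> pmult d"
      by (intro pmult_cmult pmult_add pmult_const pmult_sin assms)
    then show "(\<lambda>x. complex_of_real (?y m x)) \<in> pmult d" by simp
    show "?y m x \<in> {0..1}" for x :: "nat \<Rightarrow> real"
      using sin_ge_minus_one[of "inverse (real (Suc m)) * x i"] sin_le_one[of "inverse (real (Suc m)) * x i"]
      by (simp del: of_nat_Suc sin_ge_minus_one sin_le_one)
  qed
  show "norm (complex_of_real (indicator {?c m<..} (?y m x))) \<le> 1" for m x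
    by (auto simp: indicator_def)
  show "(\<lambda>m. complex_of_real (indicator {?c m<..} (?y m x))) \<longlonglongrightarrow> complex_of_real (indicator {c<..} (x i))" for x
  proof (intro tendsto_of_real tendsto_eventually)
    \<comment> \<open>Eventually both arguments lie in the interval where the sine is strictly
      increasing, so comparing sines amounts to comparing \<open>c\<close> with
      \<open>x i\<close>.\<close>
    have small: "\<forall>\<^sub>F m in sequentially. \<bar>inverse (real (Suc m)) * z\<bar> < pi / 2" for z
    proof -
      have "(\<lambda>m. \<bar>inverse (real (Suc m)) * z\<bar>) \<longlonglongrightarrow> \<bar>0 * z\<bar>"
        by (intro tendsto_intros LIMSEQ_inverse_real_of_nat)
      then show ?thesis by (intro order_tendstoD(2)) auto
    qed
    show "\<forall>\<^sub>F m in sequentially. (indicator {?c m<..} (?y m x) :: real) = indicator {c<..} (x i)"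
      using small[of c] small[of "x i"]
    proof eventually_elim
      case (elim m)
      then have "sin (inverse (real (Suc m)) * c) < sin (inverse (real (Suc m)) * x i)
          \<longleftrightarrow> inverse (real (Suc m)) * c < inverse (real (Suc m)) * x i"
        by (intro sin_mono_less_eq) auto
      also have "\<dots> \<longleftrightarrow> c < x i" by (simp add: mult_less_cancel_left)
      finally show ?case by (simp add: indicator_def)
    qed
  qed
qed

definition indP :: "nat \<Rightarrow> (nat \<Rightarrow> real) set \<Rightarrow> bool" where
  "indP d A \<longleftrightarrow> (\<lambda>x. complex_of_real (indicator A x)) \<in> pmult d"

text \<open>A change outside \<open>space (gauss d)\<close> is covered by closure under limits,
  applied to a constant sequence.\<close>

lemma pmult_cong:
  assumes "w \<in> pmult d" "\<And>x. x \<in> space (gauss d) \<Longrightarrow> w x = w' x"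
  shows "w' \<in> pmult d"
proof -
  obtain C where "\<And>x. x \<in> space (gauss d) \<Longrightarrow> norm (w x) \<le> C"
    using assms(1) by (auto simp: pmult_def)
  then show ?thesis
    by (rule pmult_lim[where w="\<lambda>_. w" and C=C, OF assms(1)]) (simp_all add: assms(2)[symmetric])
qed

lemma indP_compl: "indP d A \<Longrightarrow> indP d (space (gauss d) - A)"
  unfolding indP_def
  by (rule pmult_cong[OF pmult_diff[OF pmult_const[of 1]]]) (auto simp: indicator_def)

text \<open>One minus the product of the complementary indicators is the indicator of a finite
  union, disjoint or not; so closure of multipliers under products makes these sets a sigma-algebra
  directly.\<close>

lemma indP_UN:
  assumes A: "\<And>k::nat. indP d (A k)"
  shows "indP d (\<Union>k. A k)"
  unfolding indP_def
proof (rule pmult_lim)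
  let ?w = "\<lambda>n x. 1 - (\<Prod>k<n. 1 - complex_of_real (indicator (A k) x))"
  have w: "?w n x = complex_of_real (indicator (\<Union>k<n. A k) x)" for n x
  proof (cases "x \<in> (\<Union>k<n. A k)")
    case True
    then obtain k where "k < n" "x \<in> A k" by auto
    then have "(\<Prod>k<n. 1 - complex_of_real (indicator (A k) x)) = 0"
      by (intro prod_zero bexI[of _ k]) auto
    then show ?thesis using True by simp
  qed (auto simp: indicator_def)
  show "?w n \<in> pmult d" for n
    using A by (intro pmult_diff pmult_const pmult_prod) (auto simp: indP_def)
  show "norm (?w n x) \<le> 1" for n x
    unfolding w by (auto simp: indicator_def)
  show "(\<lambda>n. ?w n x) \<longlonglongrightarrow> complex_of_real (indicator (\<Union>k. A k) x)" for x
    unfolding w by (intro tendsto_of_real LIMSEQ_indicator_UN)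
qed

text \<open>Two nested inductions over generated sigma-algebras: open half-lines generate the Borel
  sets of one coordinate, and one-coordinate cylinders generate the product sigma-algebra.\<close>

lemma indP_sets:
  assumes "A \<in> sets (gauss d)"
  shows "indP d A"
proof -
  let ?\<Omega> = "space (gauss d)"
  have \<Omega>: "?\<Omega> = (\<Pi>\<^sub>E i\<in>{..<d}. space gauss1)" by (simp add: gauss_def space_PiM)
  have basic: "indP d {f\<in>?\<Omega>. f i \<in> B}" if i: "i < d" and B: "B \<in> sets borel" for i and B :: "real set"
  proof -
    from B have "B \<in> sigma_sets UNIV (range greaterThan)"
      by (subst (asm) borel_Ioi) simp
    then show ?thesis
    proof (induction rule: sigma_sets.induct)
      case (Basic B)
      then obtain c where "B = {c<..}" by auto
      then show ?case
        unfolding indP_def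
        by (intro pmult_cong[OF pmult_indicator_halfspace[OF i, of c]]) (auto simp: indicator_def)
    next
      case Empty
      show ?case using pmult_const[of 0] by (simp add: indP_def)
    next
      case (Compl B)
      have "{f\<in>?\<Omega>. f i \<in> UNIV - B} = ?\<Omega> - {f\<in>?\<Omega>. f i \<in> B}" by auto
      then show ?case using indP_compl[OF Compl.IH] by simp
    next
      case (Union B)
      have "{f\<in>?\<Omega>. f i \<in> (\<Union>k. B k)} = (\<Union>k. {f\<in>?\<Omega>. f i \<in> B k})" by auto
      then show ?case using indP_UN[OF Union.IH] by simp
    qed
  qed
  have "A \<in> sigma_sets ?\<Omega> {{f\<in>?\<Omega>. f i \<in> B} | i B. i \<in> {..<d} \<and> B \<in> sets gauss1}"
    using assms unfolding \<Omega> unfolding gauss_def sets_PiM_single .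
  then show ?thesis
  proof (induction rule: sigma_sets.induct)
    case (Basic A)
    then show ?case using basic by auto
  next
    case Empty
    show ?case using pmult_const[of 0] by (simp add: indP_def)
  qed (auto intro: indP_compl indP_UN)
qed

text \<open>The constant 1 is a polynomial, so every multiplier, in particular every measurable
  indicator, lies in \<open>polyL2 d\<close>. Simple functions follow by linearity, and
  \<open>f\<close> is a limit of simple functions dominated by \<open>2 * f\<close>.\<close>

theorem polys_dense:
  assumes f: "sqint (gauss d) f"
  shows "f \<in> polyL2 d"
proof -
  note [measurable] = sqint_measurable[OF f]
  obtain F where F: "\<And>i. simple_function (gauss d) (F i)" "\<And>x. x \<in> space (gauss d) \<Longrightarrow> (\<lambda>i. F i x) \<longlonglongrightarrow> f x"
    "\<And>i x. x \<in> space (gauss d) \<Longrightarrow> dist (F i x) 0 \<le> 2 * dist (f x) 0"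
    using borel_measurable_implies_sequence_metric[OF sqint_measurable[OF f], of 0] by blast
  have one: "(\<lambda>x. 1) \<in> polyL2 d" using polys_polyL2[OF one_in_polys] .
  have ind: "(\<lambda>x. complex_of_real (indicator A x)) \<in> polyL2 d" if "A \<in> sets (gauss d)" for A
    using indP_sets[OF that] one unfolding indP_def pmult_def by force
  have sum: "(\<lambda>x. \<Sum>y\<in>Y. y * complex_of_real (indicator (B y) x)) \<in> polyL2 d"
    if "finite Y" "\<And>y. y \<in> Y \<Longrightarrow> B y \<in> sets (gauss d)" for Y B
    using that
  proof (induction Y rule: finite_induct)
    case empty
    show ?case using polyL2_cmult[OF one, of 0] by simp
  next
    case (insert y Y)
    then show ?case by (simp add: polyL2_add polyL2_cmult ind)
  qed
  define S where "S i x = (\<Sum>y\<in>F i ` space (gauss d). y * complex_of_real (indicator (F i -` {y} \<inter> space (gauss d)) x))" for i x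
  have S: "S i x = F i x" if "x \<in> space (gauss d)" for i x
    unfolding S_def simple_function_indicator_representation_banach[OF F(1) that, of i]
    by (intro sum.cong) (simp_all add: scaleR_conv_of_real mult.commute)
  show ?thesis
  proof (rule polyL2_dominated)
    show "S i \<in> polyL2 d" for i
      unfolding S_def using F(1)[of i] by (intro sum) (auto simp: simple_function_def)
    show "sqint (gauss d) (\<lambda>x. 2 * f x)" by (intro sqint_cmult f)
    show "(\<lambda>i. S i x) \<longlonglongrightarrow> f x" if "x \<in> space (gauss d)" for x using F(2)[OF that] that by (simp add: S)
    show "norm (S i x) \<le> norm (2 * f x)" if "x \<in> space (gauss d)" for i x
      using F(3)[OF that, of i] that by (simp add: S norm_mult)
  qed measurable
qed

section \<open>The rotated product\<close>

text \<open>The convex function \<open>t powr r\<close> lies above its tangent at 1. Applied to a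
  function divided by its mean and integrated, this is Jensen's inequality for powers.\<close>

lemma Bernoulli_powr:
  fixes t r :: real
  assumes "0 \<le> t" "1 \<le> r"
  shows "1 + r * (t - 1) \<le> t powr r"
proof (cases "t = 0")
  case False
  then have "r * (t - 1) \<le> t powr r - 1 powr r"
    by (intro convex_on_imp_above_tangent[OF powr_convex])
       (use assms in \<open>auto intro!: derivative_eq_intros simp: interior_open\<close>)
  then show ?thesis by simp
qed (use assms in simp)

text \<open>Measurability is the only assumption on \<open>h\<close>, so that the bounds for
  \<open>rotprod\<close> can be proved before anything is known about the integrability of its
  sections.\<close>

lemma (in prob_space) norm_integral_powr_le:
  fixes h :: "'a \<Rightarrow> complex"
  assumes [measurable]: "h \<in> borel_measurable M" and r: "1 \<le> r"
  shows "ennreal (norm (\<integral>x. h x \<partial>M) powr r) \<le> (\<integral>\<^sup>+x. ennreal (norm (h x) powr r) \<partial>M)"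
proof (cases "integrable M h \<and> (\<integral>\<^sup>+x. ennreal (norm (h x) powr r) \<partial>M) < \<infinity>")
  case True
  then have h: "integrable M h" and hr: "integrable M (\<lambda>x. norm (h x) powr r)"
    by (auto intro!: integrableI_nonneg)
  define m where "m = (\<integral>x. norm (h x) \<partial>M)"
  have le: "norm (\<integral>x. h x \<partial>M) \<le> m" unfolding m_def by (rule integral_norm_bound)
  have "m powr r \<le> (\<integral>x. norm (h x) powr r \<partial>M)"
  proof (cases "m = 0")
    case False
    then have m: "m > 0" unfolding m_def by (simp add: less_le)
    have int: "integrable M (\<lambda>x. 1 + r * (norm (h x) / m - 1))"
      using h by simp
    have "1 = (\<integral>x. 1 + r * (norm (h x) / m - 1) \<partial>M)"
      using h m by (simp add: m_def[symmetric] prob_space)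
    also have "\<dots> \<le> (\<integral>x. norm (h x) powr r / m powr r \<partial>M)"
    proof (rule integral_mono[OF int])
      show "integrable M (\<lambda>x. norm (h x) powr r / m powr r)" using hr by simp
      show "1 + r * (norm (h x) / m - 1) \<le> norm (h x) powr r / m powr r" for x
        using Bernoulli_powr[of "norm (h x) / m" r] r m by (simp add: powr_divide)
    qed
    finally show ?thesis using m by (simp add: field_simps)
  qed simp
  with le r have "norm (\<integral>x. h x \<partial>M) powr r \<le> (\<integral>x. norm (h x) powr r \<partial>M)"
    by (meson norm_ge_zero order_trans powr_mono2 zero_le_one)
  then show ?thesis using hr by (simp add: nn_integral_eq_integral)
next
  \<comment> \<open>Either the Bochner integral takes its default value 0, or the right-hand side is
    infinite.\<close>
  case False
  then consider "\<not> integrable M h" | "(\<integral>\<^sup>+x. ennreal (norm (h x) powr r) \<partial>M) = \<infinity>"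
    by (auto simp: not_less top_unique)
  then show ?thesis by cases (simp_all add: not_integrable_integral_eq)
qed

section \<open>Pairs of independent Gaussian vectors\<close>

lemma AE_gauss_fst: "AE x in gauss d. P x \<Longrightarrow> AE z in gauss d \<Otimes>\<^sub>M gauss d. P (fst z)"
  by (intro AE_distrD[OF measurable_fst]) (simp only: gauss.distr_pair_fst)

lemma AE_gauss_snd:
  assumes "AE x in gauss d. P x"
  shows "AE z in gauss d \<Otimes>\<^sub>M gauss d. P (snd z)"
proof -
  have "AE z in distr (gauss d \<Otimes>\<^sub>M gauss d) (gauss d \<Otimes>\<^sub>M gauss d) (\<lambda>(x, y). (y, x)). P (fst z)"
    using AE_gauss_fst[OF assms] by (simp only: gauss2.distr_pair_swap[symmetric])
  from AE_distrD[OF measurable_pair_swap' this] show ?thesis by (simp add: split_def)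
qed

lemma integrable_gauss_tensor:
  fixes f g :: "(nat \<Rightarrow> real) \<Rightarrow> complex"
  assumes f: "integrable (gauss d) f" and g: "integrable (gauss d) g"
  shows "integrable (gauss d \<Otimes>\<^sub>M gauss d) (\<lambda>z. f (fst z) * g (snd z))"
  using f g by (intro gauss2.Fubini_integrable) (auto simp: norm_mult)

lemma nn_integral_gauss_tensor:
  fixes f g :: "(nat \<Rightarrow> real) \<Rightarrow> ennreal"
  assumes [measurable]: "f \<in> borel_measurable (gauss d)" "g \<in> borel_measurable (gauss d)"
  shows "(\<integral>\<^sup>+z. f (fst z) * g (snd z) \<partial>(gauss d \<Otimes>\<^sub>M gauss d)) = (\<integral>\<^sup>+x. f x \<partial>gauss d) * (\<integral>\<^sup>+x. g x \<partial>gauss d)"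
  by (subst gauss.nn_integral_fst[symmetric]) (simp_all add: nn_integral_cmult nn_integral_multc)

lemma sqint_gauss_tensor:
  assumes f: "sqint (gauss d) f" and g: "sqint (gauss d) g"
  shows "sqint (gauss d \<Otimes>\<^sub>M gauss d) (\<lambda>z. f (fst z) * g (snd z))"
proof -
  note [measurable] = sqint_measurable[OF f] sqint_measurable[OF g]
  have "integrable (gauss d) (\<lambda>x. complex_of_real ((norm (f x))\<^sup>2))" "integrable (gauss d) (\<lambda>x. complex_of_real ((norm (g x))\<^sup>2))"
    using f g by (simp_all only: integrable_of_real sqint_integrable)
  from integrable_norm[OF integrable_gauss_tensor[OF this]]
  show ?thesis by (simp add: sqint_def norm_mult power_mult_distrib norm_power)
qed

text \<open>With \<open>g\<close> constantly 1 this is Mehler's formula for the Ornstein-Uhlenbeck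
  semigroup. For integrable \<open>f\<close> and \<open>g\<close> the section is integrable for
  almost every \<open>x\<close>; at the other points the value is the default 0.\<close>

definition rotprod :: "nat \<Rightarrow> real \<Rightarrow> real \<Rightarrow> ((nat \<Rightarrow> real) \<Rightarrow> complex) \<Rightarrow> ((nat \<Rightarrow> real) \<Rightarrow> complex) \<Rightarrow> (nat \<Rightarrow> real) \<Rightarrow> complex" where
  "rotprod d a b f g x = (\<integral>y. f (lc d a b x y) * g (lc d b (-a) x y) \<partial>gauss d)"

lemma rotprod_measurable [measurable]:
  assumes [measurable]: "f \<in> borel_measurable (gauss d)" "g \<in> borel_measurable (gauss d)"
  shows "rotprod d a b f g \<in> borel_measurable (gauss d)"
  unfolding rotprod_def
  by (rule gauss.borel_measurable_lebesgue_integral) (simp add: split_def)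

context rotation
begin

lemma integrable_rot_tensor:
  assumes "integrable (gauss d) f" "integrable (gauss d) g"
  shows "integrable (gauss d \<Otimes>\<^sub>M gauss d) (\<lambda>z. f (lc d a b (fst z) (snd z)) * g (lc d b (-a) (fst z) (snd z)) :: complex)"
  using integrable_rot[OF integrable_gauss_tensor[OF assms]] by (simp add: rot_def)

lemma AE_integrable_rotprod:
  assumes "integrable (gauss d) f" "integrable (gauss d) g"
  shows "AE x in gauss d. integrable (gauss d) (\<lambda>y. f (lc d a b x y) * g (lc d b (-a) x y) :: complex)"
  using gauss2.AE_integrable_fst'[OF integrable_rot_tensor[OF assms]] by simp

text \<open>The integral splits at those \<open>x\<close> for which both sections are integrable,
  that is almost everywhere by Fubini.\<close>

lemma rotprod_diff_left:
  assumes "integrable (gauss d) f" "integrable (gauss d) f'" "integrable (gauss d) g"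
  shows "AE x in gauss d. rotprod d a b (\<lambda>x. f x - f' x) g x = rotprod d a b f g x - rotprod d a b f' g x"
  using AE_integrable_rotprod[OF assms(1,3)] AE_integrable_rotprod[OF assms(2,3)]
  by eventually_elim (simp add: rotprod_def left_diff_distrib)

lemma rotprod_diff_right:
  assumes "integrable (gauss d) f" "integrable (gauss d) g" "integrable (gauss d) g'"
  shows "AE x in gauss d. rotprod d a b f (\<lambda>x. g x - g' x) x = rotprod d a b f g x - rotprod d a b f g' x"
  using AE_integrable_rotprod[OF assms(1,2)] AE_integrable_rotprod[OF assms(1,3)]
  by eventually_elim (simp add: rotprod_def right_diff_distrib)

text \<open>Being stated for nonnegative integrals of \<open>r\<close>-th powers, one estimate
  serves the L^1 continuity, the L^2 contraction and the bound for every finite exponent.\<close>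

lemma nn_integral_rotprod_powr:
  assumes [measurable]: "f \<in> borel_measurable (gauss d)" "g \<in> borel_measurable (gauss d)" and r: "1 \<le> r"
  shows "(\<integral>\<^sup>+x. ennreal (norm (rotprod d a b f g x) powr r) \<partial>gauss d)
    \<le> (\<integral>\<^sup>+x. ennreal (norm (f x) powr r) \<partial>gauss d) * (\<integral>\<^sup>+x. ennreal (norm (g x) powr r) \<partial>gauss d)"
proof -
  define H where "H z = ennreal (norm (f (fst z)) powr r) * ennreal (norm (g (snd z)) powr r)" for z
  have [measurable]: "H \<in> borel_measurable (gauss d \<Otimes>\<^sub>M gauss d)" unfolding H_def by measurable
  have "(\<integral>\<^sup>+x. ennreal (norm (rotprod d a b f g x) powr r) \<partial>gauss d)
      \<le> (\<integral>\<^sup>+x. \<integral>\<^sup>+y. ennreal (norm (f (lc d a b x y) * g (lc d b (-a) x y)) powr r) \<partial>gauss d \<partial>gauss d)"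
    unfolding rotprod_def
  proof (intro nn_integral_mono gauss.norm_integral_powr_le r)
    fix x assume [measurable]: "x \<in> space (gauss d)"
    show "(\<lambda>y. f (lc d a b x y) * g (lc d b (-a) x y)) \<in> borel_measurable (gauss d)" by measurable
  qed
  also have "\<dots> = (\<integral>\<^sup>+x. \<integral>\<^sup>+y. H (rot d a b (x, y)) \<partial>gauss d \<partial>gauss d)"
    by (simp add: H_def rot_def norm_mult powr_mult ennreal_mult)
  also have "\<dots> = (\<integral>\<^sup>+z. H z \<partial>(gauss d \<Otimes>\<^sub>M gauss d))"
    by (subst gauss.nn_integral_fst) (simp_all add: nn_integral_rot)
  also have "\<dots> = (\<integral>\<^sup>+x. ennreal (norm (f x) powr r) \<partial>gauss d) * (\<integral>\<^sup>+x. ennreal (norm (g x) powr r) \<partial>gauss d)"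
    unfolding H_def by (rule nn_integral_gauss_tensor) measurable
  finally show ?thesis .
qed

lemma sqint_rotprod:
  assumes f: "sqint (gauss d) f" and g: "sqint (gauss d) g"
  shows "sqint (gauss d) (rotprod d a b f g)"
    and sqn_rotprod: "sqn (gauss d) (rotprod d a b f g) \<le> sqn (gauss d) f * sqn (gauss d) g"
proof -
  note [measurable] = sqint_measurable[OF f] sqint_measurable[OF g]
  have nn: "(\<integral>\<^sup>+x. ennreal (norm (h x) powr 2) \<partial>gauss d) = ennreal (sqn (gauss d) h)" if "sqint (gauss d) h" for h
    using that by (simp add: sqn_def sqint_def nn_integral_eq_integral)
  have le: "(\<integral>\<^sup>+x. ennreal (norm (rotprod d a b f g x) powr 2) \<partial>gauss d) \<le> ennreal (sqn (gauss d) f * sqn (gauss d) g)"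
    using nn_integral_rotprod_powr[of f d g 2] unfolding nn[OF f] nn[OF g]
    by (simp add: ennreal_mult sqn_nonneg)
  then show *: "sqint (gauss d) (rotprod d a b f g)"
    by (auto simp: sqint_def integrable_iff_bounded intro: le_less_trans)
  show "sqn (gauss d) (rotprod d a b f g) \<le> sqn (gauss d) f * sqn (gauss d) g"
    using le unfolding nn[OF *] by (simp add: sqn_nonneg)
qed

lemma sqint_rot_pair:
  assumes h: "sqint (gauss d) h"
  shows "sqint (gauss d \<Otimes>\<^sub>M gauss d) (\<lambda>z. h (lc d a b (fst z) (snd z)))"
proof -
  note [measurable] = sqint_measurable[OF h]
  have "sqint (gauss d \<Otimes>\<^sub>M gauss d) (\<lambda>z. h (fst z))"
    using sqint_gauss_tensor[OF h sqint_const[of "gauss d" 1]] by (simp add: gauss.finite_measure_axioms)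
  then have "integrable (gauss d \<Otimes>\<^sub>M gauss d) (\<lambda>z. complex_of_real ((norm (h (fst z)))\<^sup>2))"
    by (simp only: integrable_of_real sqint_integrable)
  from integrable_norm[OF integrable_rot[OF this]]
  show ?thesis by (simp add: sqint_def rot_def norm_power)
qed

text \<open>Changing variables by the involution \<^const>\<open>rot\<close> moves the rotation from \<open>f\<close> and \<open>g\<close> to the test function \<open>h\<close>.\<close>

lemma L2_inner_rotprod:
  assumes f: "sqint (gauss d) f" and g: "sqint (gauss d) g" and h: "sqint (gauss d) h"
  shows "L2_inner (gauss d) (rotprod d a b f g) h
    = L2_inner (gauss d \<Otimes>\<^sub>M gauss d) (\<lambda>z. f (fst z) * g (snd z)) (\<lambda>z. h (lc d a b (fst z) (snd z)))"
proof -
  note [measurable] = sqint_measurable[OF f] sqint_measurable[OF g] sqint_measurable[OF h]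
  let ?M = "gauss d \<Otimes>\<^sub>M gauss d"
  define K where "K z = (f (fst z) * g (snd z)) * cnj (h (lc d a b (fst z) (snd z)))" for z
  have K: "integrable ?M K"
    unfolding K_def by (intro integrable_inner sqint_gauss_tensor sqint_rot_pair f g h)
  have eq: "K (rot d a b z) = (f (lc d a b (fst z) (snd z)) * g (lc d b (-a) (fst z) (snd z))) * cnj (h (fst z))"
    if "z \<in> space ?M" for z
    using that lc_inverse[OF ab1, of "fst z" d "snd z"] by (auto simp: K_def rot_def space_pair_measure)
  have int: "integrable ?M (\<lambda>z. (f (lc d a b (fst z) (snd z)) * g (lc d b (-a) (fst z) (snd z))) * cnj (h (fst z)))"
    by (rule Bochner_Integration.integrable_cong[THEN iffD1, OF refl _ integrable_rot[OF K]]) (simp add: eq)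
  have "L2_inner (gauss d) (rotprod d a b f g) h
     = (\<integral>x. \<integral>y. (f (lc d a b x y) * g (lc d b (-a) x y)) * cnj (h x) \<partial>gauss d \<partial>gauss d)"
    by (simp add: L2_inner_def rotprod_def)
  also have "\<dots> = (\<integral>z. (f (lc d a b (fst z) (snd z)) * g (lc d b (-a) (fst z) (snd z))) * cnj (h (fst z)) \<partial>?M)"
    using gauss2.integral_fst'[OF int] by simp
  also have "\<dots> = (\<integral>z. K (rot d a b z) \<partial>?M)"
    by (rule Bochner_Integration.integral_cong) (simp_all add: eq)
  also have "\<dots> = (\<integral>z. K z \<partial>?M)"
    by (rule integral_rot) (use K in auto)
  finally show ?thesis by (simp add: K_def L2_inner_def)
qed

end

section \<open>The rotated product of polynomials\<close>

text \<open>The strict bound makes \<open>n = 0\<close> the zero space, so that chaos of order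
  \<open>n\<close> is the orthogonal complement of \<open>plow d n\<close> in
  \<open>polys d n\<close> uniformly in \<open>n\<close>, with no separate case for
  constants.\<close>

definition plow :: "nat \<Rightarrow> nat \<Rightarrow> ((nat \<Rightarrow> real) \<Rightarrow> complex) set" where
  "plow d n = cspan (xmon ` {l. set l \<subseteq> {..<d} \<and> length l < n})"

lemma plow_0: "plow d 0 = {\<lambda>x. 0}"
proof -
  have "f = (\<lambda>x. 0)" if "f \<in> cspan {}" for f :: "'a \<Rightarrow> complex"
    using that by (induction rule: cspan.induct) auto
  then show ?thesis by (auto simp: plow_def cspan.zero)
qed

lemma plow_Suc: "plow d (Suc n) = polys d n"
  by (simp add: plow_def polys_eq_cspan xmons_def less_Suc_eq_le)

lemma plow_mono: "m \<le> n \<Longrightarrow> plow d m \<subseteq> plow d n"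
  unfolding plow_def by (intro cspan_mono) auto

lemma plow_polys: "f \<in> plow d n \<Longrightarrow> f \<in> polys d n"
  using plow_mono[of n "Suc n" d] by (auto simp: plow_Suc)

lemma polys_plow: "m < n \<Longrightarrow> f \<in> polys d m \<Longrightarrow> f \<in> plow d n"
  using plow_mono[of "Suc m" n d] by (auto simp: plow_Suc)

lemma plow_diff: "f \<in> plow d n \<Longrightarrow> g \<in> plow d n \<Longrightarrow> (\<lambda>x. f x - g x) \<in> plow d n"
  unfolding plow_def by (rule cspan_diff)

lemma plow_sqint: "f \<in> plow d n \<Longrightarrow> sqint (gauss d) f"
  by (rule polys_sqint[OF plow_polys])

lemma xmon_in_plow: "set l \<subseteq> {..<d} \<Longrightarrow> length l < n \<Longrightarrow> xmon l \<in> plow d n"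
  unfolding plow_def by (rule cspan_base) auto

section \<open>Polynomials in a pair of vectors\<close>

definition bimon :: "nat list \<Rightarrow> nat list \<Rightarrow> (nat \<Rightarrow> real) \<times> (nat \<Rightarrow> real) \<Rightarrow> complex" where
  "bimon l m z = xmon l (fst z) * xmon m (snd z)"

definition bspan :: "nat \<Rightarrow> nat \<Rightarrow> ((nat \<Rightarrow> real) \<times> (nat \<Rightarrow> real) \<Rightarrow> complex) set" where
  "bspan d n = cspan {bimon l m | l m. set l \<subseteq> {..<d} \<and> set m \<subseteq> {..<d} \<and> length l + length m \<le> n}"

text \<open>The degree in the first variable alone is bounded here, strictly: integrating over the second variable
  leaves a polynomial of degree less than \<open>n\<close>, so equality modulo \<open>lspan d n\<close> keeps just the leading part.\<close>

definition lspan :: "nat \<Rightarrow> nat \<Rightarrow> ((nat \<Rightarrow> real) \<times> (nat \<Rightarrow> real) \<Rightarrow> complex) set" where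
  "lspan d n = cspan {bimon l m | l m. set l \<subseteq> {..<d} \<and> set m \<subseteq> {..<d} \<and> length l < n}"

lemma bimon_mult: "bimon l m z * bimon l' m' z = bimon (l @ l') (m @ m') z"
  by (simp add: bimon_def xmon_append)

lemma bimon_in_bspan: "set l \<subseteq> {..<d} \<Longrightarrow> set m \<subseteq> {..<d} \<Longrightarrow> length l + length m \<le> n \<Longrightarrow> bimon l m \<in> bspan d n"
  unfolding bspan_def by (rule cspan_base) auto

lemma bspan_mult:
  assumes "F \<in> bspan d i" "G \<in> bspan d j"
  shows "(\<lambda>z. F z * G z) \<in> bspan d (i + j)"
  using assms unfolding bspan_def
proof (rule cspan_mult)
  fix b c
  assume "b \<in> {bimon l m | l m. set l \<subseteq> {..<d} \<and> set m \<subseteq> {..<d} \<and> length l + length m \<le> i}"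
    and "c \<in> {bimon l m | l m. set l \<subseteq> {..<d} \<and> set m \<subseteq> {..<d} \<and> length l + length m \<le> j}"
  then obtain l m l' m' where "b = bimon l m" "c = bimon l' m'" "set (l @ l') \<subseteq> {..<d}" "set (m @ m') \<subseteq> {..<d}"
    "length (l @ l') + length (m @ m') \<le> i + j" by auto
  then show "(\<lambda>x. b x * c x) \<in> cspan {bimon l m | l m. set l \<subseteq> {..<d} \<and> set m \<subseteq> {..<d} \<and> length l + length m \<le> i + j}"
    unfolding bimon_mult[abs_def] using bimon_in_bspan[of "l @ l'" d "m @ m'" "i + j"]
    by (simp add: bspan_def bimon_mult)
qed

text \<open>Degrees in the first variable add, and total degree at most \<open>j\<close> bounds the
  degree in the first variable; strictness in one factor makes the sum strict.\<close>

lemma lspan_mult: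
  assumes "F \<in> lspan d i" "G \<in> bspan d j"
  shows "(\<lambda>z. F z * G z) \<in> lspan d (i + j)"
  using assms unfolding bspan_def lspan_def
proof (rule cspan_mult)
  fix b c
  assume "b \<in> {bimon l m | l m. set l \<subseteq> {..<d} \<and> set m \<subseteq> {..<d} \<and> length l < i}"
    and "c \<in> {bimon l m | l m. set l \<subseteq> {..<d} \<and> set m \<subseteq> {..<d} \<and> length l + length m \<le> j}"
  then obtain l m l' m' where *: "b = bimon l m" "c = bimon l' m'" "set (l @ l') \<subseteq> {..<d}" "set (m @ m') \<subseteq> {..<d}"
    "length (l @ l') < i + j" by auto
  then have "bimon (l @ l') (m @ m') \<in> cspan {bimon l m | l m. set l \<subseteq> {..<d} \<and> set m \<subseteq> {..<d} \<and> length l < i + j}"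
    by (intro cspan_base) blast
  with * show "(\<lambda>x. b x * c x) \<in> cspan {bimon l m | l m. set l \<subseteq> {..<d} \<and> set m \<subseteq> {..<d} \<and> length l < i + j}"
    by (simp add: bimon_mult)
qed

lemma bspan_mono: "m \<le> n \<Longrightarrow> bspan d m \<subseteq> bspan d n"
  unfolding bspan_def by (intro cspan_mono) force

lemma bspan_lspan: "m < n \<Longrightarrow> bspan d m \<subseteq> lspan d n"
  unfolding bspan_def lspan_def by (intro cspan_mono) force

lemma coord_in_bspan:
  assumes "i < d"
  shows "(\<lambda>z. complex_of_real (fst z i)) \<in> bspan d 1" "(\<lambda>z. complex_of_real (snd z i)) \<in> bspan d 1"
    "(\<lambda>z. complex_of_real (snd z i)) \<in> lspan d 1"
proof -
  have "bimon [i] [] = (\<lambda>z. complex_of_real (fst z i))" "bimon [] [i] = (\<lambda>z. complex_of_real (snd z i))"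
    by (simp_all add: bimon_def fun_eq_iff)
  moreover have "bimon [] [i] \<in> lspan d 1"
    unfolding lspan_def using assms by (intro cspan_base) force
  ultimately show "(\<lambda>z. complex_of_real (fst z i)) \<in> bspan d 1" "(\<lambda>z. complex_of_real (snd z i)) \<in> bspan d 1"
    "(\<lambda>z. complex_of_real (snd z i)) \<in> lspan d 1"
    using bimon_in_bspan[of "[i]" d "[]" 1] bimon_in_bspan[of "[]" d "[i]" 1] assms by simp_all
qed

lemma lc_apply: "i < d \<Longrightarrow> lc d a b x y i = a * x i + b * y i"
  by (simp add: lincomb_def)

text \<open>Each factor becomes \<open>a s_i + b t_i\<close>. Choosing the second summand in any
  factor lowers the degree in the first vector, so modulo \<open>lspan\<close> only the product of
  the terms \<open>a s_i\<close> survives.\<close>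

lemma xmon_lc:
  assumes "set l \<subseteq> {..<d}"
  shows "(\<lambda>z. xmon l (lc d a b (fst z) (snd z))) \<in> bspan d (length l)"
    and "(\<lambda>z. xmon l (lc d a b (fst z) (snd z)) - complex_of_real a ^ length l * xmon l (fst z)) \<in> lspan d (length l)"
  using assms
proof (induction l)
  case Nil
  {
    case 1
    show ?case using bimon_in_bspan[of "[]" d "[]" 0] by (simp add: bimon_def[abs_def])
  next
    case 2
    show ?case by (simp add: lspan_def cspan.zero)
  }
next
  case (Cons i l)
  let ?M = "\<lambda>z. xmon l (lc d a b (fst z) (snd z))"
  let ?D = "\<lambda>z. ?M z - complex_of_real a ^ length l * xmon l (fst z)"
  {
    case 1
    then have i: "i < d" and M: "?M \<in> bspan d (length l)" using Cons.IH by auto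
    have "(\<lambda>z. complex_of_real a * complex_of_real (fst z i) + complex_of_real b * complex_of_real (snd z i)) \<in> bspan d 1"
      unfolding bspan_def by (intro cspan_add cspan_cmult; fold bspan_def; intro coord_in_bspan i)
    from bspan_mult[OF this M] show ?case using i by (simp add: lc_apply)
  next
    case 2
    then have i: "i < d" and M: "?M \<in> bspan d (length l)" and D: "?D \<in> lspan d (length l)" using Cons.IH by auto
    have "(\<lambda>z. complex_of_real (snd z i) * ?M z) \<in> lspan d (1 + length l)"
      by (rule lspan_mult[OF coord_in_bspan(3)[OF i] M])
    moreover have "(\<lambda>z. ?D z * complex_of_real (fst z i)) \<in> lspan d (length l + 1)"
      by (rule lspan_mult[OF D coord_in_bspan(1)[OF i]])
    ultimately have "(\<lambda>z. complex_of_real a * (?D z * complex_of_real (fst z i)) + complex_of_real b * (complex_of_real (snd z i) * ?M z))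
        \<in> lspan d (Suc (length l))"
      unfolding lspan_def by (intro cspan_add cspan_cmult) simp_all
    \<comment> \<open>With \<open>n = length l\<close>: \<open>(a s_i + b t_i) M - a^(n+1) s_i xmon
      l s = a (D s_i) + b (t_i M)\<close>, where the first summand is handled by induction and the
      second by the missing factor in \<open>s\<close>.\<close>
    moreover have "complex_of_real a * (?D z * complex_of_real (fst z i)) + complex_of_real b * (complex_of_real (snd z i) * ?M z)
      = xmon (i # l) (lc d a b (fst z) (snd z)) - complex_of_real a ^ length (i # l) * xmon (i # l) (fst z)" for z
      using i by (simp add: lc_apply algebra_simps)
    ultimately show ?case by simp
  }
qed

lemma polys_fst_bspan: "f \<in> polys d n \<Longrightarrow> (\<lambda>z. f (fst z)) \<in> bspan d n"
  unfolding polys_eq_cspan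
proof (induction rule: cspan.induct)
  case (step b f c)
  then obtain l where "b = xmon l" "set l \<subseteq> {..<d}" "length l \<le> n" by (auto simp: xmons_def)
  then have "(\<lambda>z. b (fst z)) \<in> bspan d n"
    using bimon_in_bspan[of l d "[]" n] by (simp add: bimon_def[abs_def])
  then show ?case using step.IH unfolding bspan_def by (intro cspan_add cspan_cmult)
qed (simp add: bspan_def cspan.zero)

lemma polys_lc:
  assumes "f \<in> polys d n"
  shows "(\<lambda>z. f (lc d a b (fst z) (snd z))) \<in> bspan d n"
    and "(\<lambda>z. f (lc d a b (fst z) (snd z)) - complex_of_real a ^ n * f (fst z)) \<in> lspan d n"
  using assms unfolding polys_eq_cspan
proof (induction rule: cspan.induct)
  case zero
  {
    case 1
    show ?case by (simp add: bspan_def cspan.zero)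
  next
    case 2
    show ?case by (simp add: lspan_def cspan.zero)
  }
next
  case (step h f c)
  then obtain l where l: "h = xmon l" "set l \<subseteq> {..<d}" "length l \<le> n" by (auto simp: xmons_def)
  {
    case 1
    have "(\<lambda>z. h (lc d a b (fst z) (snd z))) \<in> bspan d n"
      using xmon_lc(1)[OF l(2)] bspan_mono[OF l(3)] l(1) by auto
    then show ?case using step.IH(1) unfolding bspan_def by (intro cspan_add cspan_cmult)
  next
    case 2
    have "(\<lambda>z. h (lc d a b (fst z) (snd z)) - complex_of_real a ^ n * h (fst z)) \<in> lspan d n"
    proof (cases "length l = n")
      case True
      then show ?thesis using xmon_lc(2)[OF l(2)] l(1) by auto
    next
      \<comment> \<open>A monomial of lower degree gets the factor \<open>a ^ n\<close> instead of
        \<open>a ^ length l\<close>. This does no harm: both terms have total degree below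
        \<open>n\<close> and hence lie in \<open>lspan d n\<close> separately.\<close>
      case False
      have "h \<in> polys d (length l)" using l by (auto intro: xmon_in_polys)
      then have "(\<lambda>z. h (lc d a b (fst z) (snd z)) - complex_of_real a ^ n * h (fst z)) \<in> bspan d (length l)"
        using xmon_lc(1)[OF l(2), of a b] polys_fst_bspan[of h d "length l"] l(1)
        unfolding bspan_def by (intro cspan_diff cspan_cmult) auto
      then show ?thesis using bspan_lspan[of "length l" n d] l(3) False by auto
    qed
    then have "(\<lambda>z. c * (h (lc d a b (fst z) (snd z)) - complex_of_real a ^ n * h (fst z))
        + (f (lc d a b (fst z) (snd z)) - complex_of_real a ^ n * f (fst z))) \<in> lspan d n"
      using step.IH(2) unfolding lspan_def by (intro cspan_add cspan_cmult)
    then show ?case by (simp add: algebra_simps)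
  }
qed

lemma integrable_polys: "p \<in> polys d n \<Longrightarrow> integrable (gauss d) p"
  by (intro sqint_imp_integrable polys_sqint gauss.finite_measure_axioms)

lemma bspan_section:
  assumes "K \<in> bspan d n"
  shows "integrable (gauss d) (\<lambda>y. K (x, y))" "(\<lambda>x. \<integral>y. K (x, y) \<partial>gauss d) \<in> polys d n"
proof -
  have int: "(\<lambda>y. K (x, y)) \<in> polys d n" if "K \<in> bspan d n" for x K
    using that unfolding bspan_def
  proof (induction rule: cspan.induct)
    case zero
    show ?case by (rule polys_zero)
  next
    case (step k K c)
    then obtain l m where "k = bimon l m" "set m \<subseteq> {..<d}" "length m \<le> n" by auto
    then have "(\<lambda>y. k (x, y)) \<in> polys d n"
      using polys_cmult[OF xmon_in_polys[of m d n], of "xmon l x"] by (simp add: bimon_def)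
    then show ?case using step.IH by (intro polys_add polys_cmult)
  qed
  show "integrable (gauss d) (\<lambda>y. K (x, y))"
    using int[OF assms] by (rule integrable_polys)
  show "(\<lambda>x. \<integral>y. K (x, y) \<partial>gauss d) \<in> polys d n"
    using assms unfolding bspan_def
  proof (induction rule: cspan.induct)
    case zero
    show ?case by (simp add: polys_zero)
  next
    case (step k K c)
    then obtain l m where k: "k = bimon l m" "set l \<subseteq> {..<d}" "length l \<le> n" "set m \<subseteq> {..<d}" "length l + length m \<le> n"
      by auto
    have ki: "integrable (gauss d) (\<lambda>y. k (x, y))" for x
      by (rule integrable_polys[OF int]) (use k in \<open>auto intro: bimon_in_bspan\<close>)
    have Ki: "integrable (gauss d) (\<lambda>y. K (x, y))" for x
      by (rule integrable_polys[OF int]) (use step in \<open>simp add: bspan_def\<close>)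
    have "(\<lambda>x. (\<integral>y. xmon m y \<partial>gauss d) * xmon l x) \<in> polys d n"
      using k by (intro polys_cmult xmon_in_polys)
    then have "(\<lambda>x. \<integral>y. k (x, y) \<partial>gauss d) \<in> polys d n"
      by (simp add: k(1) bimon_def mult.commute)
    then have "(\<lambda>x. c * (\<integral>y. k (x, y) \<partial>gauss d) + (\<integral>y. K (x, y) \<partial>gauss d)) \<in> polys d n"
      using step.IH by (intro polys_add polys_cmult)
    then show ?case using ki Ki by simp
  qed
qed

lemma lspan_section:
  assumes "K \<in> lspan d n"
  shows "(\<lambda>x. \<integral>y. K (x, y) \<partial>gauss d) \<in> plow d n \<and> (\<forall>x. integrable (gauss d) (\<lambda>y. K (x, y)))"
  using assms unfolding lspan_def
proof (induction rule: cspan.induct)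
  case zero
  show ?case by (simp add: plow_def cspan.zero)
next
  case (step k K c)
  then obtain l m where k: "k = bimon l m" "set l \<subseteq> {..<d}" "length l < n" "set m \<subseteq> {..<d}" by auto
  have ki: "integrable (gauss d) (\<lambda>y. k (x, y))" for x
    using integrable_polys[OF xmon_in_polys[OF k(4) order_refl]] by (simp add: k(1) bimon_def)
  have "(\<lambda>x. (\<integral>y. xmon m y \<partial>gauss d) * xmon l x) \<in> plow d n"
    using xmon_in_plow[OF k(2,3)] unfolding plow_def by (rule cspan_cmult)
  then have "(\<lambda>x. \<integral>y. k (x, y) \<partial>gauss d) \<in> plow d n"
    by (simp add: k(1) bimon_def mult.commute)
  then have "(\<lambda>x. c * (\<integral>y. k (x, y) \<partial>gauss d) + (\<integral>y. K (x, y) \<partial>gauss d)) \<in> plow d n"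
    using step.IH unfolding plow_def by (intro cspan_add cspan_cmult) auto
  then show ?case using ki step.IH by simp
qed

text \<open>Sections of polynomials are integrable at every \<open>x\<close>, so these statements
  hold pointwise and not merely almost everywhere. The leading factor of
  \<open>g (b x - a y)\<close> in \<open>x\<close> is \<open>b ^ j\<close>.\<close>

lemma rotprod_polys:
  assumes f: "f \<in> polys d i" and g: "g \<in> polys d j"
  shows "rotprod d a b f g \<in> polys d (i + j)"
    and "(\<lambda>x. rotprod d a b f g x - complex_of_real (a ^ i * b ^ j) * (f x * g x)) \<in> plow d (i + j)"
    and "integrable (gauss d) (\<lambda>y. f (lc d a b x y) * g (lc d b (-a) x y))"
proof -
  let ?F = "\<lambda>z. f (lc d a b (fst z) (snd z))" and ?G = "\<lambda>z. g (lc d b (-a) (fst z) (snd z))"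
  let ?A = "complex_of_real a ^ i" and ?B = "complex_of_real b ^ j"
  note F = polys_lc[OF f, of a b] and G = polys_lc[OF g, of b "-a"]
  note FG = bspan_section[OF bspan_mult[OF F(1) G(1)]]
  show "rotprod d a b f g \<in> polys d (i + j)"
    using FG(2) by (simp add: rotprod_def[abs_def])
  show int: "integrable (gauss d) (\<lambda>y. f (lc d a b x y) * g (lc d b (-a) x y))" for x
    using FG(1)[of x] by simp
  have Gf: "(\<lambda>z. ?G z - ?B * g (fst z)) \<in> lspan d j" and Ff: "(\<lambda>z. ?F z - ?A * f (fst z)) \<in> lspan d i"
    using F(2) G(2) by auto
  \<comment> \<open>Splitting of \<open>F G - A B f g\<close>, where each summand contains one
    difference of lower degree in the first variable.\<close>
  have "(\<lambda>z. (?F z - ?A * f (fst z)) * ?G z + ?A * ((?G z - ?B * g (fst z)) * f (fst z))) \<in> lspan d (i + j)"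
    using lspan_mult[OF Ff G(1)] lspan_mult[OF Gf polys_fst_bspan[OF f]]
    unfolding lspan_def by (intro cspan_add cspan_cmult) (simp_all add: add.commute)
  moreover have "(?F z - ?A * f (fst z)) * ?G z + ?A * ((?G z - ?B * g (fst z)) * f (fst z)) = ?F z * ?G z - ?A * ?B * (f (fst z) * g (fst z))" for z
    by (simp add: algebra_simps)
  ultimately have "(\<lambda>z. ?F z * ?G z - ?A * ?B * (f (fst z) * g (fst z))) \<in> lspan d (i + j)" by simp
  from lspan_section[OF this] int
  show "(\<lambda>x. rotprod d a b f g x - complex_of_real (a ^ i * b ^ j) * (f x * g x)) \<in> plow d (i + j)"
    by (simp add: rotprod_def gauss.prob_space)
qed

lemma rotprod_polys_sum_left:
  assumes "\<And>i. i \<in> I \<Longrightarrow> f i \<in> polys d n" "g \<in> polys d m"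
  shows "rotprod d a b (\<lambda>x. \<Sum>i\<in>I. f i x) g x = (\<Sum>i\<in>I. rotprod d a b (f i) g x)"
  unfolding rotprod_def sum_distrib_right
  by (rule Bochner_Integration.integral_sum) (rule rotprod_polys(3)[OF assms])

lemma rotprod_polys_sum_right:
  assumes "\<And>i. i \<in> I \<Longrightarrow> g i \<in> polys d n" "f \<in> polys d m"
  shows "rotprod d a b f (\<lambda>x. \<Sum>i\<in>I. g i x) x = (\<Sum>i\<in>I. rotprod d a b f (g i) x)"
  unfolding rotprod_def sum_distrib_left
  by (rule Bochner_Integration.integral_sum) (rule rotprod_polys(3)[OF assms(2,1)])

lemma L2_inner_tensor_bimon:
  assumes f: "sqint (gauss d) f" and g: "sqint (gauss d) g" and l: "set l \<subseteq> {..<d}" "set m \<subseteq> {..<d}"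
  shows "L2_inner (gauss d \<Otimes>\<^sub>M gauss d) (\<lambda>z. f (fst z) * g (snd z)) (bimon l m)
    = L2_inner (gauss d) f (xmon l) * L2_inner (gauss d) g (xmon m)"
proof -
  have sq: "sqint (gauss d) (xmon l)" "sqint (gauss d) (xmon m)"
    using l by (auto intro: polys_sqint xmon_in_polys)
  define u where "u = (\<lambda>x. f x * cnj (xmon l x))"
  define v where "v = (\<lambda>x. g x * cnj (xmon m x))"
  have "integrable (gauss d \<Otimes>\<^sub>M gauss d) (\<lambda>z. u (fst z) * v (snd z))"
    unfolding u_def v_def by (intro integrable_gauss_tensor integrable_inner f g sq)
  from gauss2.integral_fst'[OF this]
  have "(\<integral>z. u (fst z) * v (snd z) \<partial>(gauss d \<Otimes>\<^sub>M gauss d)) = (\<integral>x. u x \<partial>gauss d) * (\<integral>y. v y \<partial>gauss d)"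
    by simp
  moreover have "f (fst z) * g (snd z) * cnj (bimon l m z) = u (fst z) * v (snd z)" for z
    by (simp add: bimon_def u_def v_def)
  ultimately show ?thesis
    unfolding L2_inner_def by (simp only: u_def v_def)
qed

lemma bimon_sqint:
  assumes "set l \<subseteq> {..<d}" "set m \<subseteq> {..<d}"
  shows "sqint (gauss d \<Otimes>\<^sub>M gauss d) (bimon l m)"
  unfolding bimon_def[abs_def] using assms by (intro sqint_gauss_tensor) (auto intro: polys_sqint xmon_in_polys)

context rotation
begin

text \<open>After the change of variables, \<open>h\<close> becomes a polynomial of total degree at
  most \<open>n\<close> in two independent vectors, and pairing a tensor product with a monomial
  factors into moments. Applied with the zero pair this gives orthogonality, applied with
  projections it gives truncation.\<close>

lemma rotprod_inner_polys_cong: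
  assumes sq: "sqint (gauss d) f" "sqint (gauss d) g" "sqint (gauss d) f'" "sqint (gauss d) g'"
    and eq: "\<And>l m. set l \<subseteq> {..<d} \<Longrightarrow> set m \<subseteq> {..<d} \<Longrightarrow> length l + length m \<le> n \<Longrightarrow>
        L2_inner (gauss d) f (xmon l) * L2_inner (gauss d) g (xmon m)
        = L2_inner (gauss d) f' (xmon l) * L2_inner (gauss d) g' (xmon m)"
    and h: "h \<in> polys d n"
  shows "L2_inner (gauss d) (rotprod d a b f g) h = L2_inner (gauss d) (rotprod d a b f' g') h"
proof -
  let ?M = "gauss d \<Otimes>\<^sub>M gauss d"
  define D where "D = (\<lambda>z. f (fst z) * g (snd z) - f' (fst z) * g' (snd z))"
  have sqs: "sqint ?M (\<lambda>z. f (fst z) * g (snd z))" "sqint ?M (\<lambda>z. f' (fst z) * g' (snd z))"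
    by (intro sqint_gauss_tensor sq)+
  have "L2_inner ?M D (\<lambda>z. h (lc d a b (fst z) (snd z))) = 0"
  proof (rule cspan_orthogonal)
    show "(\<lambda>z. h (lc d a b (fst z) (snd z))) \<in> cspan {bimon l m | l m. set l \<subseteq> {..<d} \<and> set m \<subseteq> {..<d} \<and> length l + length m \<le> n}"
      using polys_lc(1)[OF h] by (simp add: bspan_def)
    show "sqint ?M D" unfolding D_def by (intro sqint_diff sqs)
    fix k assume "k \<in> {bimon l m | l m. set l \<subseteq> {..<d} \<and> set m \<subseteq> {..<d} \<and> length l + length m \<le> n}"
    then obtain l m where k: "k = bimon l m" "set l \<subseteq> {..<d}" "set m \<subseteq> {..<d}" "length l + length m \<le> n" by auto
    show sk: "sqint ?M k" using k by (simp add: bimon_sqint)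
    show "L2_inner ?M D k = 0"
      unfolding D_def using sk k eq[OF k(2-4)]
      by (simp add: L2_inner_diff_left sqs L2_inner_tensor_bimon sq)
  qed
  then show ?thesis
    using polys_sqint[OF h]
    by (simp add: D_def L2_inner_rotprod sq L2_inner_diff_left sqs sqint_rot_pair)
qed

end

section \<open>The chaos decomposition\<close>

text \<open>The target is finite-dimensional, so \<open>ex_orthogonal_projection\<close> provides a
  projection whose values are genuine polynomials; those for consecutive \<open>n\<close> differ by
  one chaos component.\<close>

definition lproj :: "nat \<Rightarrow> nat \<Rightarrow> ((nat \<Rightarrow> real) \<Rightarrow> complex) \<Rightarrow> ((nat \<Rightarrow> real) \<Rightarrow> complex)" where
  "lproj d n f = (SOME p. p \<in> plow d n \<and> (\<forall>q\<in>plow d n. L2_inner (gauss d) (\<lambda>x. f x - p x) q = 0))"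

lemma lproj:
  assumes f: "sqint (gauss d) f"
  shows lproj_plow: "lproj d n f \<in> plow d n"
    and lproj_orthogonal: "q \<in> plow d n \<Longrightarrow> L2_inner (gauss d) (\<lambda>x. f x - lproj d n f x) q = 0"
proof -
  let ?B = "xmon ` {l. set l \<subseteq> {..<d} \<and> length l < n}"
  have "{l. set l \<subseteq> {..<d} \<and> length l < n} \<subseteq> {l. set l \<subseteq> {..<d} \<and> length l \<le> n}" by auto
  then have fin: "finite ?B"
    using finite_lists_length_le[of "{..<d}" n] by (auto intro: finite_subset)
  have sB: "sqint (gauss d) b" if "b \<in> ?B" for b
    using that by (auto intro: polys_sqint xmon_in_polys)
  obtain p where p: "p \<in> plow d n" "\<forall>b\<in>?B. L2_inner (gauss d) (\<lambda>x. f x - p x) b = 0"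
    using ex_orthogonal_projection[OF fin sB f] unfolding plow_def by auto
  have sp: "sqint (gauss d) (\<lambda>x. f x - p x)" by (intro sqint_diff f plow_sqint[OF p(1)])
  have "\<forall>q\<in>plow d n. L2_inner (gauss d) (\<lambda>x. f x - p x) q = 0"
  proof
    fix q assume "q \<in> plow d n"
    then have "q \<in> cspan ?B" by (simp add: plow_def)
    then show "L2_inner (gauss d) (\<lambda>x. f x - p x) q = 0"
      by (rule cspan_orthogonal[OF _ sB sp]) (use p(2) in blast)+
  qed
  with p(1) have "\<exists>p. p \<in> plow d n \<and> (\<forall>q\<in>plow d n. L2_inner (gauss d) (\<lambda>x. f x - p x) q = 0)" by blast
  from someI_ex[OF this]
  show "lproj d n f \<in> plow d n" "q \<in> plow d n \<Longrightarrow> L2_inner (gauss d) (\<lambda>x. f x - lproj d n f x) q = 0"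
    by (auto simp: lproj_def)
qed

lemma lproj_inner:
  assumes f: "sqint (gauss d) f" and q: "q \<in> plow d n"
  shows "L2_inner (gauss d) (lproj d n f) q = L2_inner (gauss d) f q"
  using lproj_orthogonal[OF f q] L2_inner_diff_left[OF f plow_sqint[OF lproj_plow[OF f]] plow_sqint[OF q], of n]
  by simp

lemma sqn_orthogonal_le:
  assumes f: "sqint (gauss d) f" and p: "p \<in> plow d n" and q: "q \<in> plow d n"
    and orth: "\<And>h. h \<in> plow d n \<Longrightarrow> L2_inner (gauss d) (\<lambda>x. f x - p x) h = 0"
  shows "sqn (gauss d) (\<lambda>x. f x - p x) \<le> sqn (gauss d) (\<lambda>x. f x - q x)"
proof -
  have "sqn (gauss d) (\<lambda>x. (f x - p x) + (p x - q x)) = sqn (gauss d) (\<lambda>x. f x - p x) + sqn (gauss d) (\<lambda>x. p x - q x)"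
    by (intro sqn_pythagoras sqint_diff f plow_sqint[OF p] plow_sqint[OF q] orth plow_diff p q)
  then show ?thesis using sqn_nonneg[of "gauss d" "\<lambda>x. p x - q x"] by simp
qed

text \<open>An orthogonal projection is the best approximation in its space, so density of
  polynomials forces convergence. The sequence \<open>p\<close> is arbitrary because the lemma
  serves both \<open>lproj\<close> and the partial sums of the Wick series.\<close>

lemma orthogonal_polys_tendsto:
  assumes f: "sqint (gauss d) f" and p: "\<And>n. p n \<in> plow d (Suc n)"
    and orth: "\<And>n h. h \<in> plow d (Suc n) \<Longrightarrow> L2_inner (gauss d) (\<lambda>x. f x - p n x) h = 0"
  shows "(\<lambda>n. sqn (gauss d) (\<lambda>x. f x - p n x)) \<longlonglongrightarrow> 0"
proof (rule order_tendstoI)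
  fix e :: real assume "0 < e"
  then obtain m q where q: "q \<in> polys d m" "sqn (gauss d) (\<lambda>x. f x - q x) < e"
    using polyL2D[OF polys_dense[OF f]] by blast
  have "sqn (gauss d) (\<lambda>x. f x - p n x) < e" if "n \<ge> m" for n
    using sqn_orthogonal_le[OF f p _ orth, of q n] polys_plow[OF _ q(1), of "Suc n"] that q(2) by fastforce
  then show "\<forall>\<^sub>F n in sequentially. sqn (gauss d) (\<lambda>x. f x - p n x) < e"
    unfolding eventually_sequentially by blast
next
  fix e :: real assume "e < 0"
  then show "\<forall>\<^sub>F n in sequentially. e < sqn (gauss d) (\<lambda>x. f x - p n x)"
    by (intro always_eventually allI) (rule less_le_trans[OF _ sqn_nonneg])
qed

text \<open>The order \<open>n\<close> chaos component of \<open>f\<close>, by a polynomial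
  representative; \<open>proj d n f\<close> is known only up to a null set.\<close>

definition hpart :: "nat \<Rightarrow> nat \<Rightarrow> ((nat \<Rightarrow> real) \<Rightarrow> complex) \<Rightarrow> ((nat \<Rightarrow> real) \<Rightarrow> complex)" where
  "hpart d n f x = lproj d (Suc n) f x - lproj d n f x"

text \<open>The polynomial members of the chaos of order \<open>n\<close>. The functions in
  \<open>chaos d n\<close> are exactly the square integrable ones almost everywhere equal to such a
  polynomial.\<close>

definition hchaos :: "nat \<Rightarrow> nat \<Rightarrow> ((nat \<Rightarrow> real) \<Rightarrow> complex) set" where
  "hchaos d n = {f \<in> polys d n. \<forall>q\<in>plow d n. L2_inner (gauss d) f q = 0}"

lemma hchaos_polys: "f \<in> hchaos d n \<Longrightarrow> f \<in> polys d n"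
  by (simp add: hchaos_def)

lemma hchaos_sqint: "f \<in> hchaos d n \<Longrightarrow> sqint (gauss d) f"
  by (rule polys_sqint[OF hchaos_polys])

lemma hchaos_orthogonal: "f \<in> hchaos d n \<Longrightarrow> q \<in> plow d n \<Longrightarrow> L2_inner (gauss d) f q = 0"
  by (simp add: hchaos_def)

lemma hchaos_orthogonal': "f \<in> hchaos d n \<Longrightarrow> q \<in> plow d n \<Longrightarrow> L2_inner (gauss d) q f = 0"
  using hchaos_orthogonal L2_inner_eq_0_commute by blast

lemma hchaos_diff: "f \<in> hchaos d n \<Longrightarrow> g \<in> hchaos d n \<Longrightarrow> (\<lambda>x. f x - g x) \<in> hchaos d n"
  by (auto simp: hchaos_def polys_diff L2_inner_diff_left polys_sqint plow_sqint)

lemma hchaos_cmult: "f \<in> hchaos d n \<Longrightarrow> (\<lambda>x. c * f x) \<in> hchaos d n"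
  by (auto simp: hchaos_def polys_cmult L2_inner_cmult_left)

lemma hpart_hchaos:
  assumes f: "sqint (gauss d) f"
  shows "hpart d n f \<in> hchaos d n"
  unfolding hchaos_def
proof (intro CollectI conjI ballI)
  have p: "lproj d (Suc n) f \<in> polys d n" "lproj d n f \<in> plow d n"
    using lproj_plow[OF f] by (auto simp: plow_Suc[symmetric])
  then show "hpart d n f \<in> polys d n"
    unfolding hpart_def[abs_def] by (intro polys_diff plow_polys[OF p(2)] p(1))
  fix q assume q: "q \<in> plow d n"
  then have "q \<in> plow d (Suc n)" using plow_mono[of n "Suc n" d] by auto
  with q show "L2_inner (gauss d) (hpart d n f) q = 0"
    unfolding hpart_def[abs_def]
    using p f by (simp add: L2_inner_diff_left polys_sqint plow_sqint lproj_inner)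
qed

lemma lproj_0: "sqint (gauss d) f \<Longrightarrow> lproj d 0 f = (\<lambda>x. 0)"
  using lproj_plow[of d f 0] by (simp add: plow_0)

lemma lproj_eq_sum_hpart: "sqint (gauss d) f \<Longrightarrow> lproj d n f x = (\<Sum>i<n. hpart d i f x)"
  by (induction n) (simp_all add: lproj_0 hpart_def)

section \<open>Closures and projections in terms of polynomial representatives\<close>

lemma L2_closureE:
  assumes "f \<in> L2_closure (gauss d) (polys d n)" "e > 0"
  shows "\<exists>g\<in>polys d n. sqn (gauss d) (\<lambda>x. f x - g x) < e"
proof -
  have f: "sqint (gauss d) f" using assms by (simp add: L2_closure_def Lp_mem_2)
  obtain g where g: "g \<in> polys d n" "Lp_norm (gauss d) 2 (\<lambda>x. f x - g x) < ennreal (sqrt e)"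
    using assms unfolding L2_closure_def by (auto dest: spec[of _ "sqrt e"])
  then have "sqn (gauss d) (\<lambda>x. f x - g x) < e"
    using f polys_sqint[OF g(1)] assms(2)
    by (simp add: Lp_norm_2 sqint_diff ennreal_less_iff sqn_nonneg)
  with g(1) show ?thesis by blast
qed

lemma L2_closure_sqint: "f \<in> L2_closure M S \<Longrightarrow> sqint M f"
  by (simp add: L2_closure_def Lp_mem_2)

lemma L2_closure_AE_eq:
  assumes "sqint (gauss d) f" "p \<in> polys d n" "AE x in gauss d. f x = p x"
  shows "f \<in> L2_closure (gauss d) (polys d n)"
proof -
  have "sqn (gauss d) (\<lambda>x. f x - p x) = sqn (gauss d) (\<lambda>x. 0)"
    using assms sqint_measurable[OF assms(1)] sqint_measurable[OF polys_sqint[OF assms(2)]]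
    by (intro sqn_AE_cong) auto
  then have "Lp_norm (gauss d) 2 (\<lambda>x. f x - p x) = 0"
    using assms by (simp add: Lp_norm_2 sqint_diff polys_sqint sqn_def)
  then show ?thesis
    unfolding L2_closure_def using assms by (auto simp: Lp_mem_2 intro!: bexI[of _ p])
qed

text \<open>A finite-dimensional space is closed: the projection is at least as close to
  \<open>f\<close> as every approximating polynomial, so its distance to \<open>f\<close> is
  0.\<close>

lemma L2_closure_polys_AE:
  assumes f: "f \<in> L2_closure (gauss d) (polys d n)"
  shows "AE x in gauss d. f x = lproj d (Suc n) f x"
proof -
  have sf: "sqint (gauss d) f" using f by (rule L2_closure_sqint)
  have "sqn (gauss d) (\<lambda>x. f x - lproj d (Suc n) f x) \<le> 0"
  proof (rule field_le_epsilon)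
    fix e :: real assume "e > 0"
    then obtain g where "g \<in> polys d n" "sqn (gauss d) (\<lambda>x. f x - g x) < e"
      using L2_closureE[OF f] by blast
    then show "sqn (gauss d) (\<lambda>x. f x - lproj d (Suc n) f x) \<le> 0 + e"
      using sqn_orthogonal_le[OF sf lproj_plow[OF sf] _ lproj_orthogonal[OF sf], of g "Suc n"]
      by (simp add: plow_Suc)
  qed
  then have "AE x in gauss d. f x - lproj d (Suc n) f x = 0"
    using sqn_nonneg[of "gauss d" "\<lambda>x. f x - lproj d (Suc n) f x"]
    by (intro sqn_eq_0_AE sqint_diff sf plow_sqint[OF lproj_plow[OF sf]]) auto
  then show ?thesis by simp
qed

lemma L2_closure_polys_eq:
  "f \<in> L2_closure (gauss d) (polys d n) \<longleftrightarrow> sqint (gauss d) f \<and> (\<exists>p\<in>polys d n. AE x in gauss d. f x = p x)"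
  using L2_closure_polys_AE[of f d n] L2_closure_AE_eq[of d f _ n] L2_closure_sqint[of f] lproj_plow[of d f "Suc n"]
  unfolding plow_Suc by blast

lemma chaos_iff: "f \<in> chaos d n \<longleftrightarrow> sqint (gauss d) f \<and> (\<exists>\<phi>\<in>hchaos d n. AE x in gauss d. f x = \<phi> x)"
proof
  assume f: "f \<in> chaos d n"
  then obtain p where p: "sqint (gauss d) f" "p \<in> polys d n" "AE x in gauss d. f x = p x"
    unfolding chaos_def L2_closure_polys_eq by auto
  have "L2_inner (gauss d) p q = 0" if q: "q \<in> plow d n" for q
  proof (cases n)
    case 0
    then show ?thesis using q by (simp add: plow_0)
  next
    case (Suc m)
    then have "q \<in> L2_closure (gauss d) (polys d m)"
      using q by (intro L2_closure_AE_eq[of d q q]) (auto simp: plow_Suc polys_sqint)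
    then have "L2_inner (gauss d) f q = 0" using f Suc by (simp add: chaos_def)
    then show ?thesis
      using L2_inner_AE_cong[of f "gauss d" p q] p polys_sqint[OF p(2)] plow_sqint[OF q] by (auto dest: sqint_measurable)
  qed
  with p show "sqint (gauss d) f \<and> (\<exists>\<phi>\<in>hchaos d n. AE x in gauss d. f x = \<phi> x)"
    by (auto simp: hchaos_def)
next
  assume "sqint (gauss d) f \<and> (\<exists>\<phi>\<in>hchaos d n. AE x in gauss d. f x = \<phi> x)"
  then obtain \<phi> where f: "sqint (gauss d) f" and \<phi>: "\<phi> \<in> hchaos d n" "AE x in gauss d. f x = \<phi> x" by auto
  have "f \<in> L2_closure (gauss d) (polys d n)"
    using L2_closure_AE_eq[OF f hchaos_polys[OF \<phi>(1)] \<phi>(2)] .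
  moreover have "L2_inner (gauss d) f g = 0" if n: "n > 0" and g: "g \<in> L2_closure (gauss d) (polys d (n - 1))" for g
  proof -
    obtain q where q: "sqint (gauss d) g" "q \<in> polys d (n - 1)" "AE x in gauss d. g x = q x"
      using g unfolding L2_closure_polys_eq by auto
    note [measurable] = sqint_measurable[OF f] sqint_measurable[OF q(1)] sqint_measurable[OF hchaos_sqint[OF \<phi>(1)]]
      sqint_measurable[OF polys_sqint[OF q(2)]]
    have "L2_inner (gauss d) f g = L2_inner (gauss d) \<phi> q"
      unfolding L2_inner_def using \<phi>(2) q(3) by (intro integral_cong_AE) auto
    also have "\<dots> = 0"
      using polys_plow[OF _ q(2), of n] n by (intro hchaos_orthogonal[OF \<phi>(1)]) auto
    finally show ?thesis .
  qed
  ultimately show "f \<in> chaos d n" by (simp add: chaos_def)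
qed

text \<open>\<open>\<phi>\<close> witnesses that the choice in \<open>proj\<close> has the defining
  property, and it is unique: the difference of two candidates lies in the chaos and is orthogonal
  to the chaos, hence to itself.\<close>

lemma proj_AE_eq:
  assumes f: "sqint (gauss d) f" and \<phi>: "\<phi> \<in> hchaos d n"
    and orth: "\<And>\<psi>. \<psi> \<in> hchaos d n \<Longrightarrow> L2_inner (gauss d) (\<lambda>x. f x - \<phi> x) \<psi> = 0"
  shows "sqint (gauss d) (proj d n f)" "AE x in gauss d. proj d n f x = \<phi> x"
proof -
  have s\<phi>: "sqint (gauss d) \<phi>" by (rule hchaos_sqint[OF \<phi>])
  have ch: "\<phi> \<in> chaos d n" unfolding chaos_iff using s\<phi> \<phi> by auto
  have orth': "L2_inner (gauss d) (\<lambda>x. f x - \<phi> x) h = 0" if h: "h \<in> chaos d n" for h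
  proof -
    obtain \<psi> where \<psi>: "\<psi> \<in> hchaos d n" "AE x in gauss d. h x = \<psi> x" "sqint (gauss d) h"
      using h unfolding chaos_iff by auto
    have "L2_inner (gauss d) h (\<lambda>x. f x - \<phi> x) = L2_inner (gauss d) \<psi> (\<lambda>x. f x - \<phi> x)"
      using \<psi> hchaos_sqint[OF \<psi>(1)] sqint_diff[OF f s\<phi>] by (intro L2_inner_AE_cong) (auto dest: sqint_measurable)
    then show ?thesis using orth[OF \<psi>(1)] L2_inner_eq_0_commute by metis
  qed
  have P: "proj d n f \<in> chaos d n \<and> (\<forall>h\<in>chaos d n. L2_inner (gauss d) (\<lambda>x. f x - proj d n f x) h = 0)"
    unfolding proj_def by (rule someI[of _ \<phi>]) (use ch orth' in auto)
  then obtain \<psi> where \<psi>: "\<psi> \<in> hchaos d n" "AE x in gauss d. proj d n f x = \<psi> x" and sp: "sqint (gauss d) (proj d n f)"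
    unfolding chaos_iff by auto
  show "sqint (gauss d) (proj d n f)" by fact
  define D where "D = (\<lambda>x. \<phi> x - proj d n f x)"
  have sD: "sqint (gauss d) D" unfolding D_def by (intro sqint_diff s\<phi> sp)
  have "AE x in gauss d. D x = \<phi> x - \<psi> x"
    using \<psi>(2) by eventually_elim (simp add: D_def)
  then have D: "D \<in> chaos d n"
    unfolding chaos_iff by (intro conjI sD bexI[OF _ hchaos_diff[OF \<phi> \<psi>(1)]])
  have eq: "D = (\<lambda>x. (f x - proj d n f x) - (f x - \<phi> x))" by (simp add: D_def fun_eq_iff)
  have "L2_inner (gauss d) D D
      = L2_inner (gauss d) (\<lambda>x. f x - proj d n f x) D - L2_inner (gauss d) (\<lambda>x. f x - \<phi> x) D"
    by (subst (1) eq) (rule L2_inner_diff_left[OF sqint_diff[OF f sp] sqint_diff[OF f s\<phi>] sD])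
  also have "\<dots> = 0"
    using bspec[OF conjunct2[OF P] D] orth'[OF D] by (simp only: diff_self)
  finally have "L2_inner (gauss d) D D = 0" .
  then have "AE x in gauss d. D x = 0"
    using sqn_eq_0_AE[OF sD] by (simp add: L2_inner_self)
  then show "AE x in gauss d. proj d n f x = \<phi> x" by eventually_elim (simp add: D_def)
qed

lemma proj_AE_hpart:
  assumes f: "sqint (gauss d) f"
  shows "sqint (gauss d) (proj d n f)" "AE x in gauss d. proj d n f x = hpart d n f x"
proof -
  have *: "L2_inner (gauss d) (\<lambda>x. f x - hpart d n f x) \<psi> = 0" if \<psi>: "\<psi> \<in> hchaos d n" for \<psi>
  proof -
    have eq: "(\<lambda>x. f x - hpart d n f x) = (\<lambda>x. (f x - lproj d (Suc n) f x) + lproj d n f x)"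
      by (simp add: hpart_def fun_eq_iff)
    have "L2_inner (gauss d) (\<lambda>x. f x - lproj d (Suc n) f x) \<psi> = 0"
      using lproj_orthogonal[OF f, of \<psi> "Suc n"] hchaos_polys[OF \<psi>] by (simp add: plow_Suc)
    moreover have "L2_inner (gauss d) (lproj d n f) \<psi> = 0"
      by (rule hchaos_orthogonal'[OF \<psi> lproj_plow[OF f]])
    ultimately show ?thesis
      unfolding eq
      by (simp add: L2_inner_add_left sqint_diff f plow_sqint[OF lproj_plow[OF f]] hchaos_sqint[OF \<psi>])
  qed
  show "sqint (gauss d) (proj d n f)" "AE x in gauss d. proj d n f x = hpart d n f x"
    using proj_AE_eq[OF f hpart_hchaos[OF f] *] by auto
qed

text \<open>Such an \<open>f\<close> is orthogonal to itself. Consequently an element of a chaos is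
  determined by its leading part, the principle behind the eigenvalue \<open>a ^ n\<close> of
  \<open>second_quant\<close>.\<close>

lemma hchaos_plow_AE_0:
  assumes "f \<in> hchaos d n" "f \<in> plow d n"
  shows "AE x in gauss d. f x = 0"
  using sqn_eq_0_AE[OF hchaos_sqint[OF assms(1)]] hchaos_orthogonal[OF assms]
  by (simp add: L2_inner_self)

lemma one_hchaos: "(\<lambda>x. 1) \<in> hchaos d 0"
  by (auto simp: hchaos_def one_in_polys plow_0)

context rotation
begin

text \<open>Comparison with the zero pair: on every monomial that a test polynomial of degree below
  \<open>i + j\<close> can produce, the product of moments is already 0.\<close>

lemma rotprod_hchaos:
  assumes \<phi>: "\<phi> \<in> hchaos d i" and \<psi>: "\<psi> \<in> hchaos d j"
  shows "rotprod d a b \<phi> \<psi> \<in> hchaos d (i + j)"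
  unfolding hchaos_def
proof (intro CollectI conjI ballI)
  show "rotprod d a b \<phi> \<psi> \<in> polys d (i + j)"
    using rotprod_polys(1)[OF hchaos_polys[OF \<phi>] hchaos_polys[OF \<psi>]] .
  fix q assume q: "q \<in> plow d (i + j)"
  show "L2_inner (gauss d) (rotprod d a b \<phi> \<psi>) q = 0"
  proof (cases "i + j")
    case 0
    then show ?thesis using q by (simp add: plow_0)
  next
    case (Suc n)
    have "L2_inner (gauss d) (rotprod d a b \<phi> \<psi>) q = L2_inner (gauss d) (rotprod d a b (\<lambda>x. 0) (\<lambda>x. 0)) q"
    proof (rule rotprod_inner_polys_cong)
      show "q \<in> polys d n" using q Suc by (simp add: plow_Suc)
      fix l m assume lm: "set l \<subseteq> {..<d}" "set m \<subseteq> {..<d}" "length l + length m \<le> n"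
      \<comment> \<open>Total degree at most \<open>i + j - 1\<close> leaves no room for degree
        \<open>i\<close> in one variable and \<open>j\<close> in the other.\<close>
      then consider "length l < i" | "length m < j" using Suc by linarith
      then show "L2_inner (gauss d) \<phi> (xmon l) * L2_inner (gauss d) \<psi> (xmon m)
          = L2_inner (gauss d) (\<lambda>x. 0) (xmon l) * L2_inner (gauss d) (\<lambda>x. 0) (xmon m)"
        using lm by cases (simp_all add: hchaos_orthogonal[OF \<phi>] hchaos_orthogonal[OF \<psi>] xmon_in_plow)
    qed (simp_all add: sqint_zero hchaos_sqint[OF \<phi>] hchaos_sqint[OF \<psi>])
    then show ?thesis by (simp add: rotprod_def[abs_def])
  qed
qed

text \<open>Moments of degree at most \<open>n\<close> do not change under projection onto
  polynomials of degree at most \<open>n\<close>, and \<open>h\<close> sees no others.\<close>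

lemma rotprod_lproj_inner:
  assumes f: "sqint (gauss d) f" and g: "sqint (gauss d) g" and h: "h \<in> polys d n"
  shows "L2_inner (gauss d) (rotprod d a b f g) h
    = L2_inner (gauss d) (rotprod d a b (lproj d (Suc n) f) (lproj d (Suc n) g)) h"
proof (rule rotprod_inner_polys_cong[OF f g])
  fix l m assume "set l \<subseteq> {..<d}" "set m \<subseteq> {..<d}" "length l + length m \<le> n"
  then have "xmon l \<in> plow d (Suc n)" "xmon m \<in> plow d (Suc n)" by (auto intro: xmon_in_plow)
  then show "L2_inner (gauss d) f (xmon l) * L2_inner (gauss d) g (xmon m)
     = L2_inner (gauss d) (lproj d (Suc n) f) (xmon l) * L2_inner (gauss d) (lproj d (Suc n) g) (xmon m)"
    by (simp add: lproj_inner f g)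
qed (auto intro: plow_sqint lproj_plow f g h)

lemma rotprod_lproj_sum:
  assumes f: "sqint (gauss d) f" and g: "sqint (gauss d) g"
  shows "rotprod d a b (lproj d m f) (lproj d n g) x = (\<Sum>i<m. \<Sum>j<n. rotprod d a b (hpart d i f) (hpart d j g) x)"
proof -
  have pf: "hpart d i f \<in> polys d m" if "i < m" for i
    using that polys_mono[OF _ hchaos_polys[OF hpart_hchaos[OF f]], of i m] by simp
  have pg: "hpart d j g \<in> polys d n" if "j < n" for j
    using that polys_mono[OF _ hchaos_polys[OF hpart_hchaos[OF g]], of j n] by simp
  have "lproj d m f = (\<lambda>x. \<Sum>i<m. hpart d i f x)" "lproj d n g = (\<lambda>x. \<Sum>j<n. hpart d j g x)"
    by (rule ext, rule lproj_eq_sum_hpart, fact)+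
  then have "rotprod d a b (lproj d m f) (lproj d n g) x = rotprod d a b (\<lambda>x. \<Sum>i<m. hpart d i f x) (\<lambda>x. \<Sum>j<n. hpart d j g x) x"
    by simp
  also have "\<dots> = (\<Sum>i<m. rotprod d a b (hpart d i f) (\<lambda>x. \<Sum>j<n. hpart d j g x) x)"
    by (rule rotprod_polys_sum_left[where n=m and m=n]) (auto intro: pf polys_sum pg)
  also have "\<dots> = (\<Sum>i<m. \<Sum>j<n. rotprod d a b (hpart d i f) (hpart d j g) x)"
    by (intro sum.cong refl rotprod_polys_sum_right[where n=n and m=m]) (auto intro: pf pg)
  finally show ?thesis .
qed

text \<open>Truncation leaves the pairs with \<open>i, j \<le> n\<close>. Those with
  \<open>i + j > n\<close> contribute 0, since their product lies in a chaos orthogonal to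
  \<open>h\<close>; the remaining triangle is summed along \<open>k = i + j\<close>, the shape of
  the series in \<open>wick\<close>.\<close>

lemma rotprod_lproj_inner_sum:
  assumes f: "sqint (gauss d) f" and g: "sqint (gauss d) g" and h: "h \<in> polys d n"
  shows "L2_inner (gauss d) (rotprod d a b f g) h
    = (\<Sum>k\<le>n. \<Sum>i\<le>k. L2_inner (gauss d) (rotprod d a b (hpart d i f) (hpart d (k - i) g)) h)"
proof -
  let ?X = "\<lambda>i j. rotprod d a b (hpart d i f) (hpart d j g)"
  have X: "?X i j \<in> hchaos d (i + j)" for i j
    by (intro rotprod_hchaos hpart_hchaos f g)
  have X0: "L2_inner (gauss d) (?X i j) h = 0" if "n < i + j" for i j
    by (rule hchaos_orthogonal[OF X polys_plow[OF that h]])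
  have "L2_inner (gauss d) (rotprod d a b f g) h = L2_inner (gauss d) (\<lambda>x. \<Sum>i<Suc n. \<Sum>j<Suc n. ?X i j x) h"
    unfolding rotprod_lproj_inner[OF f g h] rotprod_lproj_sum[OF f g, abs_def] ..
  also have "\<dots> = (\<Sum>i<Suc n. \<Sum>j<Suc n. L2_inner (gauss d) (?X i j) h)"
    by (simp only: L2_inner_sum_left sqint_sum hchaos_sqint[OF X] polys_sqint[OF h])
  also have "\<dots> = (\<Sum>(i, j)\<in>{..<Suc n} \<times> {..<Suc n}. L2_inner (gauss d) (?X i j) h)"
    by (rule sum.cartesian_product)
  also have "\<dots> = (\<Sum>(i, j)\<in>{(i, j). i + j \<le> n}. L2_inner (gauss d) (?X i j) h)"
  proof (rule sum.mono_neutral_right)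
    show "\<forall>z\<in>{..<Suc n} \<times> {..<Suc n} - {(i, j). i + j \<le> n}. (case z of (i, j) \<Rightarrow> L2_inner (gauss d) (?X i j) h) = 0"
    proof
      fix z assume z: "z \<in> {..<Suc n} \<times> {..<Suc n} - {(i, j). i + j \<le> n}"
      obtain i j where "z = (i, j)" by (cases z)
      with z X0[of i j] show "(case z of (i, j) \<Rightarrow> L2_inner (gauss d) (?X i j) h) = 0" by simp
    qed
  qed auto
  also have "\<dots> = (\<Sum>k\<le>n. \<Sum>i\<le>k. L2_inner (gauss d) (?X i (k - i)) h)"
    by (rule sum.triangle_reindex_eq)
  finally show ?thesis .
qed

text \<open>The partial sums are polynomials of degree at most \<open>n\<close> with the same inner
  products as \<open>T(f,g)\<close> against all such polynomials; they are its orthogonal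
  projections, and density applies.\<close>

lemma rotprod_sum_tendsto:
  assumes f: "sqint (gauss d) f" and g: "sqint (gauss d) g"
  shows "(\<lambda>n. sqn (gauss d) (\<lambda>x. rotprod d a b f g x - (\<Sum>k\<le>n. \<Sum>i\<le>k. rotprod d a b (hpart d i f) (hpart d (k - i) g) x))) \<longlonglongrightarrow> 0"
proof (rule orthogonal_polys_tendsto)
  let ?X = "\<lambda>i j. rotprod d a b (hpart d i f) (hpart d j g)"
  show T: "sqint (gauss d) (rotprod d a b f g)" by (rule sqint_rotprod[OF f g])
  have X: "?X i j \<in> hchaos d (i + j)" for i j
    by (intro rotprod_hchaos hpart_hchaos f g)
  have "(\<lambda>x. \<Sum>k\<le>n. \<Sum>i\<le>k. ?X i (k - i) x) \<in> polys d n" for n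
  proof (intro polys_sum)
    fix k i assume "k \<in> {..n}" "i \<in> {..k}"
    then show "?X i (k - i) \<in> polys d n"
      using polys_mono[OF _ hchaos_polys[OF X[of i "k - i"]], of n] by simp
  qed
  then show P: "(\<lambda>x. \<Sum>k\<le>n. \<Sum>i\<le>k. ?X i (k - i) x) \<in> plow d (Suc n)" for n
    by (simp add: plow_Suc)
  fix n h assume "h \<in> plow d (Suc n)"
  then have h: "h \<in> polys d n" by (simp add: plow_Suc)
  have "L2_inner (gauss d) (\<lambda>x. \<Sum>k\<le>n. \<Sum>i\<le>k. ?X i (k - i) x) h = (\<Sum>k\<le>n. \<Sum>i\<le>k. L2_inner (gauss d) (?X i (k - i)) h)"
    by (simp only: L2_inner_sum_left sqint_sum hchaos_sqint[OF X] polys_sqint[OF h])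
  then show "L2_inner (gauss d) (\<lambda>x. rotprod d a b f g x - (\<Sum>k\<le>n. \<Sum>i\<le>k. ?X i (k - i) x)) h = 0"
    using rotprod_lproj_inner_sum[OF f g h]
    by (simp add: L2_inner_diff_left T plow_sqint[OF P] polys_sqint[OF h])
qed

end

section \<open>Identification with the Wick product\<close>

lemma sqint_one: "sqint (gauss d) (\<lambda>x. 1)"
  by (rule sqint_const[OF gauss.finite_measure_axioms])

context rotation
begin

text \<open>The two sides lie in the same chaos and have the same leading part, so their difference
  is both of lower degree and orthogonal to lower degree.\<close>

lemma rotprod_one_hpart:
  assumes f: "sqint (gauss d) f"
  shows "AE x in gauss d. rotprod d a b (hpart d n f) (\<lambda>x. 1) x = complex_of_real (a ^ n) * hpart d n f x"
proof -
  note h = hpart_hchaos[OF f, of n]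
  let ?D = "\<lambda>x. rotprod d a b (hpart d n f) (\<lambda>x. 1) x - complex_of_real (a ^ n) * hpart d n f x"
  have "?D \<in> hchaos d n"
    using rotprod_hchaos[OF h one_hchaos] by (intro hchaos_diff hchaos_cmult h) simp
  moreover have "?D \<in> plow d n"
    using rotprod_polys(2)[OF hchaos_polys[OF h] one_in_polys[of d 0], of a b] by simp
  ultimately have "AE x in gauss d. ?D x = 0" by (rule hchaos_plow_AE_0)
  then show ?thesis by simp
qed

lemma rotprod_one_lproj:
  assumes f: "sqint (gauss d) f"
  shows "rotprod d a b (lproj d n f) (\<lambda>x. 1) x = (\<Sum>i<n. rotprod d a b (hpart d i f) (\<lambda>x. 1) x)"
proof -
  have "hpart d i f \<in> polys d n" if "i < n" for i
    using that polys_mono[OF _ hchaos_polys[OF hpart_hchaos[OF f]], of i n] by simp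
  moreover have "lproj d n f = (\<lambda>x. \<Sum>i<n. hpart d i f x)"
    by (rule ext, rule lproj_eq_sum_hpart, fact)
  ultimately show ?thesis
    using rotprod_polys_sum_left[OF _ one_in_polys[of d 0], of "{..<n}" "\<lambda>i. hpart d i f" n a b x] by simp
qed

text \<open>The partial sums of the series are \<open>T\<close> applied to truncations of
  \<open>f\<close>, and \<open>T\<close> with second argument 1 is an L^2 contraction; the error is
  at most that of the truncation.\<close>

lemma second_quant_AE:
  assumes f: "sqint (gauss d) f"
  shows sqint_second_quant: "sqint (gauss d) (second_quant d a f)"
    and AE_second_quant: "AE x in gauss d. second_quant d a f x = rotprod d a b f (\<lambda>x. 1) x"
proof -
  let ?F = "\<lambda>N x. \<Sum>n\<le>N. complex_of_real (a ^ n) * proj d n f x"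
  let ?T = "rotprod d a b f (\<lambda>x. 1)"
  let ?r = "\<lambda>N x. f x - lproj d (Suc N) f x"
  have F: "sqint (gauss d) (?F N)" for N
    by (intro sqint_sum sqint_cmult proj_AE_hpart[OF f])
  have T: "sqint (gauss d) ?T" by (rule sqint_rotprod(1)[OF f sqint_one])
  have lp: "sqint (gauss d) (lproj d n f)" for n by (rule plow_sqint[OF lproj_plow[OF f]])
  have r: "sqint (gauss d) (?r N)" for N by (intro sqint_diff f lp)
  have le: "sqn (gauss d) (\<lambda>x. ?F N x - ?T x) \<le> sqn (gauss d) (?r N)" for N
  proof -
    have "AE x in gauss d. \<forall>n. proj d n f x = hpart d n f x \<and>
        rotprod d a b (hpart d n f) (\<lambda>x. 1) x = complex_of_real (a ^ n) * hpart d n f x"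
      using proj_AE_hpart(2)[OF f] rotprod_one_hpart[OF f] by (simp add: AE_all_countable)
    moreover have "AE x in gauss d. rotprod d a b (?r N) (\<lambda>x. 1) x = ?T x - rotprod d a b (lproj d (Suc N) f) (\<lambda>x. 1) x"
      by (intro rotprod_diff_left sqint_imp_integrable gauss.finite_measure_axioms f lp sqint_one)
    \<comment> \<open>On a common full set the partial sum equals \<open>T\<close> of
      \<open>lproj d (Suc N) f\<close> and 1, so the error is minus \<open>T\<close> of the
      remainder \<open>?r N\<close> and 1.\<close>
    ultimately have "AE x in gauss d. ?F N x - ?T x = - 1 * rotprod d a b (?r N) (\<lambda>x. 1) x"
      by eventually_elim (simp add: rotprod_one_lproj[OF f] lessThan_Suc_atMost del: sum.lessThan_Suc)
    then have "sqn (gauss d) (\<lambda>x. ?F N x - ?T x) = sqn (gauss d) (\<lambda>x. - 1 * rotprod d a b (?r N) (\<lambda>x. 1) x)"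
      by (intro sqn_AE_cong sqint_measurable[OF sqint_diff[OF F T]]
           sqint_measurable[OF sqint_cmult[OF sqint_rotprod(1)[OF r sqint_one]]])
    also have "\<dots> = sqn (gauss d) (rotprod d a b (?r N) (\<lambda>x. 1))"
      unfolding sqn_cmult by simp
    also have "\<dots> \<le> sqn (gauss d) (?r N) * sqn (gauss d) (\<lambda>x. 1)"
      by (rule sqn_rotprod[OF r sqint_one])
    finally show ?thesis by (simp add: sqn_def gauss.prob_space)
  qed
  have "(\<lambda>N. sqn (gauss d) (\<lambda>x. ?F N x - ?T x)) \<longlonglongrightarrow> 0"
  proof (rule tendsto_sandwich[where f="\<lambda>_. 0" and h="\<lambda>N. sqn (gauss d) (?r N)"])
    show "(\<lambda>N. sqn (gauss d) (?r N)) \<longlonglongrightarrow> 0"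
      by (rule orthogonal_polys_tendsto[OF f lproj_plow[OF f] lproj_orthogonal[OF f]])
    show "\<forall>\<^sub>F N in sequentially. 0 \<le> sqn (gauss d) (\<lambda>x. ?F N x - ?T x)"
      by (rule always_eventually, rule allI, rule sqn_nonneg)
    show "\<forall>\<^sub>F N in sequentially. sqn (gauss d) (\<lambda>x. ?F N x - ?T x) \<le> sqn (gauss d) (?r N)"
      by (rule always_eventually, rule allI, rule le)
  qed (rule tendsto_const)
  from L2_lim_AE_eq[OF F T this]
  show "sqint (gauss d) (second_quant d a f)" "AE x in gauss d. second_quant d a f x = ?T x"
    unfolding second_quant_def by auto
qed

text \<open>A test function in chaos \<open>n\<close> sees only orders up to \<open>n\<close> of
  \<open>T(f,1)\<close>, because it has degree at most \<open>n\<close>, and of these only order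
  \<open>n\<close> itself, because it is orthogonal to lower degree.\<close>

lemma proj_second_quant:
  assumes f: "sqint (gauss d) f"
  shows "sqint (gauss d) (proj d n (second_quant d a f))"
    and "AE x in gauss d. proj d n (second_quant d a f) x = complex_of_real (a ^ n) * hpart d n f x"
proof -
  note h = hpart_hchaos[OF f]
  let ?T = "rotprod d a b f (\<lambda>x. 1)" and ?X = "\<lambda>i. rotprod d a b (hpart d i f) (\<lambda>x. 1)"
  have X: "?X i \<in> hchaos d i" for i
    using rotprod_hchaos[OF h one_hchaos, of i] by simp
  have S: "sqint (gauss d) (second_quant d a f)" by (rule sqint_second_quant[OF f])
  have T: "sqint (gauss d) ?T" by (rule sqint_rotprod(1)[OF f sqint_one])
  have lp: "sqint (gauss d) (lproj d n f)" for n by (rule plow_sqint[OF lproj_plow[OF f]])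
  have *: "L2_inner (gauss d) (\<lambda>x. second_quant d a f x - complex_of_real (a ^ n) * hpart d n f x) \<psi> = 0"
    if \<psi>: "\<psi> \<in> hchaos d n" for \<psi>
  proof -
    note s\<psi> = hchaos_sqint[OF \<psi>]
    have "L2_inner (gauss d) (second_quant d a f) \<psi> = L2_inner (gauss d) ?T \<psi>"
      by (intro L2_inner_AE_cong sqint_measurable[OF S] sqint_measurable[OF T] sqint_measurable[OF s\<psi>]
           AE_second_quant f)
    also have "\<dots> = L2_inner (gauss d) (rotprod d a b (lproj d (Suc n) f) (\<lambda>x. 1)) \<psi>"
    proof (rule rotprod_inner_polys_cong[OF f sqint_one lp sqint_one _ hchaos_polys[OF \<psi>]])
      fix l m :: "nat list" assume "set l \<subseteq> {..<d}" "length l + length m \<le> n"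
      then have "xmon l \<in> plow d (Suc n)" by (auto intro: xmon_in_plow)
      then show "L2_inner (gauss d) f (xmon l) * L2_inner (gauss d) (\<lambda>x. 1) (xmon m)
        = L2_inner (gauss d) (lproj d (Suc n) f) (xmon l) * L2_inner (gauss d) (\<lambda>x. 1) (xmon m)"
        by (simp add: lproj_inner f)
    qed
    also have "\<dots> = (\<Sum>i<Suc n. L2_inner (gauss d) (?X i) \<psi>)"
      unfolding rotprod_one_lproj[OF f, abs_def] by (rule L2_inner_sum_left) (auto intro: hchaos_sqint X s\<psi>)
    also have "\<dots> = L2_inner (gauss d) (?X n) \<psi>"
      using hchaos_orthogonal'[OF \<psi> polys_plow[OF _ hchaos_polys[OF X]]] by simp
    also have "\<dots> = L2_inner (gauss d) (\<lambda>x. complex_of_real (a ^ n) * hpart d n f x) \<psi>"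
      by (intro L2_inner_AE_cong rotprod_one_hpart f sqint_measurable[OF hchaos_sqint[OF X]]
           sqint_measurable[OF hchaos_sqint[OF hchaos_cmult[OF h]]] sqint_measurable[OF s\<psi>])
    finally show ?thesis
      by (simp only: L2_inner_diff_left[OF S hchaos_sqint[OF hchaos_cmult[OF h]] s\<psi>] diff_self)
  qed
  show "sqint (gauss d) (proj d n (second_quant d a f))"
    "AE x in gauss d. proj d n (second_quant d a f) x = complex_of_real (a ^ n) * hpart d n f x"
    using proj_AE_eq[OF S hchaos_cmult[OF h] *] by auto
qed

text \<open>Each summand of the Wick series projects \<open>a^i b^j\<close> times a product of chaos
  components, and this projection is \<open>T\<close> of the two components; the series is then the
  chaos expansion of \<open>T(f,g)\<close>.\<close>

lemma wick_second_quant_AE: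
  assumes f: "sqint (gauss d) f" and g: "sqint (gauss d) g"
  shows "sqint (gauss d) (wick d (second_quant d a f) (second_quant d b g))"
    and "AE x in gauss d. wick d (second_quant d a f) (second_quant d b g) x = rotprod d a b f g x"
proof -
  \<comment> \<open>Supplies the facts on \<open>second_quant d b\<close>, needed for
    \<open>g\<close>.\<close>
  interpret ba: rotation b a
    by standard (use a_pos b_pos ab1 in auto)
  let ?F = "second_quant d a f" and ?G = "second_quant d b g"
  let ?X = "\<lambda>i j. rotprod d a b (hpart d i f) (hpart d j g)"
  let ?P = "\<lambda>i j y. proj d i ?F y * proj d j ?G y"
  have X: "?X i j \<in> hchaos d (i + j)" for i j
    by (intro rotprod_hchaos hpart_hchaos f g)
  have proj: "sqint (gauss d) (proj d (i + j) (?P i j)) \<and> (AE x in gauss d. proj d (i + j) (?P i j) x = ?X i j x)" for i j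
  proof -
    let ?Q = "\<lambda>x. complex_of_real (a ^ i * b ^ j) * (hpart d i f x * hpart d j g x)"
    have hf: "hpart d i f \<in> polys d i" and hg: "hpart d j g \<in> polys d j"
      by (intro hchaos_polys hpart_hchaos f g)+
    have Q: "sqint (gauss d) ?Q"
      by (intro sqint_cmult polys_sqint[OF polys_mult[OF hf hg]])
    have meas: "?P i j \<in> borel_measurable (gauss d)"
      using sqint_measurable[OF proj_second_quant(1)[OF f]] sqint_measurable[OF ba.proj_second_quant(1)[OF g]]
      by (rule borel_measurable_times)
    have PQ: "AE x in gauss d. ?P i j x = ?Q x"
      using proj_second_quant(2)[OF f, of i] ba.proj_second_quant(2)[OF g, of j]
      by eventually_elim simp
    have P: "sqint (gauss d) (?P i j)"
      by (rule sqint_AE_cong[OF Q meas]) (use PQ in auto)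
    have "L2_inner (gauss d) (\<lambda>x. ?P i j x - ?X i j x) \<psi> = 0" if \<psi>: "\<psi> \<in> hchaos d (i + j)" for \<psi>
    proof -
      note s\<psi> = hchaos_sqint[OF \<psi>]
      have "L2_inner (gauss d) (?P i j) \<psi> = L2_inner (gauss d) ?Q \<psi>"
        by (intro L2_inner_AE_cong PQ meas sqint_measurable[OF Q] sqint_measurable[OF s\<psi>])
      \<comment> \<open>\<open>X\<close> lies in the chaos of order \<open>i + j\<close> and differs
        from \<open>Q\<close> by lower degree, so \<open>X\<close> is the projection of
        \<open>Q\<close>.\<close>
      moreover have "L2_inner (gauss d) (\<lambda>x. ?X i j x - ?Q x) \<psi> = 0"
        by (rule hchaos_orthogonal'[OF \<psi> rotprod_polys(2)[OF hf hg]])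
      ultimately show ?thesis
        by (simp only: L2_inner_diff_left[OF P hchaos_sqint[OF X] s\<psi>] L2_inner_diff_left[OF hchaos_sqint[OF X] Q s\<psi>]) simp
    qed
    from proj_AE_eq[OF P X this] show ?thesis by blast
  qed
  have projk: "sqint (gauss d) (proj d k (?P i (k - i)))" "AE x in gauss d. proj d k (?P i (k - i)) x = ?X i (k - i) x"
    if "i \<le> k" for i k
    using proj[of i "k - i"] that by auto
  let ?W = "\<lambda>K x. \<Sum>k\<le>K. \<Sum>i\<le>k. proj d k (?P i (k - i)) x"
  let ?V = "\<lambda>K x. \<Sum>k\<le>K. \<Sum>i\<le>k. ?X i (k - i) x"
  have W: "sqint (gauss d) (?W K)" for K
    by (intro sqint_sum projk) auto
  have V: "sqint (gauss d) (?V K)" for K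
    by (intro sqint_sum hchaos_sqint[OF X])
  have T: "sqint (gauss d) (rotprod d a b f g)" by (rule sqint_rotprod(1)[OF f g])
  have "AE x in gauss d. i \<le> k \<longrightarrow> proj d k (?P i (k - i)) x = ?X i (k - i) x" for i k
    by (cases "i \<le> k") (use projk(2)[of i k] in simp_all)
  \<comment> \<open>The exceptional sets of countably many summands are merged into one null set,
    valid for all partial sums.\<close>
  then have "AE x in gauss d. \<forall>k i. i \<le> k \<longrightarrow> proj d k (?P i (k - i)) x = ?X i (k - i) x"
    unfolding AE_all_countable by blast
  then have "AE x in gauss d. \<forall>K. ?W K x = ?V K x"
    by eventually_elim simp
  then have "AE x in gauss d. ?W K x - rotprod d a b f g x = ?V K x - rotprod d a b f g x" for K
    by eventually_elim simp
  then have "sqn (gauss d) (\<lambda>x. ?W K x - rotprod d a b f g x) = sqn (gauss d) (\<lambda>x. rotprod d a b f g x - ?V K x)" for K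
    by (subst (2) sqn_minus_commute)
       (intro sqn_AE_cong sqint_measurable[OF sqint_diff[OF W T]] sqint_measurable[OF sqint_diff[OF V T]])
  then have "(\<lambda>K. sqn (gauss d) (\<lambda>x. ?W K x - rotprod d a b f g x)) \<longlonglongrightarrow> 0"
    using rotprod_sum_tendsto[OF f g] by simp
  from L2_lim_AE_eq[OF W T this]
  show "sqint (gauss d) (wick d ?F ?G)" "AE x in gauss d. wick d ?F ?G x = rotprod d a b f g x"
    unfolding wick_def by auto
qed

end

section \<open>The space L^1 and the continuous extension\<close>

lemma Lp_norm_1: "Lp_norm M 1 f = (\<integral>\<^sup>+x. ennreal (norm (f x)) \<partial>M)"
proof -
  have "(\<integral>\<^sup>+x. ennreal (norm (f x) powr 1) \<partial>M) = (\<integral>\<^sup>+x. ennreal (norm (f x)) \<partial>M)" by simp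
  then show ?thesis
    unfolding Lp_norm_def by (auto simp: Let_def less_top)
qed

lemma Lp_mem_1: "Lp_mem M 1 f \<longleftrightarrow> integrable M f"
  by (simp add: Lp_mem_def Lp_norm_1 integrable_iff_bounded)

lemma Lp_norm_1_triangle:
  assumes [measurable]: "f \<in> borel_measurable M" "g \<in> borel_measurable M"
  shows "Lp_norm M 1 (\<lambda>x. f x + g x) \<le> Lp_norm M 1 f + Lp_norm M 1 g"
proof -
  have "(\<integral>\<^sup>+x. ennreal (norm (f x + g x)) \<partial>M) \<le> (\<integral>\<^sup>+x. ennreal (norm (f x)) + ennreal (norm (g x)) \<partial>M)"
    by (intro nn_integral_mono) (simp add: norm_triangle_ineq flip: ennreal_plus)
  then show ?thesis by (simp add: Lp_norm_1 nn_integral_add)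
qed

lemma Lp_norm_1_minus: "Lp_norm M 1 (\<lambda>x. f x - g x) = Lp_norm M 1 (\<lambda>x. g x - f x)"
  by (simp add: Lp_norm_1 norm_minus_commute)

lemma Lp_norm_AE_cong:
  assumes [measurable]: "f \<in> borel_measurable M" "g \<in> borel_measurable M" and eq: "AE x in M. f x = g x"
  shows "Lp_norm M p f = Lp_norm M p g"
proof -
  have "esssup M (\<lambda>x. ennreal (norm (f x))) = esssup M (\<lambda>x. ennreal (norm (g x)))"
    using eq by (intro esssup_AE_cong) auto
  moreover have "(\<integral>\<^sup>+x. ennreal (norm (f x) powr r) \<partial>M) = (\<integral>\<^sup>+x. ennreal (norm (g x) powr r) \<partial>M)" for r
    using eq by (intro nn_integral_cong_AE) auto
  ultimately show ?thesis by (simp add: Lp_norm_def)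
qed

lemma Lp_norm_1_eq_0_AE:
  assumes [measurable]: "f \<in> borel_measurable M" "g \<in> borel_measurable M" and "Lp_norm M 1 (\<lambda>x. f x - g x) = 0"
  shows "AE x in M. f x = g x"
proof -
  have "AE x in M. ennreal (norm (f x - g x)) = 0"
    using assms(3) by (subst nn_integral_0_iff_AE[symmetric]) (simp_all add: Lp_norm_1)
  then show ?thesis by (simp add: ennreal_eq_0_iff)
qed

text \<open>Provides square integrable sequences converging in L^1. Their existence is what makes
  the condition in \<open>wick_uv_ext\<close> pin down its value.\<close>

lemma (in finite_measure) truncation_tendsto:
  fixes f :: "'a \<Rightarrow> complex"
  assumes f: "integrable M f"
  defines "F \<equiv> \<lambda>k x. if norm (f x) \<le> real k then f x else 0"
  shows "\<And>k. sqint M (F k)" "(\<lambda>k. Lp_norm M 1 (\<lambda>x. F k x - f x)) \<longlonglongrightarrow> 0"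
proof -
  have [measurable]: "f \<in> borel_measurable M" using f by auto
  have meas [measurable]: "F k \<in> borel_measurable M" for k unfolding F_def by measurable
  show "sqint M (F k)" for k
    by (rule sqint_bound[OF meas sqint_const[OF finite_measure_axioms, of "complex_of_real k"], of _ 1])
       (auto simp: F_def)
  have int: "integrable M (\<lambda>x. F k x - f x)" for k
    using f by (rule Bochner_Integration.integrable_bound) (auto simp: F_def)
  have "(\<lambda>k. \<integral>x. norm (F k x - f x) \<partial>M) \<longlonglongrightarrow> (\<integral>x. 0 \<partial>M)"
  proof (rule integral_dominated_convergence)
    show "integrable M (\<lambda>x. norm (f x))" using f by simp
    show "AE x in M. (\<lambda>k. norm (F k x - f x)) \<longlonglongrightarrow> 0"
    proof (rule AE_I2)
      fix x
      obtain k0 where "norm (f x) \<le> real k0" using real_arch_simple by blast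
      then have "norm (F k x - f x) = 0" if "k \<ge> k0" for k
        using that by (simp add: F_def)
      then show "(\<lambda>k. norm (F k x - f x)) \<longlonglongrightarrow> 0"
        by (intro tendsto_eventually) (auto simp: eventually_sequentially)
    qed
    show "AE x in M. norm (norm (F k x - f x)) \<le> norm (f x)" for k by (auto simp: F_def)
  qed auto
  then have "(\<lambda>k. ennreal (\<integral>x. norm (F k x - f x) \<partial>M)) \<longlonglongrightarrow> ennreal 0" by (intro tendsto_ennrealI) simp
  then show "(\<lambda>k. Lp_norm M 1 (\<lambda>x. F k x - f x)) \<longlonglongrightarrow> 0"
    using int by (simp add: Lp_norm_1 nn_integral_eq_integral)
qed

context rotation
begin

lemma Lp_norm_1_rotprod:
  assumes "f \<in> borel_measurable (gauss d)" "g \<in> borel_measurable (gauss d)"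
  shows "Lp_norm (gauss d) 1 (rotprod d a b f g) \<le> Lp_norm (gauss d) 1 f * Lp_norm (gauss d) 1 g"
  using nn_integral_rotprod_powr[OF assms, of 1] by (simp add: Lp_norm_1)

lemma integrable_rotprod:
  assumes f: "integrable (gauss d) f" and g: "integrable (gauss d) g"
  shows "integrable (gauss d) (rotprod d a b f g)"
proof -
  have "Lp_norm (gauss d) 1 f * Lp_norm (gauss d) 1 g < \<top>"
    using f g by (simp add: Lp_mem_1[symmetric] Lp_mem_def ennreal_mult_less_top)
  then show ?thesis
    using f g Lp_norm_1_rotprod[of f d g] by (auto simp: Lp_mem_1[symmetric] Lp_mem_def intro: le_less_trans)
qed

lemma rotprod_tendsto_L1:
  assumes f: "integrable (gauss d) f" and g: "integrable (gauss d) g"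
    and fs: "\<And>k. integrable (gauss d) (fs k)" "(\<lambda>k. Lp_norm (gauss d) 1 (\<lambda>x. fs k x - f x)) \<longlonglongrightarrow> 0"
    and gs: "\<And>k. integrable (gauss d) (gs k)" "(\<lambda>k. Lp_norm (gauss d) 1 (\<lambda>x. gs k x - g x)) \<longlonglongrightarrow> 0"
  shows "(\<lambda>k. Lp_norm (gauss d) 1 (\<lambda>x. rotprod d a b (fs k) (gs k) x - rotprod d a b f g x)) \<longlonglongrightarrow> 0"
proof -
  let ?N = "Lp_norm (gauss d) 1" and ?T = "rotprod d a b"
  have fin: "?N f < \<top>" "?N g < \<top>" using f g by (simp_all add: Lp_mem_1[symmetric] Lp_mem_def)
  have [measurable]: "f \<in> borel_measurable (gauss d)" "g \<in> borel_measurable (gauss d)"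
    "fs k \<in> borel_measurable (gauss d)" "gs k \<in> borel_measurable (gauss d)" for k
    using f g fs(1)[of k] gs(1)[of k] by auto
  let ?df = "\<lambda>k x. fs k x - f x" and ?dg = "\<lambda>k x. gs k x - g x"
  have le: "?N (\<lambda>x. ?T (fs k) (gs k) x - ?T f g x) \<le> ?N (?df k) * (?N (?dg k) + ?N g) + ?N f * ?N (?dg k)" for k
  proof -
    \<comment> \<open>The usual splitting of a difference of bilinear values, here only almost
      everywhere because \<open>rotprod\<close> is additive only there.\<close>
    have "AE x in gauss d. ?T (fs k) (gs k) x - ?T f g x = ?T (?df k) (gs k) x + ?T f (?dg k) x"
      using rotprod_diff_left[OF fs(1) f gs(1), of k k] rotprod_diff_right[OF f gs(1) g, of k]
      by eventually_elim simp
    then have "?N (\<lambda>x. ?T (fs k) (gs k) x - ?T f g x) = ?N (\<lambda>x. ?T (?df k) (gs k) x + ?T f (?dg k) x)"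
      by (intro Lp_norm_AE_cong) measurable
    also have "\<dots> \<le> ?N (?T (?df k) (gs k)) + ?N (?T f (?dg k))"
      by (intro Lp_norm_1_triangle) measurable
    also have "\<dots> \<le> ?N (?df k) * ?N (gs k) + ?N f * ?N (?dg k)"
      by (intro add_mono Lp_norm_1_rotprod) measurable
    also have "?N (gs k) \<le> ?N (?dg k) + ?N g"
      using Lp_norm_1_triangle[of "?dg k" "gauss d" g] by simp
    finally show ?thesis by (simp add: mult_left_mono)
  qed
  \<comment> \<open>Multiplication of extended reals is discontinuous at the pair of 0 and \<top>;
    finiteness of the norms of \<open>f\<close> and \<open>g\<close> excludes it.\<close>
  have lim: "(\<lambda>k. ?N (?df k) * (?N (?dg k) + ?N g) + ?N f * ?N (?dg k)) \<longlonglongrightarrow> 0 * (0 + ?N g) + ?N f * 0"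
    using fin by (intro tendsto_add tendsto_mult_ennreal tendsto_const fs(2) gs(2)) auto
  show ?thesis
  proof (rule tendsto_sandwich[where f="\<lambda>_. 0" and h="\<lambda>k. ?N (?df k) * (?N (?dg k) + ?N g) + ?N f * ?N (?dg k)"])
    show "\<forall>\<^sub>F k in sequentially. ?N (\<lambda>x. ?T (fs k) (gs k) x - ?T f g x) \<le> ?N (?df k) * (?N (?dg k) + ?N g) + ?N f * ?N (?dg k)"
      by (rule always_eventually, rule allI, rule le)
    show "(\<lambda>k. ?N (?df k) * (?N (?dg k) + ?N g) + ?N f * ?N (?dg k)) \<longlonglongrightarrow> 0"
      using lim by simp
  qed (rule always_eventually, simp, rule tendsto_const)
qed

text \<open>\<open>T(f,g)\<close> has the defining property of the extension, so the choice has it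
  too; along the truncations of \<open>f\<close> and \<open>g\<close> both are limits of one
  sequence in L^1, hence equal almost everywhere.\<close>

lemma wick_ext_AE:
  assumes f: "integrable (gauss d) f" and g: "integrable (gauss d) g"
    and uv: "1 / sqrt u = a" "1 / sqrt v = b"
  shows "wick_uv_ext d u v f g \<in> borel_measurable (gauss d)"
    and "AE x in gauss d. wick_uv_ext d u v f g x = rotprod d a b f g x"
proof -
  let ?N = "Lp_norm (gauss d) 1" and ?T = "rotprod d a b"
  define P where "P F \<longleftrightarrow> Lp_mem (gauss d) 1 F \<and>
     (\<forall>fs gs. (\<forall>k. Lp_mem (gauss d) 2 (fs k) \<and> Lp_mem (gauss d) 2 (gs k)) \<and>
        (\<lambda>k. ?N (\<lambda>x. fs k x - f x)) \<longlonglongrightarrow> 0 \<and> (\<lambda>k. ?N (\<lambda>x. gs k x - g x)) \<longlonglongrightarrow> 0 \<longrightarrow>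
        (\<lambda>k. ?N (\<lambda>x. wick_uv d u v (fs k) (gs k) x - F x)) \<longlonglongrightarrow> 0)" for F
  note int = sqint_imp_integrable[OF gauss.finite_measure_axioms]
  have T: "integrable (gauss d) (?T f g)" by (rule integrable_rotprod[OF f g])
  have Tlim: "(\<lambda>k. ?N (\<lambda>x. wick_uv d u v (fs k) (gs k) x - ?T f g x)) \<longlonglongrightarrow> 0"
    if "\<And>k. sqint (gauss d) (fs k)" "\<And>k. sqint (gauss d) (gs k)"
      "(\<lambda>k. ?N (\<lambda>x. fs k x - f x)) \<longlonglongrightarrow> 0" "(\<lambda>k. ?N (\<lambda>x. gs k x - g x)) \<longlonglongrightarrow> 0" for fs gs
  proof -
    have "?N (\<lambda>x. wick_uv d u v (fs k) (gs k) x - ?T f g x) = ?N (\<lambda>x. ?T (fs k) (gs k) x - ?T f g x)" for k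
    proof (rule Lp_norm_AE_cong)
      note [measurable] = borel_measurable_integrable[OF T]
        sqint_measurable[OF wick_second_quant_AE(1)[OF that(1,2), of k k]] sqint_measurable[OF sqint_rotprod(1)[OF that(1,2), of k k]]
      show "(\<lambda>x. wick_uv d u v (fs k) (gs k) x - ?T f g x) \<in> borel_measurable (gauss d)"
        "(\<lambda>x. ?T (fs k) (gs k) x - ?T f g x) \<in> borel_measurable (gauss d)"
        unfolding wick_uv_def uv by measurable
      show "AE x in gauss d. wick_uv d u v (fs k) (gs k) x - ?T f g x = ?T (fs k) (gs k) x - ?T f g x"
        using wick_second_quant_AE(2)[OF that(1,2), of k k]
        unfolding wick_uv_def uv by eventually_elim simp
    qed
    then show ?thesis
      using rotprod_tendsto_L1[OF f g int[OF that(1)] that(3) int[OF that(2)] that(4)] by simp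
  qed
  then have "P (?T f g)" using T by (auto simp: P_def Lp_mem_1 Lp_mem_2)
  then have PE: "P (wick_uv_ext d u v f g)"
    unfolding wick_uv_ext_def P_def[symmetric] by (rule someI[of P])
  then have E: "integrable (gauss d) (wick_uv_ext d u v f g)" by (simp add: P_def Lp_mem_1)
  then show [measurable]: "wick_uv_ext d u v f g \<in> borel_measurable (gauss d)" by auto
  note [measurable] = borel_measurable_integrable[OF T]
  let ?fs = "\<lambda>k x. if norm (f x) \<le> real k then f x else 0" and ?gs = "\<lambda>k x. if norm (g x) \<le> real k then g x else 0"
  let ?w = "\<lambda>k. wick_uv d u v (?fs k) (?gs k)"
  note fs = gauss.truncation_tendsto[OF f] and gs = gauss.truncation_tendsto[OF g]
  have lim1: "(\<lambda>k. ?N (\<lambda>x. ?w k x - wick_uv_ext d u v f g x)) \<longlonglongrightarrow> 0"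
    using conjunct2[OF PE[unfolded P_def Lp_mem_2], rule_format, of ?fs ?gs] fs gs by simp
  have lim2: "(\<lambda>k. ?N (\<lambda>x. ?w k x - ?T f g x)) \<longlonglongrightarrow> 0"
    by (rule Tlim[OF fs(1) gs(1) fs(2) gs(2)])
  have [measurable]: "?w k \<in> borel_measurable (gauss d)" for k
    unfolding wick_uv_def uv by (rule sqint_measurable[OF wick_second_quant_AE(1)[OF fs(1) gs(1)]])
  have "?N (\<lambda>x. wick_uv_ext d u v f g x - ?T f g x)
      \<le> ?N (\<lambda>x. ?w k x - wick_uv_ext d u v f g x) + ?N (\<lambda>x. ?w k x - ?T f g x)" for k
    using Lp_norm_1_triangle[of "\<lambda>x. wick_uv_ext d u v f g x - ?w k x" "gauss d" "\<lambda>x. ?w k x - ?T f g x"]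
      Lp_norm_1_minus[of "gauss d" "?w k" "wick_uv_ext d u v f g"] by simp
  moreover have "(\<lambda>k. ?N (\<lambda>x. ?w k x - wick_uv_ext d u v f g x) + ?N (\<lambda>x. ?w k x - ?T f g x)) \<longlonglongrightarrow> 0 + 0"
    by (intro tendsto_add lim1 lim2)
  ultimately have "?N (\<lambda>x. wick_uv_ext d u v f g x - ?T f g x) \<le> 0 + 0"
    by (intro tendsto_lowerbound[where F=sequentially]) (auto intro!: always_eventually)
  then show "AE x in gauss d. wick_uv_ext d u v f g x = ?T f g x"
    by (intro Lp_norm_1_eq_0_AE) simp_all
qed

section \<open>The bound for every exponent\<close>

text \<open>For finite \<open>p\<close> the estimate of \<open>r\<close>-th powers is raised to the
  power \<open>1 / r\<close>. For \<open>p = \<top>\<close> the essential bounds hold almost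
  everywhere on the product space, and the rotation preserves null sets.\<close>

lemma Lp_norm_rotprod:
  assumes p: "1 \<le> p" and f: "Lp_mem (gauss d) p f" and g: "Lp_mem (gauss d) p g"
  shows "Lp_norm (gauss d) p (rotprod d a b f g) \<le> Lp_norm (gauss d) p f * Lp_norm (gauss d) p g"
proof (cases "p = \<top>")
  case True
  have [measurable]: "f \<in> borel_measurable (gauss d)" "g \<in> borel_measurable (gauss d)"
    using f g by (auto simp: Lp_mem_def)
  define A where "A = esssup (gauss d) (\<lambda>x. ennreal (norm (f x)))"
  define B where "B = esssup (gauss d) (\<lambda>x. ennreal (norm (g x)))"
  have "AE z in gauss d \<Otimes>\<^sub>M gauss d. ennreal (norm (f (fst (rot d a b z)))) * ennreal (norm (g (snd (rot d a b z)))) \<le> A * B"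
  proof (rule AE_rot)
    have "AE z in gauss d \<Otimes>\<^sub>M gauss d. ennreal (norm (f (fst z))) \<le> A" "AE z in gauss d \<Otimes>\<^sub>M gauss d. ennreal (norm (g (snd z))) \<le> B"
      unfolding A_def B_def by (intro AE_gauss_fst AE_gauss_snd esssup_AE)+
    then show "AE z in gauss d \<Otimes>\<^sub>M gauss d. ennreal (norm (f (fst z))) * ennreal (norm (g (snd z))) \<le> A * B"
      by eventually_elim (rule mult_mono; simp)
  qed
  \<comment> \<open>For almost every \<open>x\<close> the bound holds for almost every
    \<open>y\<close>, which is enough to estimate the integral over \<open>y\<close>.\<close>
  from gauss2.AE_pair[OF this] AE_space
  have "AE x in gauss d. ennreal (norm (rotprod d a b f g x)) \<le> A * B"
  proof eventually_elim
    case (elim x)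
    note [measurable] = elim(2)
    have "(\<lambda>y. f (lc d a b x y) * g (lc d b (-a) x y)) \<in> borel_measurable (gauss d)" by measurable
    from gauss.norm_integral_powr_le[OF this, of 1]
    have "ennreal (norm (rotprod d a b f g x)) \<le> (\<integral>\<^sup>+y. ennreal (norm (f (lc d a b x y)) * norm (g (lc d b (-a) x y))) \<partial>gauss d)"
      by (simp add: rotprod_def norm_mult)
    also have "\<dots> \<le> (\<integral>\<^sup>+y. A * B \<partial>gauss d)"
      using elim(1) by (intro nn_integral_mono_AE) (simp add: rot_def ennreal_mult)
    finally show ?case by (simp add: gauss.emeasure_space_1)
  qed
  then have "esssup (gauss d) (\<lambda>x. ennreal (norm (rotprod d a b f g x))) \<le> A * B"
    by (intro esssup_I) measurable
  then show ?thesis using True by (simp add: Lp_norm_def A_def B_def)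
next
  case False
  define r where "r = enn2real p"
  have r: "1 \<le> r" unfolding r_def using p False by (metis enn2real_1 enn2real_mono less_top)
  define I where "I h = (\<integral>\<^sup>+x. ennreal (norm (h x) powr r) \<partial>gauss d)" for h :: "(nat \<Rightarrow> real) \<Rightarrow> complex"
  have N: "Lp_norm (gauss d) p h = (if I h = \<top> then \<top> else ennreal (enn2real (I h) powr (1 / r)))" for h
    using False by (simp add: Lp_norm_def I_def r_def Let_def)
  have fin: "I f < \<top>" "I g < \<top>"
    using f g by (auto simp: Lp_mem_def N less_top split: if_splits)
  have le: "I (rotprod d a b f g) \<le> I f * I g"
    unfolding I_def using f g r by (intro nn_integral_rotprod_powr) (auto simp: Lp_mem_def)
  have fin': "I f * I g < \<top>" using fin by (simp add: ennreal_mult_less_top)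
  have "enn2real (I (rotprod d a b f g)) \<le> enn2real (I f) * enn2real (I g)"
    using enn2real_mono[OF le fin'] by (simp add: enn2real_mult)
  then have "enn2real (I (rotprod d a b f g)) powr (1 / r) \<le> enn2real (I f) powr (1 / r) * enn2real (I g) powr (1 / r)"
    using r by (simp add: powr_mono2 flip: powr_mult)
  moreover have "I f \<noteq> \<top>" "I g \<noteq> \<top>" "I (rotprod d a b f g) \<noteq> \<top>"
    using fin le_less_trans[OF le fin'] by auto
  ultimately show ?thesis
    by (simp add: N ennreal_mult[symmetric])
qed

end

text \<open>On a probability space \<open>t \<le> 1 + t powr r\<close> gives this for finite
  \<open>p\<close>, and the essential supremum is an integrable majorant for
  \<open>p = \<top>\<close>. It places the arguments in L^1, where the extension is identified with
  \<open>rotprod\<close>.\<close>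

lemma Lp_mem_imp_integrable:
  assumes p: "1 \<le> p" and f: "Lp_mem (gauss d) p f"
  shows "integrable (gauss d) f"
proof -
  have [measurable]: "f \<in> borel_measurable (gauss d)" using f by (simp add: Lp_mem_def)
  have "(\<integral>\<^sup>+x. ennreal (norm (f x)) \<partial>gauss d) < \<top>"
  proof (cases "p = \<top>")
    case True
    have "(\<integral>\<^sup>+x. ennreal (norm (f x)) \<partial>gauss d) \<le> (\<integral>\<^sup>+x. esssup (gauss d) (\<lambda>x. ennreal (norm (f x))) \<partial>gauss d)"
      by (intro nn_integral_mono_AE esssup_AE)
    also have "\<dots> < \<top>" using f True by (simp add: gauss.emeasure_space_1 Lp_mem_def Lp_norm_def)
    finally show ?thesis .
  next
    case False
    define r where "r = enn2real p"
    have r: "1 \<le> r" unfolding r_def using p False by (metis enn2real_1 enn2real_mono less_top)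
    have "t \<le> 1 + t powr r" if "0 \<le> t" for t :: real
    proof (cases "t \<le> 1")
      case False
      then have "t powr 1 \<le> t powr r" using r by (intro powr_mono) auto
      then show ?thesis using False by simp
    qed (simp add: add_increasing2)
    then have "ennreal (norm (f x)) \<le> ennreal (1 + norm (f x) powr r)" for x
      by (intro ennreal_leI) simp
    then have "(\<integral>\<^sup>+x. ennreal (norm (f x)) \<partial>gauss d) \<le> (\<integral>\<^sup>+x. 1 + ennreal (norm (f x) powr r) \<partial>gauss d)"
      by (intro nn_integral_mono) (simp add: ennreal_plus)
    also have "\<dots> = 1 + (\<integral>\<^sup>+x. ennreal (norm (f x) powr r) \<partial>gauss d)"
      by (subst nn_integral_add) (simp_all add: gauss.emeasure_space_1)
    also have "\<dots> < \<top>"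
      using f False by (auto simp: Lp_mem_def Lp_norm_def r_def Let_def less_top split: if_splits)
    finally show ?thesis .
  qed
  then show ?thesis by (simp add: integrable_iff_bounded)
qed

theorem theorem4p1:
  fixes d :: nat and p :: ennreal and u v :: real
    and \<phi> \<psi> :: "(nat \<Rightarrow> real) \<Rightarrow> complex"
  assumes "1 \<le> p"
    and "u > 0" and "v > 0" and "1 / u + 1 / v = 1"
    and "Lp_mem (gauss d) p \<phi>" and "Lp_mem (gauss d) p \<psi>"
  shows "Lp_mem (gauss d) p (wick_uv_ext d u v \<phi> \<psi>) \<and>
         Lp_norm (gauss d) p (wick_uv_ext d u v \<phi> \<psi>)
           \<le> Lp_norm (gauss d) p \<phi> * Lp_norm (gauss d) p \<psi>"
proof -
  interpret rotation "1 / sqrt u" "1 / sqrt v"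
    using assms by unfold_locales (simp_all add: power_divide)
  have int: "integrable (gauss d) \<phi>" "integrable (gauss d) \<psi>"
    using assms by (auto intro: Lp_mem_imp_integrable)
  note ext = wick_ext_AE[OF int refl refl]
  have "Lp_norm (gauss d) p (wick_uv_ext d u v \<phi> \<psi>) = Lp_norm (gauss d) p (rotprod d (1 / sqrt u) (1 / sqrt v) \<phi> \<psi>)"
    by (rule Lp_norm_AE_cong[OF ext(1) borel_measurable_integrable[OF integrable_rotprod[OF int]] ext(2)])
  also have "\<dots> \<le> Lp_norm (gauss d) p \<phi> * Lp_norm (gauss d) p \<psi>"
    using assms by (intro Lp_norm_rotprod)
  finally have le: "Lp_norm (gauss d) p (wick_uv_ext d u v \<phi> \<psi>) \<le> Lp_norm (gauss d) p \<phi> * Lp_norm (gauss d) p \<psi>" .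
  moreover have "Lp_norm (gauss d) p \<phi> * Lp_norm (gauss d) p \<psi> < \<top>"
    using assms(5,6) by (simp add: Lp_mem_def ennreal_mult_less_top)
  ultimately show ?thesis
    using ext(1) by (auto simp: Lp_mem_def intro: le_less_trans)
qed

end
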